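(* Let $n\ge2$, $j\ge1$, $j\not\equiv0\pmod n$. Let $\gamma_0\in\mathcal{M}_n(\mathbb{R})$ have rapidly decaying central affine curvatures $u_1^0,\ldots,u_{n-1}^0$, and let $g_0$ be the central affine moving frame along $\gamma_0$. Suppose $u=\sum_{i=1}^{n-1}u_ie_{in}$ is the solution of the $j$-th $A^{(1)}_{n-1}$-KdV flow $u_t=[\partial_x+b+u,Z_{j,0}(u)]$ with $u(x,0)=\sum_{i=1}^{n-1}u_i^0(x)e_{in}$. Let $g:\mathbb{R}^2\to SL(n,\mathbb{R})$ be the solution of $g^{-1}g_x=b+u$, $g^{-1}g_t=Z_{j,0}(u)$ with $g(0,0)=g_0(0)$. Then $\gamma=ge_1$ is the solution of the $j$-th central affine curve flow $\gamma_t=gZ_{j,0}(u)e_1$ with $\gamma(x,0)=\gamma_0(x)$. Moreover, the central affine curvatures of $\gamma(\cdot,t)$ are also rapidly decaying.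
   Context: $\mathcal{M}_n(\mathbb{R})$ is the set of smooth $\gamma:\mathbb{R}\to\mathbb{R}^n\setminus\{0\}$ with $\det(\gamma,\gamma_x,\ldots,\gamma_x^{(n-1)})=1$. For such $\gamma$ the central affine moving frame $g=(\gamma,\ldots,\gamma_x^{(n-1)})$ satisfies $g_x=g(b+u)$ with $b=\sum_{i=1}^{n-1}e_{i+1,i}$ and $u=\sum_{i=1}^{n-1}u_ie_{in}$, where $\gamma_x^{(n)}=u_1\gamma+\cdots+u_{n-1}\gamma_x^{(n-2)}$; $u_1,\ldots,u_{n-1}$ are the central affine curvatures. $V_n=\bigoplus_{i=1}^{n-1}\mathbb{R}e_{in}$, $e_1=(1,0,\ldots,0)^t$. A solution of the $j$-th central affine curve flow is a smooth $\gamma(x,t)$ with $\gamma(\cdot,t)\in\mathcal{M}_n(\mathbb{R})$ and $\gamma_t=gZ_{j,0}(u)e_1$, with $g(\cdot,t)$, $u(\cdot,t)$ the moving frame and curvature of $\gamma(\cdot,t)$. Rapidly decaying is meant in the usual sense (Schwartz class in $x$). The Cauchy problem for the $A^{(1)}_{n-1}$-KdV flows is solved by inverse scattering for an open dense set of rapidly decaying smooth initial data. Let $J=e_{1n}\lambda+b$. For smooth $V_n$-valued $u$, let $Y(u,\lambda)=e_{1n}\lambda+\sum_{i\le 0}Y_{1,i}(u)\lambda^i$ be the unique formal series with smooth $sl(n)$-valued coefficients satisfying $Y_x+[J+u,Y]=0$ and $Y^n=\lambda I_n$; its coefficients are differential polynomials in $u$ (in the variable $x$). Write $Y(u,\lambda)^j=\sum_i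 Y_{j,i}(u)\lambda^i$. There is a unique strictly upper triangular $\zeta_j(u)$ (entries differential polynomials in $u$) with $[\partial_x+b+u,\,Y_{j,0}(u)-\zeta_j(u)]\in V_n$, where $[\partial_x+A,B]=B_x+[A,B]$. Set $Z_{j,0}(u)=Y_{j,0}(u)-\zeta_j(u)$. *)

theory Defs
  imports
    "HOL-Analysis.Derivative"
    "HOL-Computational_Algebra.Formal_Laurent_Series"
    "Jordan_Normal_Form.Determinant"
begin

text \<open>Matrix and vector indices start at \<open>0\<close>: the matrix unit \<open>e\<^sub>i\<^sub>k\<close> of the mathematical text is
  \<open>E_mat n (i - 1) (k - 1)\<close>, and \<open>e\<^sub>1\<close> is \<open>unit_vec n 0\<close>.\<close>

subsection \<open>Smooth and rapidly decaying functions\<close>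

primrec Ck :: "nat \<Rightarrow> ('a::real_normed_vector \<Rightarrow> 'b::real_normed_vector) \<Rightarrow> bool" where
  "Ck 0 f \<longleftrightarrow> continuous_on UNIV f"
| "Ck (Suc k) f \<longleftrightarrow>
     (\<exists>f'. (\<forall>x. (f has_derivative f' x) (at x)) \<and> (\<forall>v. Ck k (\<lambda>x. f' x v)))"

text \<open>For a finite-dimensional domain, \<open>Ck k\<close> is the usual class of \<open>k\<close> times continuously
  differentiable functions; it is used for the domains \<open>\<real>\<close> and \<open>\<real> \<times> \<real>\<close> only.\<close>

definition smooth :: "('a::real_normed_vector \<Rightarrow> 'b::real_normed_vector) \<Rightarrow> bool" where
  "smooth f \<longleftrightarrow> (\<forall>k. Ck k f)"

definition rapidly_decaying :: "(real \<Rightarrow> real) \<Rightarrow> bool" where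
  "rapidly_decaying f \<longleftrightarrow>
     smooth f \<and> (\<forall>m k. bounded (range (\<lambda>x. x ^ m * (deriv ^^ k) f x)))"

definition smooth_vec :: "nat \<Rightarrow> ('a::real_normed_vector \<Rightarrow> real vec) \<Rightarrow> bool" where
  "smooth_vec n v \<longleftrightarrow> (\<forall>x. v x \<in> carrier_vec n) \<and> (\<forall>i<n. smooth (\<lambda>x. v x $ i))"

definition smooth_mat :: "nat \<Rightarrow> ('a::real_normed_vector \<Rightarrow> real mat) \<Rightarrow> bool" where
  "smooth_mat n A \<longleftrightarrow>
     (\<forall>x. A x \<in> carrier_mat n n) \<and> (\<forall>i<n. \<forall>k<n. smooth (\<lambda>x. A x $$ (i, k)))"

definition rapidly_decaying_mat :: "nat \<Rightarrow> (real \<Rightarrow> real mat) \<Rightarrow> bool" where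
  "rapidly_decaying_mat n A \<longleftrightarrow>
     (\<forall>x. A x \<in> carrier_mat n n) \<and> (\<forall>i<n. \<forall>k<n. rapidly_decaying (\<lambda>x. A x $$ (i, k)))"

definition vec_deriv :: "nat \<Rightarrow> (real \<Rightarrow> real vec) \<Rightarrow> real \<Rightarrow> real vec" where
  "vec_deriv n v x = vec n (\<lambda>i. deriv (\<lambda>y. v y $ i) x)"

definition mat_deriv :: "nat \<Rightarrow> (real \<Rightarrow> real mat) \<Rightarrow> real \<Rightarrow> real mat" where
  "mat_deriv n A x = mat n n (\<lambda>(i, k). deriv (\<lambda>y. A y $$ (i, k)) x)"

subsection \<open>Central affine curves\<close>

definition E_mat :: "nat \<Rightarrow> nat \<Rightarrow> nat \<Rightarrow> 'a::zero_neq_one mat" where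
  "E_mat n i k = mat n n (\<lambda>(r, c). if r = i \<and> c = k then 1 else 0)"

definition b_mat :: "nat \<Rightarrow> 'a::zero_neq_one mat" where
  "b_mat n = mat n n (\<lambda>(r, c). if r = Suc c then 1 else 0)"

definition V_space :: "nat \<Rightarrow> real mat set" where
  "V_space n = {mat n n (\<lambda>(r, c). if c = n - 1 \<and> r < n - 1 then v r else 0) | v. True}"

definition moving_frame :: "nat \<Rightarrow> (real \<Rightarrow> real vec) \<Rightarrow> real \<Rightarrow> real mat" where
  "moving_frame n \<gamma> x = mat n n (\<lambda>(i, k). (vec_deriv n ^^ k) \<gamma> x $ i)"

definition central_affine_curves :: "nat \<Rightarrow> (real \<Rightarrow> real vec) set" where
  "central_affine_curves n =
     {\<gamma>. smooth_vec n \<gamma> \<and> (\<forall>x. \<gamma> x \<noteq> 0\<^sub>v n) \<and> (\<forall>x. det (moving_frame n \<gamma> x) = 1)}"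

text \<open>The central affine curvatures \<open>u\<^sub>1, \<dots>, u\<^sub>n\<^sub>-\<^sub>1\<close> of a curve are collected in the
  matrix \<open>u = \<Sum> u\<^sub>i e\<^sub>i\<^sub>n\<close>, so \<open>u\<^sub>i\<close> is the entry with indices \<open>(i - 1, n - 1)\<close>.\<close>

definition curvature :: "nat \<Rightarrow> (real \<Rightarrow> real vec) \<Rightarrow> real \<Rightarrow> real mat" where
  "curvature n \<gamma> x = (THE U. U \<in> V_space n \<and>
     (\<forall>i<n. (vec_deriv n ^^ n) \<gamma> x $ i
            = (\<Sum>k<n - 1. U $$ (k, n - 1) * (vec_deriv n ^^ k) \<gamma> x $ i)))"

subsection \<open>The \<open>A\<^sup>(\<^sup>1\<^sup>)\<^sub>n\<^sub>-\<^sub>1\<close>-KdV flows\<close>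

text \<open>A formal series in \<open>\<lambda>\<close> with finitely many positive powers is a formal Laurent series in
  \<open>\<lambda>\<^sup>-\<^sup>1\<close>. Hence \<open>\<lambda>\<close> is \<open>fls_X_inv\<close>, and the coefficient of \<open>\<lambda>\<^sup>i\<close> is
  the Laurent coefficient with index \<open>- i\<close>.\<close>

definition lam_coeff :: "real fls mat \<Rightarrow> int \<Rightarrow> real mat" where
  "lam_coeff A i = map_mat (\<lambda>f. fls_nth f (- i)) A"

definition J_mat :: "nat \<Rightarrow> real fls mat" where
  "J_mat n = fls_X_inv \<cdot>\<^sub>m E_mat n 0 (n - 1) + b_mat n"

definition commutator :: "'a::ring mat \<Rightarrow> 'a mat \<Rightarrow> 'a mat" where
  "commutator A B = A * B - B * A"

text \<open>The commutator \<open>[\<partial>\<^sub>x + A, B] = B\<^sub>x + [A, B]\<close>.\<close>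

definition dx_commutator ::
    "nat \<Rightarrow> (real \<Rightarrow> real mat) \<Rightarrow> (real \<Rightarrow> real mat) \<Rightarrow> real \<Rightarrow> real mat" where
  "dx_commutator n A B x = mat_deriv n B x + commutator (A x) (B x)"

definition is_Y_series :: "nat \<Rightarrow> (real \<Rightarrow> real mat) \<Rightarrow> (real \<Rightarrow> real fls mat) \<Rightarrow> bool" where
  "is_Y_series n u Y \<longleftrightarrow>
     (\<forall>x. Y x \<in> carrier_mat n n) \<and>
     (\<forall>i. smooth_mat n (\<lambda>x. lam_coeff (Y x) i)) \<and>
     (\<forall>i x. (\<Sum>r<n. lam_coeff (Y x) i $$ (r, r)) = 0) \<and>
     (\<forall>x. lam_coeff (Y x) 1 = E_mat n 0 (n - 1)) \<and>
     (\<forall>i>1. \<forall>x. lam_coeff (Y x) i = 0\<^sub>m n n) \<and>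
     (\<forall>i x. mat_deriv n (\<lambda>y. lam_coeff (Y y) i) x
            + lam_coeff (commutator (J_mat n + map_mat fls_const (u x)) (Y x)) i = 0\<^sub>m n n) \<and>
     (\<forall>x. Y x ^\<^sub>m n = fls_X_inv \<cdot>\<^sub>m 1\<^sub>m n)"

definition Y_series :: "nat \<Rightarrow> (real \<Rightarrow> real mat) \<Rightarrow> real \<Rightarrow> real fls mat" where
  "Y_series n u = (THE Y. is_Y_series n u Y)"

definition Y_coeff :: "nat \<Rightarrow> nat \<Rightarrow> int \<Rightarrow> (real \<Rightarrow> real mat) \<Rightarrow> real \<Rightarrow> real mat" where
  "Y_coeff n j i u x = lam_coeff (Y_series n u x ^\<^sub>m j) i"

definition is_zeta :: "nat \<Rightarrow> nat \<Rightarrow> (real \<Rightarrow> real mat) \<Rightarrow> (real \<Rightarrow> real mat) \<Rightarrow> bool" where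
  "is_zeta n j u \<zeta> \<longleftrightarrow>
     smooth_mat n \<zeta> \<and>
     (\<forall>x. \<forall>r<n. \<forall>c\<le>r. \<zeta> x $$ (r, c) = 0) \<and>
     (\<forall>x. dx_commutator n (\<lambda>y. b_mat n + u y) (\<lambda>y. Y_coeff n j 0 u y - \<zeta> y) x \<in> V_space n)"

definition zeta :: "nat \<Rightarrow> nat \<Rightarrow> (real \<Rightarrow> real mat) \<Rightarrow> real \<Rightarrow> real mat" where
  "zeta n j u = (THE \<zeta>. is_zeta n j u \<zeta>)"

text \<open>The matrix \<open>Z\<^sub>j\<^sub>,\<^sub>0(u)\<close>.\<close>

definition Z_mat :: "nat \<Rightarrow> nat \<Rightarrow> (real \<Rightarrow> real mat) \<Rightarrow> real \<Rightarrow> real mat" where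
  "Z_mat n j u x = Y_coeff n j 0 u x - zeta n j u x"

text \<open>Functions of \<open>(x, t)\<close> are curried, with the space variable \<open>x\<close> first. The Cauchy problem for
  the KdV flows is posed in the class of functions that are rapidly decaying in \<open>x\<close> at every
  time \<open>t\<close>.\<close>

definition kdv_solution :: "nat \<Rightarrow> nat \<Rightarrow> (real \<Rightarrow> real \<Rightarrow> real mat) \<Rightarrow> bool" where
  "kdv_solution n j u \<longleftrightarrow>
     smooth_mat n (\<lambda>(x, t). u x t) \<and>
     (\<forall>x t. u x t \<in> V_space n) \<and>
     (\<forall>t. rapidly_decaying_mat n (\<lambda>x. u x t)) \<and>
     (\<forall>x t. mat_deriv n (\<lambda>s. u x s) t
            = dx_commutator n (\<lambda>y. b_mat n + u y t) (Z_mat n j (\<lambda>y. u y t)) x)"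

definition curve_flow_solution :: "nat \<Rightarrow> nat \<Rightarrow> (real \<Rightarrow> real \<Rightarrow> real vec) \<Rightarrow> bool" where
  "curve_flow_solution n j \<gamma> \<longleftrightarrow>
     smooth_vec n (\<lambda>(x, t). \<gamma> x t) \<and>
     (\<forall>t. (\<lambda>x. \<gamma> x t) \<in> central_affine_curves n) \<and>
     (\<forall>x t. vec_deriv n (\<lambda>s. \<gamma> x s) t
            = moving_frame n (\<lambda>y. \<gamma> y t) x
              *\<^sub>v (Z_mat n j (curvature n (\<lambda>y. \<gamma> y t)) x *\<^sub>v unit_vec n 0))"

text \<open>A smooth \<open>SL(n, \<real>)\<close>-valued \<open>g\<close> with \<open>g\<^sup>-\<^sup>1 g\<^sub>x = b + u\<close> and
  \<open>g\<^sup>-\<^sup>1 g\<^sub>t = Z\<^sub>j\<^sub>,\<^sub>0(u)\<close>, both equations multiplied by \<open>g\<close> from the left.\<close>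

definition frame_solution ::
    "nat \<Rightarrow> nat \<Rightarrow> (real \<Rightarrow> real \<Rightarrow> real mat) \<Rightarrow> (real \<Rightarrow> real \<Rightarrow> real mat) \<Rightarrow> bool" where
  "frame_solution n j u g \<longleftrightarrow>
     smooth_mat n (\<lambda>(x, t). g x t) \<and>
     (\<forall>x t. det (g x t) = 1) \<and>
     (\<forall>x t. mat_deriv n (\<lambda>y. g y t) x = g x t * (b_mat n + u x t)) \<and>
     (\<forall>x t. mat_deriv n (\<lambda>s. g x s) t = g x t * Z_mat n j (\<lambda>y. u y t) x)"

end

theory Submission
  imports "HOL-Analysis.Henstock_Kurzweil_Integration" Defs
begin

text \<open>If \<open>g\<^sub>x = g (b + u)\<close>, then the columns of \<open>g\<close> are the successive derivatives of \<open>\<gamma> = g e\<^sub>1\<close>, so \<open>g\<close>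
  is the moving frame of \<open>\<gamma>\<close> and \<open>u\<close> its curvature; the initial condition follows from the uniqueness of
  linear differential equations. For the uniqueness of \<open>\<gamma>\<close> one shows conversely that the curvature of any
  solution of the curve flow solves the KdV flow. This uses that \<open>Z\<^sub>j\<^sub>,\<^sub>0(u)\<close> exists for every smooth \<open>u\<close>, is
  smooth and satisfies \<open>[\<partial>\<^sub>x + b + u, Z\<^sub>j\<^sub>,\<^sub>0(u)] \<in> V\<^sub>n\<close>.

  The series \<open>Y\<close> is obtained as \<open>T J T\<^sup>-\<^sup>1\<close>, where \<open>T = I + \<dots>\<close> solves \<open>T\<^sub>x + (J + u) T = T J\<close> order by order
  in the principal grading; its uniqueness follows by comparing leading terms in that grading.\<close>

section \<open>Smooth functions\<close>

text \<open>\<open>Y_series\<close>, \<open>zeta\<close> and \<open>curvature\<close> are definite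
  descriptions, which say nothing, not even about dimensions, before unique existence is proved. The
  hierarchy has to be built for every smooth \<open>u\<close> in \<open>V_space n\<close>, since
  \<open>Z_mat\<close> is also applied to the curvature of an arbitrary solution of the curve flow.
  J is not homogeneous in lambda, but in the principal grading (degree c - r - n i for e_rc
  lambda^i) it is a pure shift of degree -1, while u has positive degree. Hence J dominates, and
  equations can be solved degree by degree. The obstacle is that ad J is not invertible: in each
  degree its kernel consists of the constant multiples of a power of J. For Y itself these constants
  would have to satisfy the differential equation and Y^n = lambda simultaneously. Passing to T
  removes this compatibility problem: its free constants are found by integration in x, always
  possible for smooth functions, and the equation, the zero trace and Y^n = lambda are all inherited
  from J by conjugation.\<close>

lemma Ck_SucD: "Ck (Suc k) f \<Longrightarrow> Ck k f"
proof (induction k arbitrary: f)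
  case 0
  then show ?case
    using has_derivative_continuous_on[of UNIV f] by (metis Ck.simps)
next
  case (Suc k)
  then show ?case by (metis Ck.simps(2))
qed

lemma Ck_const [simp]: "Ck k (\<lambda>x. c)"
proof (induction k arbitrary: c)
  case (Suc k)
  then show ?case by (auto intro!: exI[of _ "\<lambda>x v. 0"])
qed simp

lemma Ck_add: "Ck k f \<Longrightarrow> Ck k g \<Longrightarrow> Ck k (\<lambda>x. f x + g x)"
proof (induction k arbitrary: f g)
  case 0
  then show ?case by (auto intro: continuous_on_add)
next
  case (Suc k)
  obtain f' g' where "\<And>x. (f has_derivative f' x) (at x)" "\<And>v. Ck k (\<lambda>x. f' x v)"
    "\<And>x. (g has_derivative g' x) (at x)" "\<And>v. Ck k (\<lambda>x. g' x v)"
    using Suc.prems by auto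
  then show ?case
    using Suc.IH by (auto intro!: exI[of _ "\<lambda>x v. f' x v + g' x v"] has_derivative_add)
qed

lemma Ck_mult:
  fixes f g :: "'a::real_normed_vector \<Rightarrow> 'b::real_normed_algebra"
  shows "Ck k f \<Longrightarrow> Ck k g \<Longrightarrow> Ck k (\<lambda>x. f x * g x)"
proof (induction k arbitrary: f g)
  case 0
  then show ?case by (auto intro: continuous_on_mult)
next
  case (Suc k)
  obtain f' g' where "\<And>x. (f has_derivative f' x) (at x)" "\<And>v. Ck k (\<lambda>x. f' x v)"
    "\<And>x. (g has_derivative g' x) (at x)" "\<And>v. Ck k (\<lambda>x. g' x v)"
    using Suc.prems by auto
  moreover have "Ck k f" "Ck k g"
    using Suc.prems Ck_SucD by blast+
  ultimately show ?case
    using Suc.IH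
    by (auto intro!: exI[of _ "\<lambda>x v. f x * g' x v + f' x v * g x"] has_derivative_mult Ck_add)
qed

lemma Ck_comp_affine:
  assumes "bounded_linear L"
  shows "Ck k f \<Longrightarrow> Ck k (\<lambda>x. f (a + L x))"
proof (induction k arbitrary: f)
  case 0
  have "continuous_on UNIV (\<lambda>x. a + L x)"
    by (intro continuous_intros linear_continuous_on assms)
  then show ?case
    using 0 continuous_on_compose2[of UNIV f UNIV "\<lambda>x. a + L x"] by simp
next
  case (Suc k)
  obtain f' where f': "\<And>x. (f has_derivative f' x) (at x)" "\<And>v. Ck k (\<lambda>x. f' x v)"
    using Suc.prems by auto
  have "((\<lambda>x. a + L x) has_derivative L) (at x)" for x
    by (auto intro!: derivative_eq_intros bounded_linear_imp_has_derivative assms)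
  then have "((\<lambda>x. f (a + L x)) has_derivative (\<lambda>v. f' (a + L x) (L v))) (at x)" for x
    using f'(1) has_derivative_compose by blast
  then show ?case
    using Suc.IH f'(2) by (auto intro!: exI[of _ "\<lambda>x v. f' (a + L x) (L v)"])
qed

lemma smooth_const [simp]: "smooth (\<lambda>x. c)"
  and smooth_add: "smooth f \<Longrightarrow> smooth g \<Longrightarrow> smooth (\<lambda>x. f x + g x)"
  by (simp_all add: smooth_def Ck_add)

lemma smooth_mult:
  fixes f g :: "'a::real_normed_vector \<Rightarrow> 'b::real_normed_algebra"
  shows "smooth f \<Longrightarrow> smooth g \<Longrightarrow> smooth (\<lambda>x. f x * g x)"
  by (simp add: smooth_def Ck_mult)

lemma smooth_minus:
  fixes f :: "'a::real_normed_vector \<Rightarrow> real"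
  shows "smooth f \<Longrightarrow> smooth (\<lambda>x. - f x)"
  using smooth_mult[OF smooth_const[of "-1"], of f] by simp

lemma smooth_diff:
  fixes f g :: "'a::real_normed_vector \<Rightarrow> real"
  shows "smooth f \<Longrightarrow> smooth g \<Longrightarrow> smooth (\<lambda>x. f x - g x)"
  using smooth_add[OF _ smooth_minus] by simp

lemma smooth_sum:
  fixes f :: "'i \<Rightarrow> 'a::real_normed_vector \<Rightarrow> real"
  shows "(\<And>i. i \<in> I \<Longrightarrow> smooth (f i)) \<Longrightarrow> smooth (\<lambda>x. \<Sum>i\<in>I. f i x)"
  by (induction I rule: infinite_finite_induct) (auto intro: smooth_add)

lemma smooth_prod:
  fixes f :: "'i \<Rightarrow> 'a::real_normed_vector \<Rightarrow> real"
  shows "(\<And>i. i \<in> I \<Longrightarrow> smooth (f i)) \<Longrightarrow> smooth (\<lambda>x. \<Prod>i\<in>I. f i x)"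
  by (induction I rule: infinite_finite_induct) (auto intro: smooth_mult)

text \<open>Each \<open>Ck (Suc k)\<close> brings a derivative of its own; uniqueness of derivatives
  identifies them, so a single \<open>f'\<close> serves all orders.\<close>

lemma smooth_has_derivative:
  assumes "smooth f"
  obtains f' where "\<And>x. (f has_derivative f' x) (at x)" "\<And>v. smooth (\<lambda>x. f' x v)"
proof -
  have "Ck (Suc 0) f"
    using assms by (simp only: smooth_def)
  then obtain f' where f': "\<And>x. (f has_derivative f' x) (at x)"
    by auto
  moreover have "Ck k (\<lambda>x. f' x v)" for k v
  proof -
    have "Ck (Suc k) f"
      using assms by (simp only: smooth_def)
    then obtain h where h: "\<And>x. (f has_derivative h x) (at x)" "\<And>v. Ck k (\<lambda>x. h x v)"
      by auto
    have "h x = f' x" for x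
      using has_derivative_unique[OF h(1) f'] .
    then show ?thesis
      using h(2)[of v] by simp
  qed
  ultimately show thesis
    using that unfolding smooth_def by blast
qed

lemma smooth_continuous_on: "smooth f \<Longrightarrow> continuous_on UNIV f"
  using Ck.simps(1)[of f] by (simp only: smooth_def)

lemma smooth_deriv_real:
  fixes f :: "real \<Rightarrow> real"
  assumes "smooth f"
  shows "(f has_real_derivative deriv f x) (at x)" and "smooth (deriv f)"
proof -
  obtain f' where f': "\<And>x. (f has_derivative f' x) (at x)" "\<And>v. smooth (\<lambda>x. f' x v)"
    using smooth_has_derivative[OF assms] by blast
  have *: "(f has_real_derivative f' x 1) (at x)" for x
    using f'(1)[of x] has_derivative_bounded_linear[OF f'(1)[of x]]
    by (metis has_derivative_imp_has_field_derivative mult.commute mult_1 linear_simps(5)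
        real_scaleR_def)
  then have "deriv f = (\<lambda>x. f' x 1)"
    using DERIV_imp_deriv by blast
  then show "(f has_real_derivative deriv f x) (at x)" "smooth (deriv f)"
    using * f'(2) by simp_all
qed

lemma smooth_antiderivative:
  fixes f :: "real \<Rightarrow> real"
  assumes "\<And>x. (f has_real_derivative g x) (at x)" and "smooth g"
  shows "smooth f"
proof -
  have "Ck k f" for k
  proof (cases k)
    case 0
    then show ?thesis
      using assms(1) by (auto intro!: continuous_at_imp_continuous_on DERIV_isCont)
  next
    case (Suc k)
    have "Ck k (\<lambda>x. g x * v)" for v
      using assms(2) by (auto simp: smooth_def intro: Ck_mult)
    then show ?thesis
      using assms(1) unfolding has_field_derivative_def Suc
      by (auto intro!: exI[of _ "\<lambda>x v. g x * v"])
  qed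
  then show ?thesis by (simp add: smooth_def)
qed

lemma smooth_antiderivative_exists:
  fixes g :: "real \<Rightarrow> real"
  assumes "smooth g"
  obtains f where "smooth f" "deriv f = g"
proof -
  \<comment> \<open>At least one of the two intervals is empty or a point, so this is the oriented
    integral from 0 to \<open>x\<close>.\<close>
  define f where "f = (\<lambda>x. integral {0..x} g - integral {x..0} g)"
  have cont: "continuous_on A g" for A
    using smooth_continuous_on[OF assms] continuous_on_subset by blast
  have "(f has_real_derivative g x) (at x)" for x
  proof -
    \<comment> \<open>Near \<open>x\<close>, \<open>f\<close> differs by a constant from the
      integral with fixed lower end \<open>- a\<close>; the summand 1 keeps both \<open>x\<close>
      and 0 in the interior of \<open>{- a..a}\<close>.\<close>
    define a where "a = \<bar>x\<bar> + 1"
    have int: "g integrable_on {c..d}" for c d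
      by (intro integrable_continuous_real cont)
    have eq: "f y = integral {- a..y} g - integral {- a..0} g" if "y \<in> {- a<..<a}" for y
    proof (cases "y \<ge> 0")
      case True
      then show ?thesis
        using Henstock_Kurzweil_Integration.integral_combine[of "- a" 0 y g] that int
        by (cases "y = 0") (auto simp: f_def a_def)
    next
      case False
      then show ?thesis
        using Henstock_Kurzweil_Integration.integral_combine[of "- a" y 0 g] that int
        by (auto simp: f_def a_def)
    qed
    have "((\<lambda>y. integral {- a..y} g) has_real_derivative g x) (at x within {- a..a})"
      by (rule integral_has_real_derivative[OF cont]) (auto simp: a_def)
    moreover have "at x within {- a..a} = at x"
      by (rule at_within_interior) (auto simp: a_def)
    ultimately have "((\<lambda>y. integral {- a..y} g - integral {- a..0} g) has_real_derivative g x) (at x)"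
      by (auto intro!: derivative_eq_intros)
    then show ?thesis
      by (rule has_field_derivative_transform_within_open[where S = "{- a<..<a}"])
        (auto simp: eq a_def)
  qed
  moreover from this have "deriv f = g"
    by (intro ext DERIV_imp_deriv)
  ultimately show thesis
    using smooth_antiderivative[OF _ assms] that by auto
qed

section \<open>Functions of two real variables: slices, partial derivatives, mixed partials\<close>

lemma smooth_comp_affine:
  "bounded_linear L \<Longrightarrow> smooth f \<Longrightarrow> smooth (\<lambda>x. f (a + L x))"
  by (simp add: smooth_def Ck_comp_affine)

lemma smooth_slices:
  assumes "smooth (\<lambda>(x :: real, t :: real). F x t)"
  shows "smooth (\<lambda>x. F x t)" and "smooth (\<lambda>t. F x t)"
proof -
  have "bounded_linear (\<lambda>x :: real. (x, 0 :: real))" "bounded_linear (\<lambda>t :: real. (0 :: real, t))"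
    by (intro bounded_linear_Pair bounded_linear_ident bounded_linear_zero)+
  then show "smooth (\<lambda>x. F x t)" "smooth (\<lambda>t. F x t)"
    using smooth_comp_affine[OF _ assms, of _ "(0, t)"] smooth_comp_affine[OF _ assms, of _ "(x, 0)"]
    by fastforce+
qed

lemma smooth_partial_derivs:
  fixes F :: "real \<Rightarrow> real \<Rightarrow> real"
  assumes "smooth (\<lambda>(x, t). F x t)"
  shows "smooth (\<lambda>(x, t). deriv (\<lambda>y. F y t) x)" and "smooth (\<lambda>(x, t). deriv (\<lambda>s. F x s) t)"
proof -
  obtain F' where F': "\<And>p. ((\<lambda>(x, t). F x t) has_derivative F' p) (at p)"
    "\<And>v. smooth (\<lambda>p. F' p v)"
    using smooth_has_derivative[OF assms] by blast
  have lin: "linear (F' p)" for p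
    using F'(1) has_derivative_linear by blast
  have "((\<lambda>y. F y t) has_derivative (\<lambda>v. F' (x, t) (v, 0))) (at x)" for x t
    using has_derivative_compose[OF has_derivative_Pair[OF has_derivative_ident has_derivative_const]
        F'(1), where s = UNIV] by simp
  moreover have "(\<lambda>v. F' p (v, 0)) = (*) (F' p (1, 0))" for p
  proof
    show "F' p (v, 0) = F' p (1, 0) * v" for v
      using linear_scale[OF lin, of p v "(1, 0)"] by simp
  qed
  ultimately have "((\<lambda>y. F y t) has_real_derivative F' (x, t) (1, 0)) (at x)" for x t
    by (simp add: has_field_derivative_def)
  then have "deriv (\<lambda>y. F y t) x = F' (x, t) (1, 0)" for x t
    by (rule DERIV_imp_deriv)
  then show "smooth (\<lambda>(x, t). deriv (\<lambda>y. F y t) x)"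
    using F'(2)[of "(1, 0)"] by (simp add: case_prod_unfold)
  have "((\<lambda>s. F x s) has_derivative (\<lambda>v. F' (x, t) (0, v))) (at t)" for x t
    using has_derivative_compose[OF has_derivative_Pair[OF has_derivative_const has_derivative_ident]
        F'(1), where s = UNIV] by simp
  moreover have "(\<lambda>v. F' p (0, v)) = (*) (F' p (0, 1))" for p
  proof
    show "F' p (0, v) = F' p (0, 1) * v" for v
      using linear_scale[OF lin, of p v "(0, 1)"] by simp
  qed
  ultimately have "((\<lambda>s. F x s) has_real_derivative F' (x, t) (0, 1)) (at t)" for x t
    by (simp add: has_field_derivative_def)
  then have "deriv (\<lambda>s. F x s) t = F' (x, t) (0, 1)" for x t
    by (rule DERIV_imp_deriv)
  then show "smooth (\<lambda>(x, t). deriv (\<lambda>s. F x s) t)"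
    using F'(2)[of "(0, 1)"] by (simp add: case_prod_unfold)
qed

text \<open>The mean value theorem is applied twice, in \<open>x\<close> to a difference in
  \<open>t\<close> and then in \<open>t\<close> to the \<open>x\<close>-derivative. The second
  difference is symmetric in the two variables while the right-hand side is not, and this yields the
  symmetry of mixed partials.\<close>

lemma second_difference_mean_value:
  fixes F :: "real \<Rightarrow> real \<Rightarrow> real"
  assumes F: "smooth (\<lambda>(x, t). F x t)" and h: "0 < h"
  obtains \<xi> \<eta> where "x < \<xi>" "\<xi> < x + h" "t < \<eta>" "\<eta> < t + h"
    "F (x + h) (t + h) - F (x + h) t - F x (t + h) + F x t
     = h * h * deriv (\<lambda>s. deriv (\<lambda>y. F y s) \<xi>) \<eta>"
proof -
  let ?d = "\<lambda>y. F y (t + h) - F y t"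
  let ?d' = "\<lambda>y. deriv (\<lambda>y. F y (t + h)) y - deriv (\<lambda>y. F y t) y"
  have "DERIV ?d y :> ?d' y" for y
    by (intro DERIV_diff smooth_deriv_real smooth_slices[OF F])
  then obtain \<xi> where \<xi>: "x < \<xi>" "\<xi> < x + h" "?d (x + h) - ?d x = h * ?d' \<xi>"
    using MVT2[of x "x + h" ?d ?d'] h by auto
  have "DERIV (\<lambda>s. deriv (\<lambda>y. F y s) \<xi>) s :> deriv (\<lambda>s. deriv (\<lambda>y. F y s) \<xi>) s" for s
    using smooth_deriv_real(1)[OF smooth_slices(2)[OF smooth_partial_derivs(1)[OF F]]] .
  then obtain \<eta> where "t < \<eta>" "\<eta> < t + h"
    "?d' \<xi> = h * deriv (\<lambda>s. deriv (\<lambda>y. F y s) \<xi>) \<eta>"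
    using MVT2[of t "t + h" "\<lambda>s. deriv (\<lambda>y. F y s) \<xi>"
        "\<lambda>s. deriv (\<lambda>s. deriv (\<lambda>y. F y s) \<xi>) s"] h by auto
  with \<xi> show thesis
    using that by simp
qed

text \<open>Schwarz's theorem: the second difference over a square of side h is h^2 times either
  mixed derivative at some point of the square. Continuity of both derivatives finishes the proof as
  h tends to 0.\<close>

lemma smooth_mixed_partials:
  fixes F :: "real \<Rightarrow> real \<Rightarrow> real"
  assumes F: "smooth (\<lambda>(x, t). F x t)"
  shows "deriv (\<lambda>s. deriv (\<lambda>y. F y s) x) t = deriv (\<lambda>y. deriv (\<lambda>s. F y s) t) x"
proof -
  have F': "smooth (\<lambda>(t, x). F x t)"
  proof -
    have "bounded_linear (prod.swap :: real \<times> real \<Rightarrow> real \<times> real)"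
      unfolding prod.swap_def by (intro bounded_linear_Pair bounded_linear_fst bounded_linear_snd)
    then have "smooth (\<lambda>p. (\<lambda>(x, t). F x t) (0 + prod.swap p))"
      using F by (rule smooth_comp_affine)
    then show ?thesis by (simp add: case_prod_unfold)
  qed
  define G where "G = (\<lambda>(x, t). deriv (\<lambda>s. deriv (\<lambda>y. F y s) x) t)"
  define H where "H = (\<lambda>(x, t). deriv (\<lambda>y. deriv (\<lambda>s. F y s) t) x)"
  have "continuous_on UNIV G" "continuous_on UNIV H"
    unfolding G_def H_def
    by (intro smooth_continuous_on smooth_partial_derivs F)+
  then have lim: "G \<midarrow>(x, t)\<rightarrow> G (x, t)" "H \<midarrow>(x, t)\<rightarrow> H (x, t)"
    by (auto simp: continuous_on_eq_continuous_at isCont_def)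
  have "\<exists>p q. p \<in> {x<..<x+h} \<times> {t<..<t+h} \<and> q \<in> {x<..<x+h} \<times> {t<..<t+h} \<and> G p = H q"
    if h: "0 < h" for h
  proof -
    obtain \<xi> \<eta> where 1: "x < \<xi>" "\<xi> < x + h" "t < \<eta>" "\<eta> < t + h"
      "F (x + h) (t + h) - F (x + h) t - F x (t + h) + F x t = h * h * G (\<xi>, \<eta>)"
      using second_difference_mean_value[OF F h, of x t] unfolding G_def by auto
    obtain \<eta>' \<xi>' where 2: "t < \<eta>'" "\<eta>' < t + h" "x < \<xi>'" "\<xi>' < x + h"
      "F (x + h) (t + h) - F x (t + h) - F (x + h) t + F x t = h * h * H (\<xi>', \<eta>')"
      using second_difference_mean_value[OF F' h, of t x] unfolding H_def by auto
    have "h * h * G (\<xi>, \<eta>) = h * h * H (\<xi>', \<eta>')"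
      using 1(5) 2(5) by linarith
    then show ?thesis
      using 1 2 h by (intro exI[of _ "(\<xi>, \<eta>)"] exI[of _ "(\<xi>', \<eta>')"]) simp
  qed
  then have "\<exists>p q. p \<in> {x<..<x+1/Suc m} \<times> {t<..<t+1/Suc m} \<and>
      q \<in> {x<..<x+1/Suc m} \<times> {t<..<t+1/Suc m} \<and> G p = H q" for m
    by simp
  then obtain p q where pq: "\<And>m. p m \<in> {x<..<x+1/Suc m} \<times> {t<..<t+1/Suc m}"
    "\<And>m. q m \<in> {x<..<x+1/Suc m} \<times> {t<..<t+1/Suc m}" "\<And>m. G (p m) = H (q m)"
    by metis
  have conv: "r \<longlonglongrightarrow> (x, t)" if "\<And>m. r m \<in> {x<..<x+1/Suc m} \<times> {t<..<t+1/Suc m}" for r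
  proof -
    have r: "x \<le> fst (r m)" "fst (r m) \<le> x + 1 / Suc m" "t \<le> snd (r m)" "snd (r m) \<le> t + 1 / Suc m"
      for m
      using that[of m] by (auto simp: mem_Times_iff)
    have l: "(\<lambda>m. a + 1 / Suc m) \<longlonglongrightarrow> a" for a :: real
      using tendsto_add[OF tendsto_const LIMSEQ_inverse_real_of_nat, of a]
      by (simp add: inverse_eq_divide)
    have "(\<lambda>m. fst (r m)) \<longlonglongrightarrow> x"
      by (rule tendsto_sandwich[OF _ _ tendsto_const l]) (use r in auto)
    moreover have "(\<lambda>m. snd (r m)) \<longlonglongrightarrow> t"
      by (rule tendsto_sandwich[OF _ _ tendsto_const l]) (use r in auto)
    ultimately have "(\<lambda>m. (fst (r m), snd (r m))) \<longlonglongrightarrow> (x, t)"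
      by (rule tendsto_Pair)
    then show ?thesis by simp
  qed
  \<comment> \<open>The squares are open and so omit their corner; the sequential form of a limit at
    a point requires sequences that avoid that point.\<close>
  have ne: "r m \<noteq> (x, t)" if "\<And>m. r m \<in> {x<..<x+1/Suc m} \<times> {t<..<t+1/Suc m}" for r m
    using that[of m] by auto
  have "(\<lambda>m. G (p m)) \<longlonglongrightarrow> G (x, t)"
    using lim(1) conv[of p] ne[of p] pq(1) unfolding LIMSEQ_SEQ_conv[symmetric] by blast
  moreover have "(\<lambda>m. H (q m)) \<longlonglongrightarrow> H (x, t)"
    using lim(2) conv[of q] ne[of q] pq(2) unfolding LIMSEQ_SEQ_conv[symmetric] by blast
  ultimately have "G (x, t) = H (x, t)"
    using pq(3) LIMSEQ_unique by simp
  then show ?thesis by (simp add: G_def H_def)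
qed

section \<open>Laurent series matrices as periodic bi-infinite matrices\<close>

text \<open>The entry \<open>(r, c)\<close> of the coefficient of \<open>\<lambda>\<^sup>-\<^sup>k\<close> is placed at position \<open>(r, c + n k)\<close>. This
  turns multiplication by \<open>J\<close> into a shift, and the principal grading into the distance from the
  diagonal.\<close>

definition zmat :: "nat \<Rightarrow> real fls mat \<Rightarrow> int \<Rightarrow> int \<Rightarrow> real" where
  "zmat n A r s = fls_nth (A $$ (nat (r mod int n), nat (s mod int n))) (s div int n - r div int n)"

definition zbuild :: "nat \<Rightarrow> (int \<Rightarrow> int \<Rightarrow> real) \<Rightarrow> real fls mat" where
  "zbuild n F = mat n n (\<lambda>(r, c). Abs_fls (\<lambda>k. F (int r) (int c + int n * k)))"

text \<open>\<open>p\<close> is a lower bound for the principal degree \<open>s - r\<close>. Powers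
  of lambda count negatively: J has \<open>p = - 1\<close>, and lambda times the identity has
  \<open>p = - n\<close>.\<close>

definition zbounded :: "nat \<Rightarrow> int \<Rightarrow> real fls mat \<Rightarrow> bool" where
  "zbounded n p A \<longleftrightarrow> A \<in> carrier_mat n n \<and> (\<forall>r s. s < r + p \<longrightarrow> zmat n A r s = 0)"

lemma zbounded_carrier: "zbounded n p A \<Longrightarrow> A \<in> carrier_mat n n"
  and zbounded_zero: "zbounded n p A \<Longrightarrow> s < r + p \<Longrightarrow> zmat n A r s = 0"
  by (simp_all add: zbounded_def)

lemma zbuild_carrier [simp]: "zbuild n F \<in> carrier_mat n n"
  by (simp add: zbuild_def)

lemma zmat_nth:
  assumes "r < n" "c < n"
  shows "fls_nth (A $$ (r, c)) k = zmat n A (int r) (int c + int n * k)"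
  using assms by (simp add: zmat_def)

text \<open>A crude bound on the Laurent index that is common to all n^2 entries, so that products
  of entries can be summed over one range.\<close>

lemma zbounded_nth:
  assumes A: "zbounded n p A" and "r < n" "c < n" and k: "k < - \<bar>p\<bar> - int n"
  shows "fls_nth (A $$ (r, c)) k = 0"
proof -
  have "int n * k \<le> 1 * k"
    using assms by (intro mult_right_mono_neg) auto
  then have "int c + int n * k < int r + p"
    using assms by linarith
  then show ?thesis
    using zbounded_zero[OF A] assms by (simp add: zmat_nth)
qed

lemma zmat_eqI:
  assumes "A \<in> carrier_mat n n" "B \<in> carrier_mat n n" "\<And>r s. zmat n A r s = zmat n B r s"
  shows "A = B"
proof (rule eq_matI)
  fix r c assume "r < dim_row B" "c < dim_col B"
  then have "r < n" "c < n"
    using assms by auto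
  then show "A $$ (r, c) = B $$ (r, c)"
    by (intro fls_eqI) (simp add: zmat_nth assms(3))
qed (use assms in auto)

text \<open>\<open>zbuild\<close> reads only the rows 0 to n - 1 and periodicity restores the
  others. Vanishing below a diagonal makes each row a genuine Laurent series; without such a bound
  \<open>Abs_fls\<close> would not return the given coefficients.\<close>

lemma zmat_zbuild:
  assumes n: "n > 0" and per: "\<And>r s. F (r + int n) (s + int n) = F r s"
    and bd: "\<And>r s. s < r + p \<Longrightarrow> F r s = 0"
  shows "zmat n (zbuild n F) r s = F r s"
proof -
  have up: "F (a + int n * int k) (b + int n * int k) = F a b" for a b k
  proof (induction k)
    case (Suc k)
    then show ?case
      using per[of "a + int n * int k" "b + int n * int k"] by (simp add: algebra_simps)
  qed simp
  have per': "F (a + int n * k) (b + int n * k) = F a b" for a b k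
  proof (cases "k \<ge> 0")
    case True
    then show ?thesis using up[of a "nat k" b] by simp
  next
    case False
    then show ?thesis using up[of "a + int n * k" "nat (- k)" "b + int n * k"] by simp
  qed
  define r' s' where "r' = r mod int n" and "s' = s mod int n"
  have r's': "0 \<le> r'" "r' < int n" "0 \<le> s'" "s' < int n"
    using n by (auto simp: r'_def s'_def)
  have bd': "F r' (s' + int n * k) = 0" if "k < - \<bar>p\<bar> - int n" for k
  proof -
    have "int n * k \<le> 1 * k"
      using that n by (intro mult_right_mono_neg) auto
    then show ?thesis
      using r's' that by (intro bd) linarith
  qed
  have "zmat n (zbuild n F) r s = F r' (s' + int n * (s div int n - r div int n))"
    using r's' by (simp add: zmat_def zbuild_def flip: r'_def s'_def)
      (rule nth_Abs_fls_lower_bound, use bd' in auto)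
  also have "\<dots> = F (r' + int n * (r div int n)) (s' + int n * (s div int n))"
    using per'[of r' "r div int n" "s' + int n * (s div int n - r div int n)"]
    by (simp add: algebra_simps)
  also have "\<dots> = F r s"
    by (simp add: r'_def s'_def)
  finally show ?thesis .
qed

section \<open>Arithmetic of the bi-infinite matrices\<close>

lemma zmat_periodic:
  assumes "n > 0"
  shows "zmat n A (r + int n) (s + int n) = zmat n A r s"
  using assms by (simp add: zmat_def)

lemma zmat_add:
  assumes "A \<in> carrier_mat n n" "B \<in> carrier_mat n n" "n > 0"
  shows "zmat n (A + B) r s = zmat n A r s + zmat n B r s"
  using assms by (simp add: zmat_def nat_less_iff)

lemma zmat_diff:
  assumes "A \<in> carrier_mat n n" "B \<in> carrier_mat n n" "n > 0"
  shows "zmat n (A - B) r s = zmat n A r s - zmat n B r s"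
  using assms by (simp add: zmat_def nat_less_iff)

lemma fls_nth_sum: "fls_nth (sum f I) k = (\<Sum>i\<in>I. fls_nth (f i) k)"
  by (induction I rule: infinite_finite_induct) auto

text \<open>The library formula sums between subdegrees, which vary from entry to entry; any common
  lower bounds \<open>N\<close> and \<open>M\<close> give the same sum, as the extra terms
  vanish.\<close>

lemma fls_times_nth_bounded:
  fixes f g :: "real fls"
  assumes "\<And>k. k < N \<Longrightarrow> fls_nth f k = 0" "\<And>k. k < M \<Longrightarrow> fls_nth g k = 0"
  shows "fls_nth (f * g) k = (\<Sum>i=N..k-M. fls_nth f i * fls_nth g (k - i))"
proof -
  have "(\<Sum>i=fls_subdegree f..k - fls_subdegree g. fls_nth f i * fls_nth g (k - i))
      = (\<Sum>i=N..k-M. fls_nth f i * fls_nth g (k - i))"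
  proof (rule sum.mono_neutral_cong)
    fix i assume "i \<in> {N..k-M} - {fls_subdegree f..k - fls_subdegree g}"
    then have "i < fls_subdegree f \<or> k - i < fls_subdegree g" by auto
    then show "fls_nth f i * fls_nth g (k - i) = 0"
      using fls_eq0_below_subdegree by auto
  next
    fix i assume "i \<in> {fls_subdegree f..k - fls_subdegree g} - {N..k-M}"
    then have "i < N \<or> k - i < M" by auto
    then show "fls_nth f i * fls_nth g (k - i) = 0"
      using assms by auto
  qed auto
  then show ?thesis by (simp add: fls_times_nth(2))
qed

text \<open>The passage to bi-infinite matrices is multiplicative. A product entry is a sum over a
  column c and a Laurent index i, and both are merged into the one index m = c + n (i + r div
  n).\<close>

lemma zmat_mult:
  assumes n: "n > 0" and A: "zbounded n p A" and B: "zbounded n q B"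
  shows "zmat n (A * B) r s = (\<Sum>m=r+p..s-q. zmat n A r m * zmat n B m s)"
proof -
  define r' s' where "r' = nat (r mod int n)" and "s' = nat (s mod int n)"
  define K where "K = s div int n - r div int n"
  define N M where "N = - \<bar>p\<bar> - int n" and "M = - \<bar>q\<bar> - int n"
  have r': "r' < n" "s' < n"
    using n by (auto simp: r'_def s'_def nat_less_iff)
  have req: "r = int r' + int n * (r div int n)" and seq: "s = int s' + int n * (s div int n)"
    using n by (simp_all add: r'_def s'_def)
  have A0: "fls_nth (A $$ (r', c)) k = 0" if "c < n" "k < N" for c k
    using zbounded_nth[OF A r'(1)] that by (simp add: N_def)
  have B0: "fls_nth (B $$ (c, s')) k = 0" if "c < n" "k < M" for c k
    using zbounded_nth[OF B _ r'(2)] that by (simp add: M_def)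
  have Am: "fls_nth (A $$ (r', c)) i = zmat n A r (int c + int n * (i + r div int n))"
    if "c < n" for c i
    using that n by (simp add: zmat_def r'_def)
  have Bm: "fls_nth (B $$ (c, s')) (K - i) = zmat n B (int c + int n * (i + r div int n)) s"
    if "c < n" for c i
    using that n by (simp add: zmat_def s'_def K_def diff_diff_eq add.commute)
  let ?I = "{m. N \<le> m div int n - r div int n \<and> m div int n - r div int n \<le> K - M}"
  have fin: "finite ?I"
  proof (rule finite_subset)
    show "?I \<subseteq> (\<lambda>(c, i). c + int n * (i + r div int n)) ` ({0..<int n} \<times> {N..K-M})"
    proof
      fix m assume "m \<in> ?I"
      then show "m \<in> (\<lambda>(c, i). c + int n * (i + r div int n)) ` ({0..<int n} \<times> {N..K-M})"
        using n by (intro image_eqI[of _ _ "(m mod int n, m div int n - r div int n)"]) auto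
    qed
  qed auto
  let ?h = "\<lambda>m. zmat n A r m * zmat n B m s"
  have "zmat n (A * B) r s = fls_nth ((A * B) $$ (r', s')) K"
    by (simp add: zmat_def r'_def s'_def K_def)
  also have "(A * B) $$ (r', s') = (\<Sum>c<n. A $$ (r', c) * B $$ (c, s'))"
    using zbounded_carrier[OF A] zbounded_carrier[OF B] r'
    by (simp add: scalar_prod_def lessThan_atLeast0)
  also have "fls_nth \<dots> K = (\<Sum>c<n. fls_nth (A $$ (r', c) * B $$ (c, s')) K)"
    by (simp add: fls_nth_sum)
  also have "\<dots> = (\<Sum>c<n. \<Sum>i=N..K-M. fls_nth (A $$ (r', c)) i * fls_nth (B $$ (c, s')) (K - i))"
    using A0 B0 by (intro sum.cong refl fls_times_nth_bounded) auto
  also have "\<dots> = (\<Sum>c<n. \<Sum>i=N..K-M. ?h (int c + int n * (i + r div int n)))"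
    by (intro sum.cong refl) (simp add: Am Bm)
  also have "\<dots> = (\<Sum>(c, i)\<in>{..<n} \<times> {N..K-M}. ?h (int c + int n * (i + r div int n)))"
    by (rule sum.cartesian_product)
  \<comment> \<open>Division with remainder by n: \<open>m mod n\<close> is the column,
    \<open>m div n - r div n\<close> the Laurent index.\<close>
  also have "\<dots> = (\<Sum>m\<in>?I. ?h m)"
    by (rule sum.reindex_bij_witness[where
          i = "\<lambda>m. (nat (m mod int n), m div int n - r div int n)" and
          j = "\<lambda>(c, i). int c + int n * (i + r div int n)"])
      (use n in \<open>auto simp: nat_less_iff\<close>)
  \<comment> \<open>The two index sets differ only in positions where one of the factors is
    zero.\<close>
  also have "\<dots> = (\<Sum>m=r+p..s-q. ?h m)"
  proof (rule sum.mono_neutral_cong)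
    fix m assume "m \<in> {r+p..s-q} - ?I"
    then consider "m div int n - r div int n < N" | "s div int n - m div int n < M"
      by (fastforce simp: K_def)
    then show "?h m = 0"
    proof cases
      case 1
      then have "zmat n A r m = 0"
        using A0[of "nat (m mod int n)"] n by (simp add: zmat_def r'_def nat_less_iff)
      then show ?thesis by simp
    next
      case 2
      then have "zmat n B m s = 0"
        using B0[of "nat (m mod int n)"] n by (simp add: zmat_def s'_def nat_less_iff)
      then show ?thesis by simp
    qed
  next
    fix m assume "m \<in> ?I - {r+p..s-q}"
    then have "m < r + p \<or> s < m + q" by auto
    then show "?h m = 0"
      using zbounded_zero[OF A] zbounded_zero[OF B] by auto
  qed (use fin in auto)
  finally show ?thesis .
qed


lemma zbounded_mult:
  assumes "n > 0" "zbounded n p A" "zbounded n q B"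
  shows "zbounded n (p + q) (A * B)"
  unfolding zbounded_def
proof (intro conjI allI impI)
  show "A * B \<in> carrier_mat n n"
    using assms zbounded_carrier by (metis mult_carrier_mat)
  fix r s assume "s < r + (p + q)"
  then show "zmat n (A * B) r s = 0"
    by (simp add: zmat_mult[OF assms])
qed

lemma zmat_mult_leading:
  assumes "n > 0" "zbounded n p A" "zbounded n q B"
  shows "zmat n (A * B) r (r + p + q) = zmat n A r (r + p) * zmat n B (r + p) (r + p + q)"
  by (simp add: zmat_mult[OF assms])

lemma zbounded_add: "n > 0 \<Longrightarrow> zbounded n p A \<Longrightarrow> zbounded n p B \<Longrightarrow> zbounded n p (A + B)"
  by (auto simp: zbounded_def zmat_add)

section \<open>The identity, lambda, J and constant matrices in the bi-infinite picture\<close>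

lemma div_mod_eq_iff:
  fixes n r s :: int
  shows "r = s \<longleftrightarrow> r mod n = s mod n \<and> r div n = s div n"
  by (metis mult_div_mod_eq)

lemma zmat_one: "n > 0 \<Longrightarrow> zmat n (1\<^sub>m n) r s = (if s = r then 1 else 0)"
  using div_mod_eq_iff[of s r "int n"] by (auto simp: zmat_def nat_less_iff eq_nat_nat_iff)

lemma zmat_lambda:
  assumes n: "n > 0"
  shows "zmat n (fls_X_inv \<cdot>\<^sub>m 1\<^sub>m n) r s = (if s = r - int n then 1 else 0)"
proof -
  have "s = r - int n \<longleftrightarrow> s mod int n = r mod int n \<and> s div int n = r div int n - 1"
    using div_mod_eq_iff[of s "r - int n" "int n"] n div_mult_self1[of "int n" r "- 1"] by simp
  then show ?thesis
    using n by (auto simp: zmat_def nat_less_iff eq_nat_nat_iff)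
qed

lemma div_mod_add_multiple:
  fixes c n q :: int
  assumes "0 \<le> c" "c < n"
  shows "(c + n * q) mod n = c" "(c + n * q) div n = q"
  using assms by auto

text \<open>\<open>b_mat\<close> fills the subdiagonal inside each block of size n, and e_1n lambda
  supplies the one entry joining consecutive blocks; together they form the full shift.\<close>

lemma zmat_J:
  assumes n: "n \<ge> 2"
  shows "zmat n (J_mat n) r s = (if s = r - 1 then 1 else 0)"
proof -
  define a c where "a = nat (r mod int n)" and "c = nat (s mod int n)"
  have ac: "a < n" "c < n" "r mod int n = int a" "s mod int n = int c"
    using n by (auto simp: a_def c_def nat_less_iff)
  have "J_mat n $$ (a, c) = (if a = 0 \<and> c = n - 1 then fls_X_inv else 0) + (if a = Suc c then 1 else 0)"
    using ac by (simp add: J_mat_def E_mat_def b_mat_def)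
  then have *: "zmat n (J_mat n) r s = (if a = 0 \<and> c = n - 1 \<and> s div int n = r div int n - 1 then 1 else 0)
      + (if a = Suc c \<and> s div int n = r div int n then 1 else 0)"
    unfolding zmat_def a_def[symmetric] c_def[symmetric] by auto
  have r: "r = int a + int n * (r div int n)"
    using mult_div_mod_eq[of "int n" r] ac by linarith
  have "(r - 1) mod int n = (if a = 0 then int n - 1 else int a - 1) \<and>
      (r - 1) div int n = (if a = 0 then r div int n - 1 else r div int n)"
  proof (cases "a = 0")
    case True
    have eq: "(int n - 1) + int n * (r div int n - 1) = r - 1"
      using r True by (simp add: algebra_simps)
    show ?thesis
      using True n div_mod_add_multiple[of "int n - 1" "int n" "r div int n - 1", unfolded eq] by simp
  next
    case False
    have eq: "(int a - 1) + int n * (r div int n) = r - 1"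
      using r by linarith
    show ?thesis
      using False ac div_mod_add_multiple[of "int a - 1" "int n" "r div int n", unfolded eq] by simp
  qed
  then have "s = r - 1 \<longleftrightarrow> int c = (if a = 0 then int n - 1 else int a - 1) \<and>
      s div int n = (if a = 0 then r div int n - 1 else r div int n)"
    by (subst div_mod_eq_iff[of s "r - 1" "int n"]) (simp only: ac)
  also have "\<dots> \<longleftrightarrow> (if a = 0 then c = n - 1 \<and> s div int n = r div int n - 1
       else a = Suc c \<and> s div int n = r div int n)"
    using n by auto
  finally have "s = r - 1 \<longleftrightarrow> (if a = 0 then c = n - 1 \<and> s div int n = r div int n - 1
       else a = Suc c \<and> s div int n = r div int n)" .
  then show ?thesis
    unfolding * by (simp only:) (cases "a = 0"; simp)
qed

lemma zmat_const:
  assumes "U \<in> carrier_mat n n" "n > 0"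
  shows "zmat n (map_mat fls_const U) r s =
    (if s div int n = r div int n then U $$ (nat (r mod int n), nat (s mod int n)) else 0)"
  using assms by (simp add: zmat_def nat_less_iff)

lemma J_carrier [simp]: "J_mat n \<in> carrier_mat n n"
  by (simp add: J_mat_def E_mat_def b_mat_def)

lemma zbounded_J: "n \<ge> 2 \<Longrightarrow> zbounded n (- 1) (J_mat n)"
  by (simp add: zbounded_def zmat_J)

lemma zbounded_one: "n > 0 \<Longrightarrow> zbounded n 0 (1\<^sub>m n)"
  by (simp add: zbounded_def zmat_one)

lemma zmat_J_mult:
  assumes "n \<ge> 2" "zbounded n p A"
  shows "zmat n (J_mat n * A) r s = zmat n A (r - 1) s"
proof -
  have "zmat n (J_mat n * A) r s = (\<Sum>m=r-1..s-p. zmat n (J_mat n) r m * zmat n A m s)"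
    using assms zmat_mult[OF _ zbounded_J[OF assms(1)] assms(2), of r s] by simp
  also have "\<dots> = (\<Sum>m=r-1..s-p. (if m = r - 1 then zmat n A (r - 1) s else 0))"
    by (intro sum.cong) (auto simp: zmat_J[OF assms(1)])
  finally have "zmat n (J_mat n * A) r s = \<dots>" .
  then show ?thesis
    using zbounded_zero[OF assms(2), of s "r - 1"] by (auto simp: sum.delta)
qed

lemma zmat_mult_J:
  assumes "n \<ge> 2" "zbounded n p A"
  shows "zmat n (A * J_mat n) r s = zmat n A r (s + 1)"
proof -
  have "zmat n (A * J_mat n) r s = (\<Sum>m=r+p..s+1. zmat n A r m * zmat n (J_mat n) m s)"
    using assms zmat_mult[OF _ assms(2) zbounded_J[OF assms(1)], of r s] by simp
  also have "\<dots> = (\<Sum>m=r+p..s+1. (if m = s + 1 then zmat n A r (s + 1) else 0))"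
    by (intro sum.cong) (auto simp: zmat_J[OF assms(1)])
  finally have "zmat n (A * J_mat n) r s = \<dots>" .
  then show ?thesis
    using zbounded_zero[OF assms(2), of "s + 1" r] by (auto simp: sum.delta)
qed

lemma V_space_entry:
  assumes "U \<in> V_space n" "r < n" "c < n"
  shows "U $$ (r, c) \<noteq> 0 \<Longrightarrow> c = n - 1 \<and> r < n - 1"
  using assms by (auto simp: V_space_def split: if_splits)

lemma V_space_carrier: "U \<in> V_space n \<Longrightarrow> U \<in> carrier_mat n n"
  by (auto simp: V_space_def)

text \<open>The unit e_in with i < n lies strictly above the diagonal, in degree n - i. Positive
  degree is what makes u a lower order perturbation of J.\<close>

lemma zbounded_V_space:
  assumes n: "n > 0" and U: "U \<in> V_space n"
  shows "zbounded n 1 (map_mat fls_const U)"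
  unfolding zbounded_def
proof (intro conjI allI impI)
  show "map_mat fls_const U \<in> carrier_mat n n"
    using V_space_carrier[OF U] by simp
  fix r s :: int assume s: "s < r + 1"
  show "zmat n (map_mat fls_const U) r s = 0"
  proof (rule ccontr)
    assume "zmat n (map_mat fls_const U) r s \<noteq> 0"
    then have *: "s div int n = r div int n" "U $$ (nat (r mod int n), nat (s mod int n)) \<noteq> 0"
      by (auto simp: zmat_const[OF V_space_carrier[OF U] n] split: if_splits)
    then have "nat (s mod int n) = n - 1" "nat (r mod int n) < n - 1"
      using V_space_entry[OF U _ _ *(2)] n by (simp_all add: nat_less_iff)
    then have "r mod int n < s mod int n"
      using n by linarith
    then show False
      using s *(1) mult_div_mod_eq[of "int n" r] mult_div_mod_eq[of "int n" s]
      by (metis add_le_cancel_left not_less zle_add1_eq_le)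
  qed
qed

lemma lam_coeff_zmat:
  assumes "A \<in> carrier_mat n n" "r < n" "c < n"
  shows "lam_coeff A i $$ (r, c) = zmat n A (int r) (int c - int n * i)"
  using assms zmat_nth[of r n c A "- i"] by (simp add: lam_coeff_def)

lemma lam_coeff_carrier [simp]: "A \<in> carrier_mat n n \<Longrightarrow> lam_coeff A i \<in> carrier_mat n n"
  by (simp add: lam_coeff_def)

subsection \<open>Coefficientwise differentiation\<close>

text \<open>The bound \<open>p\<close> is uniform in \<open>x\<close>. So an entry below it is the
  zero function, and an entry of a product is a finite sum whose range does not depend on
  \<open>x\<close> and can be differentiated term by term.\<close>

definition zsmooth :: "nat \<Rightarrow> int \<Rightarrow> (real \<Rightarrow> real fls mat) \<Rightarrow> bool" where
  "zsmooth n p A \<longleftrightarrow> (\<forall>x. zbounded n p (A x)) \<and> (\<forall>r s. smooth (\<lambda>x. zmat n (A x) r s))"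

definition zdx :: "nat \<Rightarrow> (real \<Rightarrow> real fls mat) \<Rightarrow> real \<Rightarrow> real fls mat" where
  "zdx n A x = zbuild n (\<lambda>r s. deriv (\<lambda>y. zmat n (A y) r s) x)"

lemma zsmooth_zbounded: "zsmooth n p A \<Longrightarrow> zbounded n p (A x)"
  and zsmooth_smooth: "zsmooth n p A \<Longrightarrow> smooth (\<lambda>x. zmat n (A x) r s)"
  by (simp_all add: zsmooth_def)

lemma zsmooth_carrier: "zsmooth n p A \<Longrightarrow> A x \<in> carrier_mat n n"
  using zsmooth_zbounded zbounded_carrier by blast

lemma zdx_carrier [simp]: "zdx n A x \<in> carrier_mat n n"
  by (simp add: zdx_def)

lemma zsmooth_const: "zbounded n p A \<Longrightarrow> zsmooth n p (\<lambda>x. A)"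
  by (simp add: zsmooth_def)

lemma zmat_zdx:
  assumes "n > 0" "zsmooth n p A"
  shows "zmat n (zdx n A x) r s = deriv (\<lambda>y. zmat n (A y) r s) x"
  unfolding zdx_def
proof (rule zmat_zbuild[where p = p])
  fix r s assume "s < r + p"
  then have "(\<lambda>y. zmat n (A y) r s) = (\<lambda>y. 0)"
    using zsmooth_zbounded[OF assms(2)] zbounded_zero by blast
  then show "deriv (\<lambda>y. zmat n (A y) r s) x = 0"
    by simp
qed (use assms in \<open>simp_all add: zmat_periodic\<close>)

lemma zsmooth_zdx:
  assumes "n > 0" "zsmooth n p A"
  shows "zsmooth n p (zdx n A)"
  unfolding zsmooth_def
proof (intro conjI allI)
  fix x
  have "deriv (\<lambda>y. zmat n (A y) r s) x = 0" if "s < r + p" for r s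
  proof -
    have "(\<lambda>y. zmat n (A y) r s) = (\<lambda>y. 0)"
      using that zsmooth_zbounded[OF assms(2)] zbounded_zero by blast
    then show ?thesis by simp
  qed
  then show "zbounded n p (zdx n A x)"
    by (simp add: zbounded_def zmat_zdx[OF assms])
next
  fix r s
  have "(\<lambda>x. zmat n (zdx n A x) r s) = deriv (\<lambda>y. zmat n (A y) r s)"
    by (simp add: zmat_zdx[OF assms] fun_eq_iff)
  then show "smooth (\<lambda>x. zmat n (zdx n A x) r s)"
    using smooth_deriv_real(2)[OF zsmooth_smooth[OF assms(2)]] by simp
qed

lemma zdx_const:
  assumes "n > 0" "zbounded n p A"
  shows "zdx n (\<lambda>x. A) x = 0\<^sub>m n n"
proof (rule zmat_eqI)
  show "zmat n (zdx n (\<lambda>x. A) x) r s = zmat n (0\<^sub>m n n) r s" for r s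
    using assms(1) zmat_zdx[OF assms(1) zsmooth_const[OF assms(2)], of x r s]
    by (simp add: zmat_def nat_less_iff)
qed auto

lemma zsmooth_mult:
  assumes "n > 0" "zsmooth n p A" "zsmooth n q B"
  shows "zsmooth n (p + q) (\<lambda>x. A x * B x)"
  unfolding zsmooth_def
    zmat_mult[OF assms(1) zsmooth_zbounded[OF assms(2)] zsmooth_zbounded[OF assms(3)]]
  by (intro conjI allI zbounded_mult smooth_sum smooth_mult zsmooth_smooth[OF assms(2)]
      zsmooth_smooth[OF assms(3)] zsmooth_zbounded[OF assms(2)] zsmooth_zbounded[OF assms(3)] assms(1))

lemma zdx_mult:
  assumes n: "n > 0" and A: "zsmooth n p A" and B: "zsmooth n q B"
  shows "zdx n (\<lambda>x. A x * B x) x = zdx n A x * B x + A x * zdx n B x"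
proof (rule zmat_eqI)
  note Ab = zsmooth_zbounded[OF A] and Bb = zsmooth_zbounded[OF B]
  note Ad = zsmooth_zbounded[OF zsmooth_zdx[OF n A]] and Bd = zsmooth_zbounded[OF zsmooth_zdx[OF n B]]
  note c = zbounded_carrier[OF Ab] zbounded_carrier[OF Bb] zbounded_carrier[OF Ad] zbounded_carrier[OF Bd]
  show "zdx n A x * B x + A x * zdx n B x \<in> carrier_mat n n"
    using c by (meson add_carrier_mat mult_carrier_mat)
  fix r s
  have "((\<lambda>x. zmat n (A x * B x) r s) has_real_derivative
      (\<Sum>m=r+p..s-q. zmat n (A x) r m * zmat n (zdx n B x) m s + zmat n (zdx n A x) r m * zmat n (B x) m s)) (at x)"
    unfolding zmat_mult[OF n Ab Bb] zmat_zdx[OF n A] zmat_zdx[OF n B]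
    by (intro DERIV_sum DERIV_mult' smooth_deriv_real zsmooth_smooth[OF A] zsmooth_smooth[OF B])
  then have "zmat n (zdx n (\<lambda>x. A x * B x) x) r s =
      (\<Sum>m=r+p..s-q. zmat n (A x) r m * zmat n (zdx n B x) m s + zmat n (zdx n A x) r m * zmat n (B x) m s)"
    using zmat_zdx[OF n zsmooth_mult[OF n A B]] DERIV_imp_deriv by simp
  also have "\<dots> = zmat n (zdx n A x * B x) r s + zmat n (A x * zdx n B x) r s"
    by (simp add: zmat_mult[OF n Ab Bd] zmat_mult[OF n Ad Bb] sum.distrib)
  also have "\<dots> = zmat n (zdx n A x * B x + A x * zdx n B x) r s"
    using c by (intro zmat_add[symmetric] n) (meson mult_carrier_mat)+
  finally show "zmat n (zdx n (\<lambda>x. A x * B x) x) r s = zmat n (zdx n A x * B x + A x * zdx n B x) r s" .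
qed simp

section \<open>Existence and uniqueness of the series \<open>Y\<close>\<close>

subsection \<open>The dressing matrix\<close>

text \<open>The integration constant is left to choice. Different choices may change T, but not the
  resulting Y, which is unique.\<close>

definition antideriv :: "(real \<Rightarrow> real) \<Rightarrow> real \<Rightarrow> real" where
  "antideriv g = (SOME f. smooth f \<and> deriv f = g)"

lemma smooth_antideriv:
  assumes "smooth g"
  shows "smooth (antideriv g)" and "deriv (antideriv g) = g"
proof -
  obtain f where "smooth f \<and> deriv f = g"
    using smooth_antiderivative_exists[OF assms] by blast
  then have "smooth (antideriv g) \<and> deriv (antideriv g) = g"
    unfolding antideriv_def by (rule someI[where P = "\<lambda>f. smooth f \<and> deriv f = g"])
  then show "smooth (antideriv g)" and "deriv (antideriv g) = g"
    by auto
qed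

text \<open>The coefficients of a solution \<open>T = I + \<dots>\<close> of \<open>T\<^sub>x + (J + u) T = T J\<close>, where \<open>dress n w m r\<close>
  is the entry at position \<open>(r, r + m)\<close> of the bi-infinite matrix, and \<open>w r = u\<^sub>r\<^sub>+\<^sub>1\<close>. The equation
  prescribes the differences of \<open>dress n w (Suc m) r\<close> in \<open>r\<close>; these can only be summed around the
  cycle \<open>\<int>/n\<close> if they add up to zero, and that fixes the derivative of the remaining constant one
  step earlier.\<close>

function dress :: "nat \<Rightarrow> (nat \<Rightarrow> real \<Rightarrow> real) \<Rightarrow> nat \<Rightarrow> nat \<Rightarrow> real \<Rightarrow> real" where
  "dress n w 0 r = (\<lambda>x. 1)"
| "dress n w (Suc m) r = (\<lambda>x.
     (\<Sum>i=1..r. deriv (dress n w m i) x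
        + (if n - 1 - i \<le> m then w i x * dress n w (m - (n - 1 - i)) (n - 1) x else 0))
     + antideriv (\<lambda>x. - (1 / n) *
         ((\<Sum>q<n. deriv (\<lambda>y. \<Sum>i=1..q. deriv (dress n w m i) y
             + (if n - 1 - i \<le> m then w i y * dress n w (m - (n - 1 - i)) (n - 1) y else 0)) x)
          + (\<Sum>i<n-1. if n - 1 - i \<le> Suc m
               then w i x * dress n w (Suc m - (n - 1 - i)) (n - 1) x else 0))) x)"
  by pat_completeness auto
termination by (relation "Wellfounded.measure (\<lambda>(n, w, m, r). m)") auto

declare dress.simps(2) [simp del]

text \<open>The entry of T_x + u T at position \<open>(r, r + m)\<close>. Since u has only its last
  column, u T involves row n - 1 of the block, which is \<open>n - 1 - r\<close> steps closer to the
  diagonal.\<close>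

definition dress_force :: "nat \<Rightarrow> (nat \<Rightarrow> real \<Rightarrow> real) \<Rightarrow> nat \<Rightarrow> nat \<Rightarrow> real \<Rightarrow> real" where
  "dress_force n w m r x = deriv (dress n w m r) x
     + (if n - 1 - r \<le> m then w r x * dress n w (m - (n - 1 - r)) (n - 1) x else 0)"

text \<open>The derivative that the common constant of level \<open>Suc m\<close> must have for the
  forces of that level to add up to zero: the condition is linear in it with coefficient n. The sum
  over \<open>i<n-1\<close> refers to levels at most \<open>m\<close>, so all its terms are already
  known.\<close>

definition dress_mean :: "nat \<Rightarrow> (nat \<Rightarrow> real \<Rightarrow> real) \<Rightarrow> nat \<Rightarrow> real \<Rightarrow> real" where
  "dress_mean n w m x = - (1 / n) * ((\<Sum>q<n. deriv (\<lambda>y. \<Sum>i=1..q. dress_force n w m i y) x)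
     + (\<Sum>i<n-1. if n - 1 - i \<le> Suc m
          then w i x * dress n w (Suc m - (n - 1 - i)) (n - 1) x else 0))"

lemma dress_Suc:
  "dress n w (Suc m) r = (\<lambda>x. (\<Sum>i=1..r. dress_force n w m i x) + antideriv (dress_mean n w m) x)"
  unfolding dress.simps(2) dress_force_def dress_mean_def ..

lemma smooth_dress_force_aux:
  assumes w: "\<And>r. smooth (w r)" and d: "\<And>m' r. m' \<le> m \<Longrightarrow> smooth (dress n w m' r)"
  shows "smooth (dress_force n w m r)"
proof -
  have "smooth (\<lambda>x. if n - 1 - r \<le> m then w r x * dress n w (m - (n - 1 - r)) (n - 1) x else 0)"
    using d[of "m - (n - 1 - r)" "n - 1"] w[of r] by (cases "n - 1 - r \<le> m") (auto intro: smooth_mult)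
  then show ?thesis
    unfolding dress_force_def [abs_def]
    by (intro smooth_add smooth_deriv_real d) auto
qed

lemma smooth_dress_mean_aux:
  assumes w: "\<And>r. smooth (w r)" and d: "\<And>m' r. m' \<le> m \<Longrightarrow> smooth (dress n w m' r)"
  shows "smooth (dress_mean n w m)"
proof -
  have "smooth (\<lambda>x. if n - 1 - i \<le> Suc m
          then w i x * dress n w (Suc m - (n - 1 - i)) (n - 1) x else 0)" if "i < n - 1" for i
    using d[of "Suc m - (n - 1 - i)" "n - 1"] w[of i] that
    by (cases "n - 1 - i \<le> Suc m") (auto intro: smooth_mult)
  moreover have "smooth (deriv (\<lambda>y. \<Sum>i=1..q. dress_force n w m i y))" for q
    by (intro smooth_deriv_real smooth_sum smooth_dress_force_aux assms)
  ultimately show ?thesis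
    unfolding dress_mean_def [abs_def]
    by (intro smooth_mult smooth_add smooth_sum) auto
qed

lemma smooth_dress:
  assumes w: "\<And>r. smooth (w r)"
  shows "smooth (dress n w m r)"
proof (induction m arbitrary: r rule: less_induct)
  case (less m)
  show ?case
  proof (cases m)
    case (Suc k)
    then have "\<And>m' r. m' \<le> k \<Longrightarrow> smooth (dress n w m' r)"
      using less by simp
    then show ?thesis
      unfolding Suc dress_Suc
      by (intro smooth_add smooth_sum smooth_antideriv smooth_dress_force_aux smooth_dress_mean_aux w)
  qed simp
qed

text \<open>The solvability condition on the cycle. At level 0 the entries are constant and only
  \<open>w (n - 1) = 0\<close> could contribute; at higher levels the choice of
  \<open>dress_mean\<close> enforces it.\<close>

lemma sum_dress_force:
  assumes n: "n > 0" and w: "\<And>r. smooth (w r)" and wn: "w (n - 1) = (\<lambda>x. 0)"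
  shows "(\<Sum>r<n. dress_force n w m r x) = 0"
proof (cases m)
  case 0
  have "dress_force n w 0 r x = 0" if "r < n" for r
    using that wn by (cases "r = n - 1") (auto simp: dress_force_def)
  then show ?thesis using 0 by simp
next
  case (Suc k)
  let ?W = "\<lambda>i. if n - 1 - i \<le> Suc k then w i x * dress n w (Suc k - (n - 1 - i)) (n - 1) x else 0"
  let ?s = "\<lambda>q y. \<Sum>i=1..q. dress_force n w k i y"
  have force: "smooth (dress_force n w k i)" for i
    using smooth_dress_force_aux smooth_dress w by blast
  have mean: "smooth (dress_mean n w k)"
    using smooth_dress_mean_aux smooth_dress w by blast
  have "(dress n w (Suc k) r has_real_derivative deriv (?s r) x + dress_mean n w k x) (at x)" for r
    unfolding dress_Suc
    using smooth_deriv_real(1)[OF smooth_antideriv(1)[OF mean], of x] smooth_antideriv(2)[OF mean]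
    by (intro DERIV_add smooth_deriv_real smooth_sum force) auto
  then have d: "deriv (dress n w (Suc k) r) x = deriv (?s r) x + dress_mean n w k x" for r
    by (rule DERIV_imp_deriv)
  have "(\<Sum>r<n. ?W r) = (\<Sum>r<n-1. ?W r)"
    using n wn by (cases n) auto
  then show ?thesis
    unfolding Suc dress_force_def[of n w "Suc k"] d sum.distrib
    using n by (simp add: dress_mean_def field_simps)
qed

text \<open>For \<open>r > 0\<close> this is one summand of the partial sums in
  \<open>dress_Suc\<close>. For \<open>r = 0\<close> the step wraps around from n - 1, and the zero
  sum of the forces closes the cycle.\<close>

lemma dress_diff:
  assumes n: "n > 0" and w: "\<And>r. smooth (w r)" and wn: "w (n - 1) = (\<lambda>x. 0)" and r: "r < n"
  shows "dress n w (Suc m) r x - dress n w (Suc m) (if r = 0 then n - 1 else r - 1) x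
    = dress_force n w m r x"
proof (cases r)
  case 0
  have "{..<n} = insert 0 {1..n-1}"
    using n by auto
  then have "dress_force n w m 0 x + (\<Sum>i=1..n-1. dress_force n w m i x) = 0"
    using sum_dress_force[where w = w, OF n w wn, of m x] by simp
  then show ?thesis
    using 0 by (simp add: dress_Suc)
qed (simp add: dress_Suc)

lemma last_index_div_mod:
  assumes n: "n > 0"
  shows "(int n * (r div int n) + int n - 1) mod int n = int n - 1"
    and "(int n * (r div int n) + int n - 1) div int n = r div int n"
proof -
  have eq: "int n - 1 + int n * (r div int n) = int n * (r div int n) + int n - 1"
    by simp
  have "0 \<le> int n - 1" "int n - 1 < int n"
    using n by auto
  from div_mod_add_multiple[OF this, of "r div int n", unfolded eq]
  show "(int n * (r div int n) + int n - 1) mod int n = int n - 1"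
    and "(int n * (r div int n) + int n - 1) div int n = r div int n" .
qed

text \<open>Only the last column of U is nonzero, so row r of the product is a multiple of the row
  of A at the last index of the block containing r.\<close>

lemma zmat_V_space_mult:
  assumes n: "n > 0" and U: "U \<in> V_space n" and A: "zbounded n p A"
  shows "zmat n (map_mat fls_const U * A) r s
    = U $$ (nat (r mod int n), n - 1) * zmat n A (int n * (r div int n) + int n - 1) s"
proof -
  let ?l = "int n * (r div int n) + int n - 1"
  note l = last_index_div_mod[OF n, of r]
  have ln: "nat (?l mod int n) = n - 1"
    using l n by simp
  have 1: "zmat n (map_mat fls_const U) r m = (if m = ?l then U $$ (nat (r mod int n), n - 1) else 0)" for m
  proof (cases "m = ?l")
    case True
    then show ?thesis
      by (simp only: zmat_const[OF V_space_carrier[OF U] n] l(2) ln refl if_True)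
  next
    case False
    have "nat (m mod int n) \<noteq> n - 1" if "m div int n = r div int n"
      using that False l n div_mod_eq_iff[of m ?l "int n"] by (auto simp: nat_eq_iff)
    then show ?thesis
      using False V_space_entry[OF U, of "nat (r mod int n)" "nat (m mod int n)"] n
      by (auto simp: zmat_const[OF V_space_carrier[OF U] n] nat_less_iff)
  qed
  have "zmat n (map_mat fls_const U * A) r s
      = (\<Sum>m=r+1..s-p. if m = ?l then U $$ (nat (r mod int n), n - 1) * zmat n A ?l s else 0)"
    unfolding zmat_mult[OF n zbounded_V_space[OF n U] A] by (intro sum.cong) (auto simp: 1)
  also have "\<dots> = U $$ (nat (r mod int n), n - 1) * zmat n A ?l s"
  proof (cases "?l \<in> {r+1..s-p}")
    case False
    then have "?l < r + 1 \<or> s < ?l + p" by auto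
    \<comment> \<open>Here \<open>r\<close> is itself the last index of its block, and the last row
      of U is zero.\<close>
    moreover have "U $$ (nat (r mod int n), n - 1) = 0" if "?l < r + 1"
      using 1[of ?l] zbounded_zero[OF zbounded_V_space[OF n U] that] by simp
    ultimately show ?thesis
      using zbounded_zero[OF A, of s ?l] False by auto
  qed (auto simp: sum.delta)
  finally show ?thesis .
qed

lemma dressing_matrix_exists:
  assumes n: "n \<ge> 2" and u: "smooth_mat n u" "\<And>x. u x \<in> V_space n"
  obtains T where "zsmooth n 0 T" "\<And>x r. zmat n (T x) r r = 1"
    "\<And>x. zdx n T x + (J_mat n + map_mat fls_const (u x)) * T x = T x * J_mat n"
proof -
  have n0: "n > 0" using n by simp
  \<comment> \<open>The value 0 at \<open>n - 1\<close> expresses that V_n has no e_nn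
    component.\<close>
  define w where "w = (\<lambda>r x. if r < n - 1 then u x $$ (r, n - 1) else 0)"
  have w: "smooth (w r)" for r
    using u(1) n by (cases "r < n - 1") (auto simp: w_def smooth_mat_def)
  have wn: "w (n - 1) = (\<lambda>x. 0)"
    by (simp add: w_def)
  have wu: "u x $$ (r, n - 1) = w r x" if "r < n" for r x
    using V_space_entry[OF u(2)[of x] that, of "n - 1"] n by (auto simp: w_def)
  define F where "F = (\<lambda>x r s. if s < r then 0 else dress n w (nat (s - r)) (nat (r mod int n)) x)"
  define T where "T = (\<lambda>x. zbuild n (F x))"
  have F: "zmat n (T x) r s = F x r s" for x r s
    unfolding T_def using n0 by (intro zmat_zbuild[where p = 0]) (auto simp: F_def)
  have F_smooth: "smooth (\<lambda>x. F x r s)" for r s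
    unfolding F_def by (cases "s < r") (auto intro: smooth_dress[OF w])
  have T: "zsmooth n 0 T"
    unfolding zsmooth_def zbounded_def F
    by (auto simp: F_smooth) (auto simp: T_def F_def)
  show thesis
  proof (rule that[OF T])
    show "zmat n (T x) r r = 1" for x r
      by (simp add: F F_def)
    fix x
    let ?U = "map_mat fls_const (u x)"
    note Tb = zsmooth_zbounded[OF T, of x]
    have c: "T x \<in> carrier_mat n n" "?U \<in> carrier_mat n n" "zdx n T x \<in> carrier_mat n n"
      using zbounded_carrier[OF Tb] V_space_carrier[OF u(2)] by auto
    show "zdx n T x + (J_mat n + ?U) * T x = T x * J_mat n"
    proof (rule zmat_eqI)
      show "zdx n T x + (J_mat n + ?U) * T x \<in> carrier_mat n n" "T x * J_mat n \<in> carrier_mat n n"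
        using c by (meson J_carrier add_carrier_mat mult_carrier_mat)+
      fix r s
      define a where "a = nat (r mod int n)"
      have a: "a < n" "int a = r mod int n"
        using n0 by (auto simp: a_def nat_less_iff)
      let ?l = "int n * (r div int n) + int n - 1"
      have rl: "?l = r + int (n - 1 - a)"
      proof -
        have "int (n - 1 - a) = int n - 1 - int a"
          using a by linarith
        then show ?thesis
          using mult_div_mod_eq[of "int n" r] a by linarith
      qed
      have la: "nat (?l mod int n) = n - 1"
        using last_index_div_mod(1)[OF n0, of r] by simp
      have "nat ((r - 1) mod int n) = (if a = 0 then n - 1 else a - 1)"
      proof -
        define a' q where "a' = (if a = 0 then int n - 1 else int a - 1)"
          and "q = (if a = 0 then r div int n - 1 else r div int n)"
        have eq: "a' + int n * q = r - 1"
          using a mult_div_mod_eq[of "int n" r] by (auto simp: a'_def q_def right_diff_distrib)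
        have "0 \<le> a'" "a' < int n"
          using a n by (auto simp: a'_def)
        then have "(r - 1) mod int n = a'"
          using div_mod_add_multiple(1)[of a' "int n" q, unfolded eq] by blast
        then show ?thesis
          by (auto simp: a'_def)
      qed
      note prev = this
      have "zmat n (?U * T x) r s = w a x * F x ?l s"
        using zmat_V_space_mult[OF n0 u(2) Tb, of x r s] wu[OF a(1), of x]
        unfolding a_def[symmetric] F by simp
      moreover have "J_mat n * T x \<in> carrier_mat n n" "?U * T x \<in> carrier_mat n n"
        using c by (meson J_carrier mult_carrier_mat)+
      ultimately have "zmat n (zdx n T x + (J_mat n + ?U) * T x) r s
          = deriv (\<lambda>y. F y r s) x + (F x (r - 1) s + w a x * F x ?l s)"
        using c zmat_J_mult[OF n Tb]
        by (simp add: add_mult_distrib_mat[of _ n n _ _ n] zmat_add n0 zmat_zdx[OF n0 T] F)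
      also have "\<dots> = F x r (s + 1)"
      proof -
        \<comment> \<open>Below degree -1 everything vanishes; in degree -1 both sides are the unit
          diagonal of T, shifted by J; from degree 0 on the equation is
          \<open>dress_diff\<close>.\<close>
        consider "s < r - 1" | "s = r - 1" | "s \<ge> r" by linarith
        then show ?thesis
        proof cases
          case 1
          then show ?thesis by (simp add: F_def rl)
        next
          case 2
          then show ?thesis by (simp add: F_def rl)
        next
          case 3
          define m where "m = nat (s - r)"
          have s: "s = r + int m" using 3 by (simp add: m_def)
          have "w a x * F x ?l s = (if n - 1 - a \<le> m then w a x * dress n w (m - (n - 1 - a)) (n - 1) x else 0)"
            using la unfolding F_def s rl by (auto simp: nat_diff_distrib simp flip: of_nat_diff)
          then have "deriv (\<lambda>y. F y r s) x + w a x * F x ?l s = dress_force n w m a x"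
            by (simp add: F_def s dress_force_def a_def)
          moreover have "F x (r - 1) s = dress n w (Suc m) (if a = 0 then n - 1 else a - 1) x"
            using prev by (simp add: F_def s nat_add_distrib)
          moreover have "F x r (s + 1) = dress n w (Suc m) a x"
            by (simp add: F_def s a_def nat_add_distrib)
          ultimately show ?thesis
            using dress_diff[where w = w, OF n0 w wn a(1), of m x] by simp
        qed
      qed
      also have "\<dots> = zmat n (T x * J_mat n) r s"
        by (simp add: zmat_mult_J[OF n Tb] F)
      finally show "zmat n (zdx n T x + (J_mat n + ?U) * T x) r s = zmat n (T x * J_mat n) r s" .
    qed
  qed
qed

text \<open>Entry \<open>(r, r + k)\<close> of the inverse of a unitriangular matrix, obtained by
  solving T S = 1 outward from the diagonal.\<close>

fun unitri_inv :: "(int \<Rightarrow> int \<Rightarrow> real) \<Rightarrow> nat \<Rightarrow> int \<Rightarrow> real" where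
  "unitri_inv F k r = (if k = 0 then 1 else
     - (\<Sum>a=1..k. F r (r + int a) * unitri_inv F (k - a) (r + int a)))"

declare unitri_inv.simps [simp del]

text \<open>The recursion uses finitely many entries of T for each entry of S, so periodicity and
  smoothness pass to S. It yields a right inverse, which is two-sided because the matrices are
  finite, with Laurent series as entries.\<close>

lemma unitriangular_inverse:
  assumes n: "n > 0" and T: "zsmooth n 0 T" and diag: "\<And>x r. zmat n (T x) r r = 1"
  obtains S where "zsmooth n 0 S" "\<And>x r. zmat n (S x) r r = 1" "\<And>x. T x * S x = 1\<^sub>m n"
    "\<And>x. S x * T x = 1\<^sub>m n"
proof -
  define F where "F = (\<lambda>x r s. if s < r then 0 else unitri_inv (zmat n (T x)) (nat (s - r)) r)"
  define S where "S = (\<lambda>x. zbuild n (F x))"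
  have per: "unitri_inv (zmat n (T x)) k (r + int n) = unitri_inv (zmat n (T x)) k r" for x k r
  proof (induction k arbitrary: r rule: less_induct)
    case (less k)
    have "zmat n (T x) (r + int n) (r + int n + int a) * unitri_inv (zmat n (T x)) (k - a) (r + int n + int a)
        = zmat n (T x) r (r + int a) * unitri_inv (zmat n (T x)) (k - a) (r + int a)"
      if "a \<in> {1..k}" for a
      using less[of "k - a" "r + int a"] zmat_periodic[OF n, of "T x" r "r + int a"] that
      by (simp add: algebra_simps)
    then show ?case
      by (subst (1 2) unitri_inv.simps) simp
  qed
  have sm: "smooth (\<lambda>x. unitri_inv (zmat n (T x)) k r)" for k r
  proof (induction k arbitrary: r rule: less_induct)
    case (less k)
    then show ?case
      by (subst unitri_inv.simps, cases "k = 0")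
        (auto intro!: smooth_minus smooth_sum smooth_mult zsmooth_smooth[OF T])
  qed
  have F: "zmat n (S x) r s = F x r s" for x r s
    unfolding S_def using n per by (intro zmat_zbuild[where p = 0]) (auto simp: F_def)
  have S: "zsmooth n 0 S"
    unfolding zsmooth_def zbounded_def F
  proof (intro conjI allI)
    show "smooth (\<lambda>x. F x r s)" for r s
      using sm by (cases "s < r") (simp_all add: F_def)
  qed (auto simp: F_def S_def)
  have TS: "T x * S x = 1\<^sub>m n" for x
  proof (rule zmat_eqI)
    show "T x * S x \<in> carrier_mat n n"
      using zsmooth_carrier[OF T] zsmooth_carrier[OF S] by (metis mult_carrier_mat)
    fix r s
    let ?h = "\<lambda>m. zmat n (T x) r m * F x m s"
    have "zmat n (T x * S x) r s = (\<Sum>m=r..s. ?h m)"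
      by (simp add: zmat_mult[OF n zsmooth_zbounded[OF T] zsmooth_zbounded[OF S]] F)
    also have "\<dots> = (if s = r then 1 else 0)"
    proof -
      consider "s < r" | "s = r" | "s > r" by linarith
      then show ?thesis
      proof cases
        case 2
        then show ?thesis by (simp add: F_def diag unitri_inv.simps)
      next
        case 3
        define k where "k = nat (s - r)"
        have k: "s = r + int k" "k > 0" using 3 by (auto simp: k_def)
        have "(\<Sum>m=r+1..s. ?h m) = (\<Sum>a=1..k. ?h (r + int a))"
          by (rule sum.reindex_bij_witness[where i = "\<lambda>a. r + int a" and j = "\<lambda>m. nat (m - r)"])
            (auto simp: k)
        also have "\<dots> = (\<Sum>a=1..k. zmat n (T x) r (r + int a) * unitri_inv (zmat n (T x)) (k - a) (r + int a))"
          by (intro sum.cong) (auto simp: F_def k simp flip: of_nat_diff)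
        also have "\<dots> = - F x r s"
          using k by (simp add: F_def unitri_inv.simps[of _ k])
        finally have "(\<Sum>m=r+1..s. ?h m) = - F x r s" .
        moreover have "{r..s} = insert r {r+1..s}"
          using 3 by auto
        ultimately show ?thesis
          using 3 by (simp add: diag)
      qed simp
    qed
    also have "\<dots> = zmat n (1\<^sub>m n) r s"
      by (simp add: zmat_one[OF n])
    finally show "zmat n (T x * S x) r s = zmat n (1\<^sub>m n) r s" .
  qed simp
  show thesis
  proof (rule that[OF S _ TS])
    show "zmat n (S x) r r = 1" for x r
      by (simp add: F F_def unitri_inv.simps)
    show "S x * T x = 1\<^sub>m n" for x
      using mat_mult_left_right_inverse[OF zsmooth_carrier[OF T] zsmooth_carrier[OF S] TS] .
  qed
qed

subsection \<open>Series commuting with \<open>\<partial>\<^sub>x + J + u\<close>\<close>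

abbreviation lax_op :: "nat \<Rightarrow> real mat \<Rightarrow> real fls mat" where
  "lax_op n U \<equiv> J_mat n + map_mat fls_const U"

definition lax :: "nat \<Rightarrow> (real \<Rightarrow> real mat) \<Rightarrow> (real \<Rightarrow> real fls mat) \<Rightarrow> bool" where
  "lax n u A \<longleftrightarrow> (\<forall>x. zdx n A x + commutator (lax_op n (u x)) (A x) = 0\<^sub>m n n)"

lemma commutator_carrier [simp]:
  "A \<in> carrier_mat n n \<Longrightarrow> B \<in> carrier_mat n n \<Longrightarrow> commutator A B \<in> carrier_mat n n"
  unfolding commutator_def by (meson minus_carrier_mat mult_carrier_mat)

lemma commutator_mult:
  fixes A B L :: "'a::comm_ring_1 mat"
  assumes "A \<in> carrier_mat n n" "B \<in> carrier_mat n n" "L \<in> carrier_mat n n"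
  shows "commutator L (A * B) = commutator L A * B + A * commutator L B"
proof -
  have "commutator L A * B + A * commutator L B = (L * A * B - A * L * B) + (A * L * B - A * B * L)"
    using assms
    by (simp add: commutator_def minus_mult_distrib_mat[of _ n n _ _ n]
        mult_minus_distrib_mat[of _ n n _ n] assoc_mult_mat[of _ n n _ n _ n])
  also have "\<dots> = L * A * B - A * B * L"
    using assms by (intro eq_matI) auto
  also have "\<dots> = commutator L (A * B)"
    using assms by (simp add: commutator_def assoc_mult_mat[of _ n n _ n _ n])
  finally show ?thesis ..
qed

lemma mat_add_eq_0_iff:
  fixes A B :: "'a::ab_group_add mat"
  assumes "A \<in> carrier_mat n m" "B \<in> carrier_mat n m"
  shows "A + B = 0\<^sub>m n m \<longleftrightarrow> A = - B"
proof
  assume *: "A + B = 0\<^sub>m n m"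
  show "A = - B"
  proof (rule eq_matI)
    fix i j assume ij: "i < dim_row (- B)" "j < dim_col (- B)"
    then have "(A + B) $$ (i, j) = 0"
      using * assms by simp
    then show "A $$ (i, j) = (- B) $$ (i, j)"
      using ij assms by (simp add: eq_neg_iff_add_eq_0)
  qed (use assms in auto)
next
  assume "A = - B"
  then show "A + B = 0\<^sub>m n m"
    using assms by (intro eq_matI) auto
qed

lemma lax_mult:
  assumes n: "n > 0" and A: "zsmooth n p A" "lax n u A" and B: "zsmooth n q B" "lax n u B"
    and u: "\<And>x. u x \<in> carrier_mat n n"
  shows "lax n u (\<lambda>x. A x * B x)"
  unfolding lax_def
proof
  fix x
  let ?L = "lax_op n (u x)"
  have c: "A x \<in> carrier_mat n n" "B x \<in> carrier_mat n n" "?L \<in> carrier_mat n n"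
    using zsmooth_carrier[OF A(1)] zsmooth_carrier[OF B(1)] u by auto
  have "zdx n A x = - commutator ?L (A x)" "zdx n B x = - commutator ?L (B x)"
    using A(2) B(2) mat_add_eq_0_iff[OF zdx_carrier commutator_carrier[OF c(3,1)]]
      mat_add_eq_0_iff[OF zdx_carrier commutator_carrier[OF c(3,2)]]
    unfolding lax_def by blast+
  then have "zdx n (\<lambda>x. A x * B x) x = - commutator ?L (A x) * B x + A x * - commutator ?L (B x)"
    by (simp add: zdx_mult[OF n A(1) B(1)])
  also have "\<dots> = - (commutator ?L (A x) * B x + A x * commutator ?L (B x))"
    using c by (intro eq_matI) (auto simp: carrier_matD[OF commutator_carrier[OF c(3,1)]]
        carrier_matD[OF commutator_carrier[OF c(3,2)]] scalar_prod_def sum_negf)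
  also have "\<dots> = - commutator ?L (A x * B x)"
    by (simp add: commutator_mult[OF c])
  finally show "zdx n (\<lambda>x. A x * B x) x + commutator ?L (A x * B x) = 0\<^sub>m n n"
    using c by (subst mat_add_eq_0_iff[of _ n n]) auto
qed

lemma zsmooth_pow:
  assumes n: "n > 0" and A: "zsmooth n p A"
  shows "zsmooth n (int k * p) (\<lambda>x. A x ^\<^sub>m k)"
proof (induction k)
  case 0
  have "dim_row (A x) = n" for x
    using zsmooth_carrier[OF A, of x] by auto
  then show ?case
    using zsmooth_const[OF zbounded_one[OF n]] by simp
next
  case (Suc k)
  then show ?case
    using zsmooth_mult[OF n Suc A] by (simp add: algebra_simps)
qed

lemma lax_pow:
  assumes n: "n > 0" and A: "zsmooth n p A" "lax n u A" and u: "\<And>x. u x \<in> carrier_mat n n"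
  shows "lax n u (\<lambda>x. A x ^\<^sub>m k)"
proof (induction k)
  case 0
  have "dim_row (A x) = n" for x
    using zsmooth_carrier[OF A(1), of x] by auto
  moreover have "commutator (lax_op n (u x)) (1\<^sub>m n) = 0\<^sub>m n n" for x
    using u[of x] by (simp add: commutator_def)
  ultimately show ?case
    using zdx_const[OF n zbounded_one[OF n]] by (simp add: lax_def)
next
  case (Suc k)
  then show ?case
    using lax_mult[OF n zsmooth_pow[OF n A(1)] Suc A u] by simp
qed

lemma mat_trace_comm:
  fixes A B :: "'a::comm_ring_1 mat"
  assumes "A \<in> carrier_mat n n" "B \<in> carrier_mat n n"
  shows "(\<Sum>r<n. (A * B) $$ (r, r)) = (\<Sum>r<n. (B * A) $$ (r, r))"
proof -
  have "(\<Sum>r<n. (A * B) $$ (r, r)) = (\<Sum>r<n. \<Sum>k<n. A $$ (r, k) * B $$ (k, r))"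
    using assms by (simp add: scalar_prod_def lessThan_atLeast0)
  also have "\<dots> = (\<Sum>k<n. \<Sum>r<n. B $$ (k, r) * A $$ (r, k))"
    by (subst sum.swap) (simp add: mult.commute)
  also have "\<dots> = (\<Sum>r<n. (B * A) $$ (r, r))"
    using assms by (simp add: scalar_prod_def lessThan_atLeast0)
  finally show ?thesis .
qed

lemma mat_deriv_lam_coeff:
  assumes "n > 0" "zsmooth n p A"
  shows "mat_deriv n (\<lambda>y. lam_coeff (A y) i) x = lam_coeff (zdx n A x) i"
proof (rule eq_matI)
  fix r c assume "r < dim_row (lam_coeff (zdx n A x) i)" "c < dim_col (lam_coeff (zdx n A x) i)"
  then have rc: "r < n" "c < n"
    using carrier_matD[OF zdx_carrier[of n A x]] by (auto simp: lam_coeff_def)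
  then show "mat_deriv n (\<lambda>y. lam_coeff (A y) i) x $$ (r, c) = lam_coeff (zdx n A x) i $$ (r, c)"
    by (simp add: mat_deriv_def lam_coeff_zmat[OF zsmooth_carrier[OF assms(2)] rc]
        lam_coeff_zmat[OF zdx_carrier rc] zmat_zdx[OF assms])
qed (use carrier_matD[OF zdx_carrier[of n A x]] in \<open>auto simp: lam_coeff_def mat_deriv_def\<close>)

lemma smooth_mat_lam_coeff:
  assumes "zsmooth n p A"
  shows "smooth_mat n (\<lambda>x. lam_coeff (A x) i)"
  using zsmooth_carrier[OF assms] zsmooth_smooth[OF assms]
  by (auto simp: smooth_mat_def lam_coeff_zmat[OF zsmooth_carrier[OF assms]])

lemma lam_coeff_add:
  assumes "A \<in> carrier_mat n n" "B \<in> carrier_mat n n"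
  shows "lam_coeff (A + B) i = lam_coeff A i + lam_coeff B i"
  using assms by (intro eq_matI) (auto simp: lam_coeff_def)

lemma lam_coeff_zero [simp]: "lam_coeff (0\<^sub>m n n) i = 0\<^sub>m n n"
  by (intro eq_matI) (auto simp: lam_coeff_def)

lemma lam_coeff_eqI:
  assumes "A \<in> carrier_mat n n" "B \<in> carrier_mat n n" "\<And>i. lam_coeff A i = lam_coeff B i"
  shows "A = B"
proof (rule eq_matI)
  fix r c assume "r < dim_row B" "c < dim_col B"
  then have rc: "r < n" "c < n" using assms by auto
  show "A $$ (r, c) = B $$ (r, c)"
  proof (rule fls_eqI)
    fix k
    have "lam_coeff A (- k) $$ (r, c) = lam_coeff B (- k) $$ (r, c)"
      by (simp add: assms(3))
    then show "fls_nth (A $$ (r, c)) k = fls_nth (B $$ (r, c)) k"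
      using assms rc by (simp add: lam_coeff_def)
  qed
qed (use assms in auto)

text \<open>Bridge from the coefficientwise equation in \<open>is_Y_series\<close> to an equation
  between series, to which the product rule \<open>zdx_mult\<close> applies.\<close>

lemma lax_iff_coeffs:
  assumes n: "n > 0" and A: "zsmooth n p A" and u: "\<And>x. u x \<in> carrier_mat n n"
  shows "lax n u A \<longleftrightarrow> (\<forall>i x. mat_deriv n (\<lambda>y. lam_coeff (A y) i) x
      + lam_coeff (commutator (lax_op n (u x)) (A x)) i = 0\<^sub>m n n)"
proof -
  have c: "commutator (lax_op n (u x)) (A x) \<in> carrier_mat n n" for x
    using zsmooth_carrier[OF A] u by simp
  have "zdx n A x + commutator (lax_op n (u x)) (A x) = 0\<^sub>m n n \<longleftrightarrow>
    (\<forall>i. lam_coeff (zdx n A x) i + lam_coeff (commutator (lax_op n (u x)) (A x)) i = 0\<^sub>m n n)" for x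
    using lam_coeff_eqI[of "zdx n A x + commutator (lax_op n (u x)) (A x)" n "0\<^sub>m n n"] c[of x]
    by (auto simp: lam_coeff_add[OF zdx_carrier c] simp flip: lam_coeff_add[OF zdx_carrier c])
  then show ?thesis
    unfolding lax_def mat_deriv_lam_coeff[OF n A] by auto
qed

lemma zmat_J_pow:
  assumes n: "n \<ge> 2"
  shows "zbounded n (- int k) (J_mat n ^\<^sub>m k) \<and>
    (\<forall>r s. zmat n (J_mat n ^\<^sub>m k) r s = (if s = r - int k then 1 else 0))"
proof (induction k)
  case 0
  have "J_mat n ^\<^sub>m 0 = 1\<^sub>m n"
    using carrier_matD(1)[OF J_carrier[of n]] by simp
  then show ?case
    using n zbounded_one[of n] zmat_one[of n] by simp
next
  case (Suc k)
  have "zbounded n (- int k + - 1) (J_mat n ^\<^sub>m k * J_mat n)"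
    using Suc zbounded_J[OF n] n by (intro zbounded_mult) auto
  moreover have "- int k + - 1 = - int (Suc k)"
    by simp
  ultimately have "zbounded n (- int (Suc k)) (J_mat n ^\<^sub>m Suc k)"
    by (simp only: pow_mat.simps)
  then show ?case
    using zmat_mult_J[OF n, of "- int k" "J_mat n ^\<^sub>m k"] Suc by auto
qed

text \<open>n unit shifts move each index to the neighbouring block, and this is multiplication by
  lambda.\<close>

lemma J_pow_n: "n \<ge> 2 \<Longrightarrow> J_mat n ^\<^sub>m n = fls_X_inv \<cdot>\<^sub>m 1\<^sub>m n"
  by (rule zmat_eqI) (auto simp: zmat_J_pow zmat_lambda)

lemma Y_series_exists:
  assumes n: "n \<ge> 2" and u: "smooth_mat n u" "\<And>x. u x \<in> V_space n"
  shows "\<exists>Y. is_Y_series n u Y"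
proof -
  have n0: "n > 0" using n by simp
  obtain T where T: "zsmooth n 0 T" "\<And>x r. zmat n (T x) r r = 1"
    "\<And>x. zdx n T x + lax_op n (u x) * T x = T x * J_mat n"
    using dressing_matrix_exists[OF n u] by blast
  obtain S where S: "zsmooth n 0 S" "\<And>x r. zmat n (S x) r r = 1" "\<And>x. T x * S x = 1\<^sub>m n"
    "\<And>x. S x * T x = 1\<^sub>m n"
    using unitriangular_inverse[OF n0 T(1,2)] by blast
  let ?J = "J_mat n"
  define Y where "Y = (\<lambda>x. T x * (?J * S x))"
  note J = zsmooth_const[OF zbounded_J[OF n]]
  have JS: "zsmooth n (- 1) (\<lambda>x. ?J * S x)"
    using zsmooth_mult[OF n0 J S(1)] by simp
  have Y: "zsmooth n (- 1) Y"
    using zsmooth_mult[OF n0 T(1) JS] by (simp add: Y_def)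
  have Tc: "T x \<in> carrier_mat n n" and Sc: "S x \<in> carrier_mat n n" and Yc: "Y x \<in> carrier_mat n n"
    and uc: "u x \<in> carrier_mat n n" for x
    using zsmooth_carrier[OF T(1)] zsmooth_carrier[OF S(1)] zsmooth_carrier[OF Y]
      V_space_carrier[OF u(2)] by auto
  note assoc = assoc_mult_mat[of _ n n _ n _ n] mult_carrier_mat[of _ n n _ n]
  have lead: "zmat n (Y x) r (r - 1) = 1" for x r
    using zmat_mult_leading[OF n0 zsmooth_zbounded[OF T(1), of x] zsmooth_zbounded[OF JS, of x], of r]
      zmat_J_mult[OF n zsmooth_zbounded[OF S(1), of x], of r "r - 1"]
    by (simp add: Y_def T(2) S(2))
  have laxY: "lax n u Y"
    unfolding lax_def
  proof
    fix x
    let ?L = "lax_op n (u x)"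
    have Lc: "?L \<in> carrier_mat n n"
      using uc[of x] by simp
    have dT: "zdx n T x = T x * ?J - ?L * T x"
    proof (rule eq_matI)
      fix i k assume "i < dim_row (T x * ?J - ?L * T x)" "k < dim_col (T x * ?J - ?L * T x)"
      then have "i < n" "k < n" using Tc[of x] Lc by auto
      moreover have "(zdx n T x + ?L * T x) $$ (i, k) = (T x * ?J) $$ (i, k)"
        by (simp add: T(3))
      ultimately show "zdx n T x $$ (i, k) = (T x * ?J - ?L * T x) $$ (i, k)"
        using Tc[of x] Lc carrier_matD[OF zdx_carrier[of n T x]] carrier_matD[OF mult_carrier_mat[OF Lc Tc[of x]]]
          carrier_matD[OF mult_carrier_mat[OF Tc[of x] J_carrier]]
        by (simp add: eq_diff_eq del: index_mult_mat)
    qed (use Tc[of x] Lc carrier_matD[OF zdx_carrier[of n T x]] in auto)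
    \<comment> \<open>Differentiating T S = 1 gives T S_x = - T_x S, and T_x S = (T J - L T) S = Y -
      L.\<close>
    have TdS: "T x * zdx n S x = ?L - Y x"
    proof -
      have "zdx n T x * S x + T x * zdx n S x = 0\<^sub>m n n"
        using zdx_mult[OF n0 T(1) S(1), of x] zdx_const[OF n0 zbounded_one[OF n0]] by (simp add: S(3))
      moreover have "zdx n T x * S x = Y x - ?L"
        using Tc[of x] Sc[of x] Lc
        by (simp add: dT Y_def minus_mult_distrib_mat[of _ n n _ _ n] assoc S(3) right_mult_one_mat[OF Lc])
      ultimately have "Y x - ?L = - (T x * zdx n S x)"
        using mat_add_eq_0_iff[of "Y x - ?L" n n "T x * zdx n S x"] Tc[of x] Lc
        by (metis minus_carrier_mat mult_carrier_mat zdx_carrier)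
      then have "T x * zdx n S x = - (Y x - ?L)"
        by simp
      also have "\<dots> = ?L - Y x"
        using Yc[of x] uc[of x] by (intro eq_matI) auto
      finally show ?thesis .
    qed
    have dS: "zdx n S x = S x * ?L - ?J * S x"
    proof -
      have "zdx n S x = S x * T x * zdx n S x"
        by (simp add: S(4) left_mult_one_mat[OF zdx_carrier])
      also have "\<dots> = S x * (?L - Y x)"
        using Tc[of x] Sc[of x] by (simp add: assoc TdS)
      also have "\<dots> = S x * ?L - S x * T x * (?J * S x)"
        using Tc[of x] Sc[of x] Lc Yc[of x]
        by (simp add: mult_minus_distrib_mat[of _ n n _ n] assoc Y_def)
      finally show ?thesis
        by (simp add: S(4) left_mult_one_mat[OF mult_carrier_mat[OF J_carrier Sc]])
    qed
    have "zdx n Y x = zdx n T x * (?J * S x) + T x * (?J * zdx n S x)"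
      using zdx_mult[OF n0 T(1) JS, of x] zdx_mult[OF n0 J S(1), of x] zdx_const[OF n0 zbounded_J[OF n], of x] Sc[of x]
      by (simp add: Y_def left_add_zero_mat[OF mult_carrier_mat[OF J_carrier zdx_carrier]])
    also have "zdx n T x * (?J * S x) = T x * (?J * (?J * S x)) - ?L * Y x"
      using Tc[of x] Sc[of x] Lc by (simp add: dT minus_mult_distrib_mat[of _ n n _ _ n] assoc Y_def)
    also have "T x * (?J * zdx n S x) = Y x * ?L - T x * (?J * (?J * S x))"
      using Tc[of x] Sc[of x] Lc by (simp add: dS mult_minus_distrib_mat[of _ n n _ n] assoc Y_def)
    finally show "zdx n Y x + commutator ?L (Y x) = 0\<^sub>m n n"
      unfolding commutator_def using Tc[of x] Sc[of x] uc[of x] Yc[of x]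
      by (intro eq_matI) (auto simp del: index_mult_mat(1))
  qed
  have pow: "Y x ^\<^sub>m k = T x * (?J ^\<^sub>m k * S x)" for x k
  proof (induction k)
    case 0
    then show ?case
      using Yc[of x] Sc[of x] carrier_matD(1)[OF J_carrier[of n]]
      by (simp add: S(3) left_mult_one_mat[OF Sc])
  next
    case (Suc k)
    have "Y x ^\<^sub>m Suc k = T x * (?J ^\<^sub>m k * S x) * (T x * (?J * S x))"
      by (simp only: pow_mat.simps Suc) (simp only: Y_def)
    also have "\<dots> = T x * (?J ^\<^sub>m k * (S x * T x * (?J * S x)))"
      using Tc[of x] Sc[of x] by (simp add: assoc)
    finally show ?case
      using Tc[of x] Sc[of x] by (simp add: S(4) assoc left_mult_one_mat[of _ n n])
  qed
  have "is_Y_series n u Y"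
    unfolding is_Y_series_def
  proof (intro conjI allI impI)
    show "Y x \<in> carrier_mat n n" for x by (rule Yc)
    show "smooth_mat n (\<lambda>x. lam_coeff (Y x) i)" for i
      by (rule smooth_mat_lam_coeff[OF Y])
    show "(\<Sum>r<n. lam_coeff (Y x) i $$ (r, r)) = 0" for i x
    proof -
      have "(\<Sum>r<n. lam_coeff (Y x) i $$ (r, r)) = fls_nth (\<Sum>r<n. Y x $$ (r, r)) (- i)"
        using Yc[of x] by (simp add: lam_coeff_def fls_nth_sum)
      \<comment> \<open>Y is conjugate to J, whose diagonal is zero because n is at least 2.\<close>
      also have "(\<Sum>r<n. Y x $$ (r, r)) = (\<Sum>r<n. (?J * S x * T x) $$ (r, r))"
        unfolding Y_def by (intro mat_trace_comm Tc mult_carrier_mat[OF J_carrier Sc])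
      also have "?J * S x * T x = ?J"
        using Tc[of x] Sc[of x] by (simp add: assoc S(4) right_mult_one_mat[of _ n n])
      also have "(\<Sum>r<n. ?J $$ (r, r)) = 0"
        using n by (intro sum.neutral) (auto simp: J_mat_def E_mat_def b_mat_def)
      finally show ?thesis by simp
    qed
    show "lam_coeff (Y x) 1 = E_mat n 0 (n - 1)" for x
    proof (rule eq_matI)
      fix r c assume "r < dim_row (E_mat n 0 (n - 1) :: real mat)" "c < dim_col (E_mat n 0 (n - 1) :: real mat)"
      then have rc: "r < n" "c < n" by (auto simp: E_mat_def)
      have *: "lam_coeff (Y x) 1 $$ (r, c) = zmat n (Y x) (int r) (int c - int n)"
        using lam_coeff_zmat[OF Yc rc, of x 1] by simp
      \<comment> \<open>In the coefficient of lambda the degree is c - r - n, which is at least -1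
        only in the corner r = 0, c = n - 1; there it equals -1 and the entry is the leading
        one.\<close>
      show "lam_coeff (Y x) 1 $$ (r, c) = (E_mat n 0 (n - 1) :: real mat) $$ (r, c)"
      proof (cases "r = 0 \<and> c = n - 1")
        case True
        then show ?thesis
          unfolding * using lead[of x 0] rc n by (simp add: E_mat_def of_nat_diff)
      next
        case False
        then have "int c - int n < int r + - 1"
          using rc by auto
        then show ?thesis
          unfolding * using zbounded_zero[OF zsmooth_zbounded[OF Y]] rc False by (auto simp: E_mat_def)
      qed
    qed (use Yc[of x] in \<open>auto simp: lam_coeff_def E_mat_def\<close>)
    show "lam_coeff (Y x) i = 0\<^sub>m n n" if "i > 1" for i x
    proof (rule eq_matI)
      fix r c assume "r < dim_row (0\<^sub>m n n :: real mat)" "c < dim_col (0\<^sub>m n n :: real mat)"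
      then have rc: "r < n" "c < n" by auto
      have "int n * 2 \<le> int n * i"
        using that by (intro mult_left_mono) auto
      then have "int c - int n * i < int r + - 1"
        using rc by linarith
      then show "lam_coeff (Y x) i $$ (r, c) = 0\<^sub>m n n $$ (r, c)"
        using zbounded_zero[OF zsmooth_zbounded[OF Y]] rc lam_coeff_zmat[OF Yc rc, of x i] by auto
    qed (use Yc[of x] in \<open>auto simp: lam_coeff_def\<close>)
    show "mat_deriv n (\<lambda>y. lam_coeff (Y y) i) x + lam_coeff (commutator (lax_op n (u x)) (Y x)) i = 0\<^sub>m n n"
      for i x
      using laxY lax_iff_coeffs[where u = u, OF n0 Y uc] by blast
    show "Y x ^\<^sub>m n = fls_X_inv \<cdot>\<^sub>m 1\<^sub>m n" for x
      by (simp add: pow J_pow_n[OF n] mult_smult_assoc_mat[OF one_carrier_mat Sc]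
          mult_smult_distrib[OF Tc Sc] left_mult_one_mat[OF Sc] S(3))
  qed
  then show ?thesis by blast
qed


text \<open>The commutator with J is a difference along the diagonal of degree
  \<open>s - r + 1\<close>. The right-hand side involves A only in degrees up to
  \<open>s - r\<close>, because u has positive degree. Lower diagonals thus determine the next one
  up to a constant along it.\<close>

lemma zmat_lax:
  assumes n: "n \<ge> 2" and A: "zsmooth n p A" "lax n u A" and u: "u x \<in> V_space n"
  shows "zmat n (A x) (r - 1) s - zmat n (A x) r (s + 1) =
    zmat n (A x * map_mat fls_const (u x)) r s - zmat n (map_mat fls_const (u x) * A x) r s
      - deriv (\<lambda>y. zmat n (A y) r s) x"
proof -
  have n0: "n > 0" using n by simp
  let ?U = "map_mat fls_const (u x)"
  have c: "A x \<in> carrier_mat n n" "?U \<in> carrier_mat n n"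
    using zsmooth_carrier[OF A(1)] V_space_carrier[OF u] by auto
  then have c': "J_mat n * A x \<in> carrier_mat n n" "A x * J_mat n \<in> carrier_mat n n"
    "?U * A x \<in> carrier_mat n n" "A x * ?U \<in> carrier_mat n n"
    by (meson J_carrier mult_carrier_mat)+
  have "commutator (lax_op n (u x)) (A x) = (J_mat n * A x + ?U * A x) - (A x * J_mat n + A x * ?U)"
    using c unfolding commutator_def
    by (simp only: add_mult_distrib_mat[OF J_carrier c(2,1)] mult_add_distrib_mat[OF c(1) J_carrier c(2)])
  moreover have "zmat n (zdx n A x + commutator (lax_op n (u x)) (A x)) r s = zmat n (0\<^sub>m n n) r s"
    using A(2) by (simp add: lax_def)
  moreover have "zmat n (0\<^sub>m n n) r s = 0"
    using n0 by (simp add: zmat_def nat_less_iff)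
  ultimately have "zmat n (zdx n A x + ((J_mat n * A x + ?U * A x) - (A x * J_mat n + A x * ?U))) r s = 0"
    by simp
  then show ?thesis
    using c' by (simp add: zmat_add zmat_diff n0 zmat_zdx[OF n0 A(1)] minus_carrier_mat add_carrier_mat
        zmat_J_mult[OF n zsmooth_zbounded[OF A(1)]] zmat_mult_J[OF n zsmooth_zbounded[OF A(1)]])
qed

lemma int_shift_invariant_const:
  fixes f :: "int \<Rightarrow> 'a"
  assumes "\<And>r. f (r - 1) = f r"
  shows "f r = f s"
proof -
  have "f r = f 0" for r
  proof (induction r rule: int_induct[of _ 0])
    case (step1 i)
    then show ?case using assms[of "i + 1"] by simp
  next
    case (step2 i)
    then show ?case using assms[of i] by simp
  qed simp
  then show ?thesis by metis
qed

lemma zmat_pow_leading: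
  assumes n: "n > 0" and A: "zbounded n p A" and f: "\<And>r. zmat n A r (r + p) = f"
  shows "zbounded n (int k * p) (A ^\<^sub>m k) \<and> (\<forall>r. zmat n (A ^\<^sub>m k) r (r + int k * p) = f ^ k)"
proof (induction k)
  case 0
  have "dim_row A = n"
    using zbounded_carrier[OF A] by auto
  then show ?case
    using zbounded_one[OF n] zmat_one[OF n] by simp
next
  case (Suc k)
  have eq: "int (Suc k) * p = int k * p + p"
    by (simp add: algebra_simps)
  show ?case
    unfolding eq pow_mat.simps
    using zbounded_mult[OF n conjunct1[OF Suc] A] zmat_mult_leading[OF n conjunct1[OF Suc] A] Suc f
    by (simp add: add.assoc[symmetric])
qed

text \<open>Powers of lambda are at most 1, so the most negative degree possible is that of e_n1
  lambda, namely 1 - 2 n. This is only the starting bound, improved to -1 afterwards.\<close>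

lemma is_Y_series_zsmooth_aux:
  assumes n: "n \<ge> 2" and Y: "is_Y_series n u Y"
  shows "zsmooth n (1 - 2 * int n) Y"
  unfolding zsmooth_def zbounded_def
proof (intro conjI allI impI)
  show Yc: "Y x \<in> carrier_mat n n" for x
    using Y by (simp add: is_Y_series_def)
  have coeff: "zmat n (Y x) r s = lam_coeff (Y x) (- (s div int n - r div int n))
      $$ (nat (r mod int n), nat (s mod int n))" for x r s
    using Yc[of x] n by (simp add: zmat_def lam_coeff_def nat_less_iff)
  have rn: "nat (r mod int n) < n" for r
    using n by (simp add: nat_less_iff)
  show "smooth (\<lambda>x. zmat n (Y x) r s)" for r s
    unfolding coeff using Y rn by (simp add: is_Y_series_def smooth_mat_def)
  show "zmat n (Y x) r s = 0" if s: "s < r + (1 - 2 * int n)" for x r s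
  proof -
    have "r mod int n < int n" "0 \<le> s mod int n"
      using n by auto
    then have "int n * (s div int n) < int n * (r div int n) - int n"
      using s mult_div_mod_eq[of "int n" r] mult_div_mod_eq[of "int n" s] by linarith
    also have "\<dots> = int n * (r div int n - 1)"
      by (simp add: algebra_simps)
    finally have "s div int n < r div int n - 1"
      using n by simp
    then have "- (s div int n - r div int n) > 1"
      by simp
    then show ?thesis
      unfolding coeff using Y rn by (simp add: is_Y_series_def)
  qed
qed

lemma is_Y_series_lax:
  assumes n: "n \<ge> 2" and Y: "is_Y_series n u Y" and u: "\<And>x. u x \<in> V_space n"
  shows "lax n u Y"
proof -
  have "\<forall>i x. mat_deriv n (\<lambda>y. lam_coeff (Y y) i) x
      + lam_coeff (commutator (lax_op n (u x)) (Y x)) i = 0\<^sub>m n n"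
    using Y unfolding is_Y_series_def by blast
  moreover have "n > 0"
    using n by simp
  ultimately show ?thesis
    using lax_iff_coeffs[OF _ is_Y_series_zsmooth_aux[OF n Y]] V_space_carrier[OF u] by blast
qed

text \<open>The leading diagonal of \<open>Y\<close> commutes with the shift, so it is constant; its \<open>n\<close>-th power is
  the leading diagonal of \<open>\<lambda> I\<close> if it sits at distance \<open>-1\<close>, and zero if it is further out.\<close>

lemma is_Y_series_leading:
  assumes n: "n \<ge> 2" and Y: "is_Y_series n u Y" and u: "\<And>x. u x \<in> V_space n"
  shows "zsmooth n (- 1) Y" and "zmat n (Y x) r (r - 1) = 1"
proof -
  have n0: "n > 0" using n by simp
  note laxY = is_Y_series_lax[OF n Y u]
  have const: "zmat n (Y x) r (r + p) = zmat n (Y x) s (s + p)" if Yp: "zsmooth n p Y" for p x r s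
  proof -
    have "zmat n (Y x) (r - 1) (r - 1 + p) = zmat n (Y x) r (r + p)" for r
    proof -
      note b = zsmooth_zbounded[OF Yp, of x] and U = zbounded_V_space[OF n0 u, of x]
      have "(\<lambda>y. zmat n (Y y) r (r + p - 1)) = (\<lambda>y. 0)"
        using zbounded_zero[OF zsmooth_zbounded[OF Yp]] by simp
      then show ?thesis
        using zmat_lax[OF n Yp laxY u, of x r "r + p - 1"]
          zbounded_zero[OF zbounded_mult[OF n0 U b], of "r + p - 1" r]
          zbounded_zero[OF zbounded_mult[OF n0 b U], of "r + p - 1" r]
        by (simp add: algebra_simps)
    qed
    then show ?thesis
      by (rule int_shift_invariant_const)
  qed
  have step: "zsmooth n (p + 1) Y" if Yp: "zsmooth n p Y" and p: "p < - 1" for p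
  proof -
    have "zmat n (Y x) r (r + p) = 0" for x r
    proof -
      define f where "f = zmat n (Y x) r (r + p)"
      have "zmat n (Y x ^\<^sub>m n) r (r + int n * p) = f ^ n"
        using zmat_pow_leading[OF n0 zsmooth_zbounded[OF Yp, of x], of f n] const[OF Yp, of x _ r]
        by (simp add: f_def)
      \<comment> \<open>The matrix lambda I lives on the single diagonal -n, so the leading diagonal
        of Y^n can be nonzero only if p = -1.\<close>
      moreover have "int n * p \<noteq> - int n"
      proof
        assume "int n * p = - int n"
        then have "int n * (p + 1) = 0"
          by (simp add: algebra_simps)
        then show False
          using p n0 by simp
      qed
      ultimately have "f ^ n = 0"
        using Y zmat_lambda[OF n0, of r "r + int n * p"] by (simp add: is_Y_series_def)
      then show ?thesis by (simp add: f_def)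
    qed
    then have "zmat n (Y x) r s = 0" if "s < r + (p + 1)" for x r s
      using that zbounded_zero[OF zsmooth_zbounded[OF Yp, of x], of s r] by (cases "s = r + p") auto
    then show ?thesis
      using Yp by (auto simp: zsmooth_def zbounded_def)
  qed
  \<comment> \<open>Climbing from 1 - 2 n to -1 takes 2 n - 2 steps.\<close>
  have "zsmooth n (1 - 2 * int n + int k) Y" if "k \<le> 2 * n - 2" for k
    using that
  proof (induction k)
    case 0
    then show ?case using is_Y_series_zsmooth_aux[OF n Y] by simp
  next
    case (Suc k)
    then show ?case
      using step[of "1 - 2 * int n + int k"] by (simp add: algebra_simps)
  qed
  from this[of "2 * n - 2"] show 1: "zsmooth n (- 1) Y"
    using n by (simp add: of_nat_diff)
  have Yc: "Y x \<in> carrier_mat n n"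
    using Y by (simp add: is_Y_series_def)
  \<comment> \<open>Y^n = lambda I alone would give a constant f with f^n = 1, leaving the sign open
    for even n; the prescribed coefficient e_1n of lambda selects f = 1.\<close>
  have "zmat n (Y x) 0 (- 1) = lam_coeff (Y x) 1 $$ (0, n - 1)"
    using lam_coeff_zmat[OF Yc, of 0 "n - 1" 1] n by (simp add: of_nat_diff)
  also have "\<dots> = 1"
    using Y n by (simp add: is_Y_series_def E_mat_def)
  finally show "zmat n (Y x) r (r - 1) = 1"
    using const[OF 1, of x r 0] by simp
qed

lemma mat_diff_split_mult:
  fixes A B C D :: "'a::comm_ring_1 mat"
  assumes "A \<in> carrier_mat n n" "B \<in> carrier_mat n n" "C \<in> carrier_mat n n" "D \<in> carrier_mat n n"
  shows "A * B - C * D = A * (B - D) + (A - C) * D"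
proof -
  have "A * (B - D) + (A - C) * D = (A * B - A * D) + (A * D - C * D)"
    using assms by (simp add: minus_mult_distrib_mat[of _ n n _ _ n] mult_minus_distrib_mat[of _ n n _ n])
  also have "\<dots> = A * B - C * D"
    using assms by (intro eq_matI) (auto simp del: index_mult_mat(1))
  finally show ?thesis ..
qed

text \<open>The noncommutative counterpart of a^k - b^k being approximately k a^(k-1) (a - b):
  telescoping produces k products, each contributing \<open>f\<close> because the leading diagonals
  of A and B consist of ones.\<close>

lemma zmat_pow_diff_leading:
  assumes n: "n > 0" and A: "zbounded n (- 1) A" "\<And>r. zmat n A r (r - 1) = 1"
    and B: "zbounded n (- 1) B" "\<And>r. zmat n B r (r - 1) = 1"
    and D: "zbounded n p (A - B)" "\<And>r. zmat n (A - B) r (r + p) = f"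
  shows "zbounded n (p + 1 - int k) (A ^\<^sub>m k - B ^\<^sub>m k) \<and>
    (\<forall>r. zmat n (A ^\<^sub>m k - B ^\<^sub>m k) r (r + p + 1 - int k) = of_nat k * f)"
proof (induction k)
  case 0
  have "A ^\<^sub>m 0 - B ^\<^sub>m 0 = 0\<^sub>m n n"
    using zbounded_carrier[OF A(1)] zbounded_carrier[OF B(1)] by auto
  then show ?case
    using n by (simp add: zbounded_def zmat_def nat_less_iff)
next
  case (Suc k)
  note c = zbounded_carrier[OF A(1)] zbounded_carrier[OF B(1)]
  have pA: "zbounded n (- int k) (A ^\<^sub>m k)" "zmat n (A ^\<^sub>m k) r (r - int k) = 1" for r
    using zmat_pow_leading[OF n A(1), of 1 k] A(2) by auto
  have eq: "A ^\<^sub>m Suc k - B ^\<^sub>m Suc k = A ^\<^sub>m k * (A - B) + (A ^\<^sub>m k - B ^\<^sub>m k) * B"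
    using mat_diff_split_mult[OF pow_carrier_mat[OF c(1)] c(1) pow_carrier_mat[OF c(2)] c(2)] by simp
  have b1: "zbounded n (p + 1 - int (Suc k)) (A ^\<^sub>m k * (A - B))"
    using zbounded_mult[OF n pA(1) D(1)] by (simp add: algebra_simps)
  have b2: "zbounded n (p + 1 - int (Suc k)) ((A ^\<^sub>m k - B ^\<^sub>m k) * B)"
    using zbounded_mult[OF n conjunct1[OF Suc] B(1)] by (simp add: algebra_simps)
  have l1: "zmat n (A ^\<^sub>m k * (A - B)) r (r + p + 1 - int (Suc k)) = f" for r
    using zmat_mult_leading[OF n pA(1) D(1), of r] pA(2)[of r] D(2)[of "r - int k"]
    by (simp add: algebra_simps)
  have l2: "zmat n ((A ^\<^sub>m k - B ^\<^sub>m k) * B) r (r + p + 1 - int (Suc k)) = of_nat k * f" for r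
    using zmat_mult_leading[OF n conjunct1[OF Suc] B(1), of r]
      conjunct2[OF Suc, rule_format, of r] B(2)[of "r + p + 1 - int k"]
    by (simp add: algebra_simps)
  show ?case
    unfolding eq using zbounded_add[OF n b1 b2] l1 l2
    by (simp add: zmat_add[OF zbounded_carrier[OF b1] zbounded_carrier[OF b2] n] algebra_simps)
qed

text \<open>If the difference D of two solutions starts in degree p, its leading diagonal is a
  constant f, since all terms on the right of \<open>zmat_lax\<close> agree there. Both n-th powers
  equal lambda I, so n f = 0 and D starts in degree p + 1 at least.\<close>

lemma Y_series_unique:
  assumes n: "n \<ge> 2" and u: "\<And>x. u x \<in> V_space n"
    and Y: "is_Y_series n u Y" and Y': "is_Y_series n u Y'"
  shows "Y = Y'"
proof -
  have n0: "n > 0" using n by simp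
  note lY = is_Y_series_lax[OF n Y u] and lY' = is_Y_series_lax[OF n Y' u]
  note sY = is_Y_series_leading(1)[OF n Y u] and sY' = is_Y_series_leading(1)[OF n Y' u]
  note oY = is_Y_series_leading(2)[OF n Y u] and oY' = is_Y_series_leading(2)[OF n Y' u]
  note bY = zsmooth_zbounded[OF sY] and bY' = zsmooth_zbounded[OF sY']
  have c: "Y x \<in> carrier_mat n n" "Y' x \<in> carrier_mat n n" for x
    using zbounded_carrier[OF bY] zbounded_carrier[OF bY'] by auto
  have bounded: "\<forall>x. zbounded n (int p) (Y x - Y' x)" for p
  proof (induction p)
    case 0
    have "zmat n (Y x) r s - zmat n (Y' x) r s = 0" if "s < r" for x r s
      using zbounded_zero[OF bY, of s r] zbounded_zero[OF bY', of s r] oY[of x r] oY'[of x r] that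
      by (cases "s = r - 1") auto
    then show ?case
      using minus_carrier_mat[OF c(2)] by (simp add: zbounded_def zmat_diff[OF c n0])
  next
    case (Suc p)
    have "zmat n (Y x - Y' x) r (r + int p) = 0" for x r
    proof -
      let ?U = "map_mat fls_const (u x)" and ?D = "Y x - Y' x"
      note U = zbounded_V_space[OF n0 u, of x]
      have D: "zbounded n (int p) ?D" using Suc by simp
      have cU: "?U \<in> carrier_mat n n"
        by (rule zbounded_carrier[OF U])
      have const: "zmat n ?D (r - 1) (r - 1 + int p) = zmat n ?D r (r + int p)" for r
      proof -
        let ?s = "r + int p - 1"
        have "zmat n (Y y) r ?s = zmat n (Y' y) r ?s" for y
          using zbounded_zero[of n "int p" "Y y - Y' y" ?s r] Suc by (simp add: zmat_diff[OF c n0])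
        then have "deriv (\<lambda>y. zmat n (Y y) r ?s) x = deriv (\<lambda>y. zmat n (Y' y) r ?s) x"
          by simp
        moreover have "zmat n (?U * Y x) r ?s = zmat n (?U * Y' x) r ?s"
        proof -
          have "?U * Y x - ?U * Y' x = ?U * ?D"
            using mult_minus_distrib_mat[OF cU c(1) c(2)] by simp
          then have "zmat n (?U * Y x - ?U * Y' x) r ?s = 0"
            using zbounded_zero[OF zbounded_mult[OF n0 U D], of ?s r] by simp
          then show ?thesis
            using zmat_diff[OF mult_carrier_mat[OF cU c(1)] mult_carrier_mat[OF cU c(2)] n0] by simp
        qed
        moreover have "zmat n (Y x * ?U) r ?s = zmat n (Y' x * ?U) r ?s"
        proof -
          have "Y x * ?U - Y' x * ?U = ?D * ?U"
            using minus_mult_distrib_mat[OF c(1) c(2) cU] by simp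
          then have "zmat n (Y x * ?U - Y' x * ?U) r ?s = 0"
            using zbounded_zero[OF zbounded_mult[OF n0 D U], of ?s r] by simp
          then show ?thesis
            using zmat_diff[OF mult_carrier_mat[OF c(1) cU] mult_carrier_mat[OF c(2) cU] n0] by simp
        qed
        ultimately show ?thesis
          using zmat_lax[OF n sY lY u, of x r ?s] zmat_lax[OF n sY' lY' u, of x r ?s]
          by (simp add: zmat_diff[OF c n0] algebra_simps)
      qed
      define f where "f = zmat n ?D r (r + int p)"
      have f: "zmat n ?D s (s + int p) = f" for s
        unfolding f_def using const
        by (rule int_shift_invariant_const[of "\<lambda>r. zmat n ?D r (r + int p)"])
      have "Y x ^\<^sub>m n - Y' x ^\<^sub>m n = 0\<^sub>m n n"
        using Y Y' by (simp add: is_Y_series_def)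
      then have "of_nat n * f = 0"
        using zmat_pow_diff_leading[OF n0 bY oY bY' oY' D f, of n]
        by (simp add: zmat_def nat_less_iff n0)
      then show ?thesis
        using n0 by (simp add: f_def)
    qed
    then have "zmat n (Y x - Y' x) r s = 0" if "s < r + int (Suc p)" for x r s
      using that zbounded_zero[of n "int p" "Y x - Y' x" s r] Suc by (cases "s = r + int p") auto
    then show ?case
      using Suc by (auto simp: zbounded_def)
  qed
  \<comment> \<open>Any given entry lies below the diagonal of degree s - r + 1, taken as 0 when
    negative.\<close>
  have "zmat n (Y x - Y' x) r s = 0" for x r s
  proof (rule zbounded_zero)
    show "zbounded n (int (nat (s - r + 1))) (Y x - Y' x)"
      using bounded by blast
  qed simp
  then have "Y x = Y' x" for x
    using c by (intro zmat_eqI[of _ n]) (auto simp: zmat_diff[OF c n0])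
  then show ?thesis by blast
qed

lemma is_Y_series_Y_series:
  assumes n: "n \<ge> 2" and u: "smooth_mat n u" "\<And>x. u x \<in> V_space n"
  shows "is_Y_series n u (Y_series n u)"
proof -
  have "\<exists>!Y. is_Y_series n u Y"
    using Y_series_exists[OF n u] Y_series_unique[where u = u, OF n u(2)] by blast
  then show ?thesis
    unfolding Y_series_def by (rule theI'[of "is_Y_series n u"])
qed

section \<open>The matrices \<open>Z\<^sub>j\<^sub>,\<^sub>0(u)\<close>\<close>

text \<open>b + U is a companion matrix: multiplication from the right moves column c + 1 to column
  c and puts a linear combination of the first n - 1 columns into the last.\<close>

lemma mult_b_plus_V_space:
  fixes A :: "real mat"
  assumes A: "A \<in> carrier_mat n n" and U: "U \<in> V_space n" and i: "i < n"
  shows "c < n - 1 \<Longrightarrow> (A * (b_mat n + U)) $$ (i, c) = A $$ (i, Suc c)"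
    and "n > 0 \<Longrightarrow> (A * (b_mat n + U)) $$ (i, n - 1) = (\<Sum>k<n-1. A $$ (i, k) * U $$ (k, n - 1))"
proof -
  have Uc: "U \<in> carrier_mat n n" by (rule V_space_carrier[OF U])
  have prod: "(A * (b_mat n + U)) $$ (i, c) = (\<Sum>k<n. A $$ (i, k) * ((if k = Suc c then 1 else 0) + U $$ (k, c)))"
    if "c < n" for c
    using A Uc i that by (simp add: scalar_prod_def lessThan_atLeast0 b_mat_def)
  show "(A * (b_mat n + U)) $$ (i, c) = A $$ (i, Suc c)" if c: "c < n - 1"
  proof -
    have "U $$ (k, c) = 0" if "k < n" for k
      using V_space_entry[OF U that, of c] c by linarith
    then have "(A * (b_mat n + U)) $$ (i, c) = (\<Sum>k<n. if k = Suc c then A $$ (i, Suc c) else 0)"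
      using c unfolding prod[of c, OF less_le_trans[OF c diff_le_self]] by (intro sum.cong) auto
    then show ?thesis using c by simp
  qed
  show "(A * (b_mat n + U)) $$ (i, n - 1) = (\<Sum>k<n-1. A $$ (i, k) * U $$ (k, n - 1))" if n: "n > 0"
  proof -
    have "(A * (b_mat n + U)) $$ (i, n - 1) = (\<Sum>k<n. A $$ (i, k) * U $$ (k, n - 1))"
      using n by (subst prod) (auto intro!: sum.cong)
    moreover have "U $$ (n - 1, n - 1) = 0"
      using V_space_entry[OF U, of "n - 1" "n - 1"] n by auto
    ultimately show ?thesis
      using n by (cases n) auto
  qed
qed

lemma mat_deriv_carrier [simp]: "mat_deriv n A x \<in> carrier_mat n n"
  by (simp add: mat_deriv_def)

lemma b_mat_carrier [simp]: "b_mat n \<in> carrier_mat n n"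
  by (simp add: b_mat_def)

text \<open>In a column before the last, membership in V_n forces the commutator to vanish, and the
  term A (b + u) there is the next column of A.\<close>

lemma dx_commutator_V_space_column:
  assumes A: "\<And>x. A x \<in> carrier_mat n n" and U: "u x \<in> V_space n"
    and V: "dx_commutator n (\<lambda>y. b_mat n + u y) A x \<in> V_space n" and r: "r < n" "c < n - 1"
  shows "A x $$ (r, Suc c) = deriv (\<lambda>y. A y $$ (r, c)) x + ((b_mat n + u x) * A x) $$ (r, c)"
proof -
  have Uc: "u x \<in> carrier_mat n n" by (rule V_space_carrier[OF U])
  have "dx_commutator n (\<lambda>y. b_mat n + u y) A x $$ (r, c) = 0"
    using V_space_entry[OF V r(1), of c] r by linarith
  then show ?thesis
    using mult_b_plus_V_space(1)[OF A U r] A[of x] Uc r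
    by (simp add: dx_commutator_def commutator_def mat_deriv_def del: index_mult_mat(1))
qed

lemma V_spaceI:
  assumes "W \<in> carrier_mat n n" "\<And>r c. r < n \<Longrightarrow> c < n \<Longrightarrow> c \<noteq> n - 1 \<or> r = n - 1 \<Longrightarrow> W $$ (r, c) = 0"
  shows "W \<in> V_space n"
proof -
  have "W $$ (r, c) = (if c = n - 1 \<and> r < n - 1 then W $$ (r, n - 1) else 0)" if "r < n" "c < n" for r c
  proof (cases "c = n - 1 \<and> r < n - 1")
    case False
    then have "c \<noteq> n - 1 \<or> r = n - 1"
      using that by linarith
    from assms(2)[OF that this] show ?thesis
      using False by (simp only: if_False)
  qed (simp only: if_True simp_thms)
  then have W: "W = mat n n (\<lambda>(r, c). if c = n - 1 \<and> r < n - 1 then W $$ (r, n - 1) else 0)"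
    using assms(1) by (intro eq_matI) auto
  show ?thesis
    unfolding V_space_def
    by (rule CollectI, rule exI[of _ "\<lambda>r. W $$ (r, n - 1)"], rule conjI[OF W TrueI])
qed

lemma smooth_mat_carrier: "smooth_mat n A \<Longrightarrow> A x \<in> carrier_mat n n"
  and smooth_mat_entry: "smooth_mat n A \<Longrightarrow> i < n \<Longrightarrow> k < n \<Longrightarrow> smooth (\<lambda>x. A x $$ (i, k))"
  by (simp_all add: smooth_mat_def)

text \<open>The last column of a matrix in \<open>V\<^sub>n\<close> carries no condition, so \<open>[\<partial>\<^sub>x + b + u, Z] \<in> V\<^sub>n\<close>
  determines each column of \<open>Z\<close> from the preceding one.\<close>

primrec frame_column ::
    "nat \<Rightarrow> (real \<Rightarrow> real mat) \<Rightarrow> (nat \<Rightarrow> real \<Rightarrow> real) \<Rightarrow> nat \<Rightarrow> nat \<Rightarrow> real \<Rightarrow> real" where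
  "frame_column n B f 0 = f"
| "frame_column n B f (Suc c) = (\<lambda>r x. deriv (frame_column n B f c r) x
     + (\<Sum>q<n. B x $$ (r, q) * frame_column n B f c q x))"

lemma smooth_frame_column:
  assumes B: "smooth_mat n B" and f: "\<And>r. r < n \<Longrightarrow> smooth (f r)"
  shows "r < n \<Longrightarrow> smooth (frame_column n B f c r)"
proof (induction c arbitrary: r)
  case (Suc c)
  then show ?case
    by (auto intro!: smooth_add smooth_deriv_real smooth_sum smooth_mult smooth_mat_entry[OF B])
qed (simp add: f)

lemma smooth_mat_add:
  assumes "smooth_mat n A" "smooth_mat n B"
  shows "smooth_mat n (\<lambda>x. A x + B x)"
  using assms carrier_matD[OF smooth_mat_carrier[OF assms(1)]] carrier_matD[OF smooth_mat_carrier[OF assms(2)]]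
  by (auto simp: smooth_mat_def intro!: smooth_add)

lemma smooth_mat_diff:
  assumes "smooth_mat n A" "smooth_mat n B"
  shows "smooth_mat n (\<lambda>x. A x - B x)"
  using assms carrier_matD[OF smooth_mat_carrier[OF assms(1)]] carrier_matD[OF smooth_mat_carrier[OF assms(2)]]
  by (auto simp: smooth_mat_def minus_carrier_mat intro!: smooth_diff)

lemma smooth_mat_mult:
  assumes "smooth_mat n A" "smooth_mat n B"
  shows "smooth_mat n (\<lambda>x. A x * B x)"
  using assms carrier_matD[OF smooth_mat_carrier[OF assms(1)]] carrier_matD[OF smooth_mat_carrier[OF assms(2)]]
  by (auto simp: smooth_mat_def scalar_prod_def intro!: smooth_sum smooth_mult mult_carrier_mat)

lemma smooth_mat_const: "A \<in> carrier_mat n n \<Longrightarrow> smooth_mat n (\<lambda>x. A)"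
  by (simp add: smooth_mat_def)

lemma lam_coeff_const_mult:
  assumes "B \<in> carrier_mat n n" "A \<in> carrier_mat n n"
  shows "lam_coeff (map_mat fls_const B * A) i = B * lam_coeff A i"
    and "lam_coeff (A * map_mat fls_const B) i = lam_coeff A i * B"
proof -
  have "fls_nth (f * fls_const a) k = fls_nth f k * a" for f :: "real fls" and a k
    by (simp add: mult.commute[of f])
  then show "lam_coeff (map_mat fls_const B * A) i = B * lam_coeff A i"
    "lam_coeff (A * map_mat fls_const B) i = lam_coeff A i * B"
    using assms by (auto intro!: eq_matI sum.cong simp: lam_coeff_def scalar_prod_def fls_nth_sum)
qed

text \<open>In the coefficient of lambda^0 the part e_1n lambda contributes only a commutator with
  e_1n, confined to the first row and the last column; elsewhere the coefficient satisfies the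
  equation with b + u alone. The trace is constant in x because commutators have trace zero.\<close>

lemma lax_coeff_zero:
  assumes n: "n \<ge> 2" and A: "zsmooth n p A" "lax n u A" and u: "\<And>x. u x \<in> V_space n"
  shows "1 \<le> r \<Longrightarrow> r < n \<Longrightarrow> c < n - 1 \<Longrightarrow>
      dx_commutator n (\<lambda>y. b_mat n + u y) (\<lambda>y. lam_coeff (A y) 0) x $$ (r, c) = 0"
    and "(\<Sum>r<n. mat_deriv n (\<lambda>y. lam_coeff (A y) 0) x $$ (r, r)) = 0"
proof -
  have n0: "n > 0" using n by simp
  have Ac: "A x \<in> carrier_mat n n" and uc: "u x \<in> carrier_mat n n" for x
    using zsmooth_carrier[OF A(1)] V_space_carrier[OF u] by auto
  let ?E = "fls_X_inv \<cdot>\<^sub>m E_mat n 0 (n - 1) :: real fls mat"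
  let ?C = "map_mat fls_const (b_mat n + u x)"
  let ?L = "lax_op n (u x)"
  have Ec: "?E \<in> carrier_mat n n"
    by (simp add: E_mat_def)
  have Cc: "?C \<in> carrier_mat n n"
    using uc[of x] by simp
  have L: "?L = ?E + ?C"
    using uc[of x] by (intro eq_matI) (auto simp: J_mat_def b_mat_def E_mat_def simp flip: fls_plus_const)
  have Lc: "?L \<in> carrier_mat n n"
    using uc[of x] by simp
  have eq: "mat_deriv n (\<lambda>y. lam_coeff (A y) 0) x + lam_coeff (commutator ?L (A x)) 0 = 0\<^sub>m n n"
    using A(2) lax_iff_coeffs[where u = u, OF n0 A(1) uc] by blast
  note dims = carrier_matD[OF mult_carrier_mat[OF Ec Ac[of x]]] carrier_matD[OF mult_carrier_mat[OF Ac[of x] Ec]]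
    carrier_matD[OF mult_carrier_mat[OF Cc Ac[of x]]] carrier_matD[OF mult_carrier_mat[OF Ac[of x] Cc]]
  show "dx_commutator n (\<lambda>y. b_mat n + u y) (\<lambda>y. lam_coeff (A y) 0) x $$ (r, c) = 0"
    if rc: "1 \<le> r" "r < n" "c < n - 1"
  proof -
    have c: "c < n" using rc by simp
    have E1: "(?E * A x) $$ (r, c) = 0"
      using rc c Ac[of x] by (simp add: scalar_prod_def E_mat_def)
    have E2: "(A x * ?E) $$ (r, c) = 0"
      using rc c Ac[of x] by (simp add: scalar_prod_def E_mat_def)
    have "commutator ?L (A x) = (?E * A x + ?C * A x) - (A x * ?E + A x * ?C)"
      unfolding commutator_def L
      by (simp only: add_mult_distrib_mat[OF Ec Cc Ac] mult_add_distrib_mat[OF Ac Ec Cc])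
    then have "commutator ?L (A x) $$ (r, c) = (?C * A x) $$ (r, c) - (A x * ?C) $$ (r, c)"
      using rc c E1 E2 dims by (simp del: index_mult_mat(1))
    then have "lam_coeff (commutator ?L (A x)) 0 $$ (r, c)
        = lam_coeff (?C * A x) 0 $$ (r, c) - lam_coeff (A x * ?C) 0 $$ (r, c)"
      using rc c dims carrier_matD[OF commutator_carrier[OF Lc Ac[of x]]]
      by (simp add: lam_coeff_def del: index_mult_mat(1))
    also have "\<dots> = commutator (b_mat n + u x) (lam_coeff (A x) 0) $$ (r, c)"
      using lam_coeff_const_mult[OF _ Ac[of x], of "b_mat n + u x" 0] uc[of x] rc c Ac[of x]
        carrier_matD[OF lam_coeff_carrier[OF Ac[of x]]]
      by (simp add: commutator_def del: index_mult_mat(1))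
    finally have "lam_coeff (commutator ?L (A x)) 0 $$ (r, c)
        = commutator (b_mat n + u x) (lam_coeff (A x) 0) $$ (r, c)" .
    moreover have "(mat_deriv n (\<lambda>y. lam_coeff (A y) 0) x + lam_coeff (commutator ?L (A x)) 0) $$ (r, c) = 0"
      using eq rc c by simp
    ultimately show ?thesis
      using rc c carrier_matD[OF lam_coeff_carrier[OF commutator_carrier[OF Lc Ac[of x]], of 0]]
        carrier_matD[OF commutator_carrier[OF _ lam_coeff_carrier[OF Ac[of x]], of "b_mat n + u x" 0]] uc[of x]
      by (simp add: dx_commutator_def)
  qed
  have "(\<Sum>r<n. commutator ?L (A x) $$ (r, r)) = (\<Sum>r<n. (?L * A x) $$ (r, r)) - (\<Sum>r<n. (A x * ?L) $$ (r, r))"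
    using Lc Ac[of x] carrier_matD[OF mult_carrier_mat[OF Lc Ac[of x]]] carrier_matD[OF mult_carrier_mat[OF Ac[of x] Lc]]
    by (simp add: commutator_def sum_subtractf del: index_mult_mat(1))
  also have "\<dots> = 0"
    using mat_trace_comm[OF Lc Ac[of x]] by simp
  finally have "fls_nth (\<Sum>r<n. commutator ?L (A x) $$ (r, r)) 0 = 0"
    by simp
  then have tr: "(\<Sum>r<n. lam_coeff (commutator ?L (A x)) 0 $$ (r, r)) = 0"
    using carrier_matD[OF commutator_carrier[OF Lc Ac[of x]]] by (simp add: lam_coeff_def fls_nth_sum)
  have "(mat_deriv n (\<lambda>y. lam_coeff (A y) 0) x + lam_coeff (commutator ?L (A x)) 0) $$ (r, r) = 0" if "r < n" for r
    using eq that by simp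
  then have "mat_deriv n (\<lambda>y. lam_coeff (A y) 0) x $$ (r, r) = - lam_coeff (commutator ?L (A x)) 0 $$ (r, r)" if "r < n" for r
    using that carrier_matD[OF lam_coeff_carrier[OF commutator_carrier[OF Lc Ac[of x]], of 0]]
    by (simp add: eq_neg_iff_add_eq_0)
  then show "(\<Sum>r<n. mat_deriv n (\<lambda>y. lam_coeff (A y) 0) x $$ (r, r)) = 0"
    using tr by (simp add: sum_negf)
qed

text \<open>Strict upper triangularity of zeta fixes the first column of Z = Y_{j,0} - zeta, and
  membership in V_n fixes the remaining columns. What has to be proved is that the Z so constructed
  agrees with Y_{j,0} on and below the diagonal, and that the corner entry of the commutator
  vanishes.\<close>

lemma zeta_exists_unique:
  assumes n: "n \<ge> 2" and u: "smooth_mat n u" "\<And>x. u x \<in> V_space n"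
  shows "smooth_mat n (Y_coeff n j 0 u)" and "\<exists>!\<zeta>. is_zeta n j u \<zeta>"
proof -
  have n0: "n > 0" using n by simp
  define A where "A = (\<lambda>x. Y_series n u x ^\<^sub>m j)"
  note Y = is_Y_series_Y_series[OF n u]
  note sY = is_Y_series_leading(1)[where u = u, OF n Y u(2)]
  have uc: "u x \<in> carrier_mat n n" for x
    by (rule V_space_carrier[OF u(2)])
  note A = zsmooth_pow[OF n0 sY, of j, folded A_def]
    and laxA = lax_pow[where u = u, OF n0 sY is_Y_series_lax[where u = u, OF n Y u(2)] uc, of j, folded A_def]
  define P where "P = Y_coeff n j 0 u"
  have P: "P = (\<lambda>x. lam_coeff (A x) 0)"
    by (simp add: P_def Y_coeff_def A_def fun_eq_iff)
  show sP: "smooth_mat n (Y_coeff n j 0 u)"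
    using smooth_mat_lam_coeff[OF A, of 0] by (simp add: P flip: P_def)
  note sP = sP[folded P_def]
  let ?B = "\<lambda>x. b_mat n + u x"
  define z where "z = frame_column n ?B (\<lambda>r x. P x $$ (r, 0))"
  have z0: "z 0 = (\<lambda>r x. P x $$ (r, 0))"
    and zSuc: "z (Suc c) = (\<lambda>r x. deriv (z c r) x + (\<Sum>q<n. ?B x $$ (r, q) * z c q x))" for c
    by (simp_all add: z_def)
  have sz: "smooth (z c r)" if "r < n" for r c
    unfolding z_def using that n0
    by (intro smooth_frame_column smooth_mat_add smooth_mat_const u smooth_mat_entry[OF sP]) auto
  have Bmult: "(?B x * M) $$ (r, c) = (\<Sum>q<n. ?B x $$ (r, q) * M $$ (q, c))"
    if "M \<in> carrier_mat n n" "r < n" "c < n" for M x r c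
    using that uc[of x] by (simp add: scalar_prod_def lessThan_atLeast0)
  define Z where "Z = (\<lambda>x. mat n n (\<lambda>(r, c). z c r x))"
  have Zc: "Z x \<in> carrier_mat n n" for x
    by (simp add: Z_def)
  have Zi: "Z x $$ (r, c) = z c r x" if "r < n" "c < n" for x r c
    using that by (simp add: Z_def)
  have sZ: "smooth_mat n Z"
    using sz by (simp add: smooth_mat_def Zi Zc)
  \<comment> \<open>Induction over columns: for a position in column c + 1 on or below the diagonal,
    the recursion in row r uses only entries of column c on or below the diagonal, and there Z and P
    already agree.\<close>
  have lower: "z c r = (\<lambda>x. P x $$ (r, c))" if "c \<le> r" "r < n" for c r
    using that
  proof (induction c arbitrary: r)
    case (Suc c)
    have rc: "1 \<le> r" "r < n" "c < n - 1" "c < n" using Suc.prems by auto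
    show ?case
    proof
      fix x
      have "dx_commutator n ?B P x $$ (r, c) = 0"
        unfolding P using lax_coeff_zero(1)[where u = u, OF n A laxA u(2) rc(1-3)] .
      moreover have "dx_commutator n ?B P x $$ (r, c)
          = deriv (\<lambda>y. P y $$ (r, c)) x + ((?B x * P x) $$ (r, c) - (P x * ?B x) $$ (r, c))"
        using rc smooth_mat_carrier[OF sP, of x] uc[of x]
        by (simp add: dx_commutator_def commutator_def mat_deriv_def del: index_mult_mat(1))
      ultimately have "P x $$ (r, Suc c) = deriv (\<lambda>y. P y $$ (r, c)) x + (\<Sum>q<n. ?B x $$ (r, q) * P x $$ (q, c))"
        using mult_b_plus_V_space(1)[OF smooth_mat_carrier[OF sP] u(2) rc(2,3), of x]
          Bmult[OF smooth_mat_carrier[OF sP, of x] rc(2,4), of x] by simp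
      also have "(\<Sum>q<n. ?B x $$ (r, q) * P x $$ (q, c)) = (\<Sum>q<n. ?B x $$ (r, q) * z c q x)"
      proof (intro sum.cong refl)
        fix q assume "q \<in> {..<n}"
        then have q: "q < n" by simp
        show "?B x $$ (r, q) * P x $$ (q, c) = ?B x $$ (r, q) * z c q x"
        proof (cases "c \<le> q")
          case True
          then show ?thesis using Suc.IH q by simp
        next
          case False
          \<comment> \<open>Here q < c < r, so q differs from r - 1 and from the last column, and
            neither b nor u has an entry.\<close>
          then have "?B x $$ (r, q) = 0"
            using V_space_entry[OF u(2), of r q x] rc q Suc.prems uc[of x] by (auto simp: b_mat_def)
          then show ?thesis by simp
        qed
      qed
      also have "deriv (\<lambda>y. P y $$ (r, c)) x = deriv (z c r) x"
        using Suc by simp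
      finally show "z (Suc c) r x = P x $$ (r, Suc c)"
        by (simp add: zSuc)
    qed
  qed (simp add: z0)
  define \<zeta> where "\<zeta> = (\<lambda>x. P x - Z x)"
  have PZ: "P x - \<zeta> x = Z x" for x
    using smooth_mat_carrier[OF sP, of x] Zc[of x] by (intro eq_matI) (auto simp: \<zeta>_def)
  have "is_zeta n j u \<zeta>"
    unfolding is_zeta_def
  proof (intro conjI allI impI)
    show "smooth_mat n \<zeta>"
      unfolding \<zeta>_def by (intro smooth_mat_diff sP sZ)
    show "\<zeta> x $$ (r, c) = 0" if "r < n" "c \<le> r" for x r c
      using that lower[OF that(2,1)] Zc[of x] smooth_mat_carrier[OF sP, of x] Zi[of r c x]
      by (simp add: \<zeta>_def)
    fix x
    let ?W = "dx_commutator n ?B Z x"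
    have Wc: "?W \<in> carrier_mat n n"
      using Zc[of x] uc[of x] by (simp add: dx_commutator_def)
    have W: "?W $$ (r, c) = deriv (z c r) x + ((?B x * Z x) $$ (r, c) - (Z x * ?B x) $$ (r, c))"
      if "r < n" "c < n" for r c
      using that Zc[of x] uc[of x]
      by (simp add: dx_commutator_def commutator_def mat_deriv_def Zi del: index_mult_mat(1))
    have W0: "?W $$ (r, c) = 0" if rc: "r < n" "c < n - 1" for r c
    proof -
      have "(Z x * ?B x) $$ (r, c) = z (Suc c) r x"
        using mult_b_plus_V_space(1)[OF Zc u(2) rc, of x] rc by (simp add: Zi)
      moreover have "(?B x * Z x) $$ (r, c) = (\<Sum>q<n. ?B x $$ (r, q) * z c q x)"
        using Bmult[OF Zc rc(1), of c x x] rc by (simp add: Zi)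
      ultimately show ?thesis
        using W[of r c] rc by (simp add: zSuc)
    qed
    \<comment> \<open>The recursion says nothing about the last column, yet V_n has no e_nn. All
      other diagonal entries of W vanish, so the corner equals the trace of W, which is the
      derivative of the trace of Z. The diagonals of Z and P agree, and P has constant
      trace.\<close>
    have "?W $$ (n - 1, n - 1) = (\<Sum>r<n. ?W $$ (r, r))"
      using W0 n0 by (cases n) (auto simp: sum.neutral)
    also have "\<dots> = (\<Sum>r<n. deriv (z r r) x)
        + ((\<Sum>r<n. (?B x * Z x) $$ (r, r)) - (\<Sum>r<n. (Z x * ?B x) $$ (r, r)))"
      by (simp add: W sum.distrib sum_subtractf)
    also have "\<dots> = (\<Sum>r<n. mat_deriv n P x $$ (r, r))"
      using mat_trace_comm[of "?B x" n "Z x"] uc[of x] Zc[of x] lower by (simp add: mat_deriv_def)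
    also have "\<dots> = 0"
      unfolding P by (rule lax_coeff_zero(2)[where u = u, OF n A laxA u(2)])
    finally have "?W $$ (n - 1, n - 1) = 0" .
    then have "?W \<in> V_space n"
      using W0 by (intro V_spaceI Wc) (metis Suc_diff_1 less_Suc_eq n0)
    then show "dx_commutator n ?B (\<lambda>y. Y_coeff n j 0 u y - \<zeta> y) x \<in> V_space n"
      unfolding P_def[symmetric] PZ .
  qed
  \<comment> \<open>A competitor gives the same first column and obeys the same column
    recursion.\<close>
  moreover have "\<zeta>' = \<zeta>" if "is_zeta n j u \<zeta>'" for \<zeta>'
  proof
    fix x
    have s': "smooth_mat n \<zeta>'"
      using that by (simp add: is_zeta_def)
    let ?Z = "\<lambda>x. P x - \<zeta>' x"
    have c: "?Z x \<in> carrier_mat n n" for x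
      by (intro minus_carrier_mat smooth_mat_carrier[OF s'])
    have V: "dx_commutator n ?B ?Z x \<in> V_space n" for x
      using that by (simp add: is_zeta_def P_def)
    have eq: "(\<lambda>x. ?Z x $$ (r, k)) = z k r" if "k < n" "r < n" for k r
      using that
    proof (induction k arbitrary: r)
      case 0
      then show ?case
        using \<open>is_zeta n j u \<zeta>'\<close> carrier_matD[OF smooth_mat_carrier[OF s']]
        by (auto simp: z0 is_zeta_def fun_eq_iff)
    next
      case (Suc k)
      then have k: "k < n - 1" "k < n" by auto
      show ?case
      proof
        fix x
        have "?Z x $$ (r, Suc k) = deriv (\<lambda>y. ?Z y $$ (r, k)) x + (?B x * ?Z x) $$ (r, k)"
          by (rule dx_commutator_V_space_column[OF c u(2) V Suc.prems(2) k(1)])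
        also have "(?B x * ?Z x) $$ (r, k) = (\<Sum>q<n. ?B x $$ (r, q) * z k q x)"
          unfolding Bmult[OF c Suc.prems(2) k(2)]
          using fun_cong[OF Suc.IH[OF k(2)], of _ x] by (intro sum.cong) auto
        finally show "?Z x $$ (r, Suc k) = z (Suc k) r x"
          using Suc.IH[OF k(2) Suc.prems(2)] by (simp add: zSuc)
      qed
    qed
    show "\<zeta>' x = \<zeta> x"
    proof (rule eq_matI)
      fix r k assume "r < dim_row (\<zeta> x)" "k < dim_col (\<zeta> x)"
      then have rk: "r < n" "k < n"
        using Zc[of x] by (auto simp: \<zeta>_def)
      then show "\<zeta>' x $$ (r, k) = \<zeta> x $$ (r, k)"
        using fun_cong[OF eq[OF rk(2,1)], of x] Zc[of x] smooth_mat_carrier[OF s', of x]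
        by (simp add: \<zeta>_def Zi)
    qed (use Zc[of x] smooth_mat_carrier[OF s', of x] in \<open>auto simp: \<zeta>_def\<close>)
  qed
  ultimately show "\<exists>!\<zeta>. is_zeta n j u \<zeta>"
    by (rule ex1I)
qed

lemma Z_mat_properties:
  assumes n: "n \<ge> 2" and u: "smooth_mat n u" "\<And>x. u x \<in> V_space n"
  shows "smooth_mat n (Z_mat n j u)"
    and "dx_commutator n (\<lambda>y. b_mat n + u y) (Z_mat n j u) x \<in> V_space n"
proof -
  have z: "is_zeta n j u (zeta n j u)"
    unfolding zeta_def by (rule theI'[OF zeta_exists_unique(2)[OF n u]])
  have Z: "Z_mat n j u = (\<lambda>x. Y_coeff n j 0 u x - zeta n j u x)"
    by (simp add: Z_mat_def fun_eq_iff)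
  show "smooth_mat n (Z_mat n j u)"
    unfolding Z using z by (intro smooth_mat_diff zeta_exists_unique(1)[OF n u]) (simp add: is_zeta_def)
  show "dx_commutator n (\<lambda>y. b_mat n + u y) (Z_mat n j u) x \<in> V_space n"
    unfolding Z using z by (simp add: is_zeta_def)
qed

section \<open>Determinants and moving frames\<close>

lemma smooth_det:
  assumes "smooth_mat n A"
  shows "smooth (\<lambda>x. det (A x))"
  unfolding det_def'[OF smooth_mat_carrier[OF assms]]
  by (intro smooth_sum smooth_mult smooth_const smooth_prod smooth_mat_entry[OF assms])
    (auto simp: permutes_in_image dest: permutes_in_image[of _ "{0..<n}"])

text \<open>For determinant 1 the adjugate is the inverse; being polynomial in the entries, it is
  smooth without any division.\<close>

lemma smooth_mat_adj:
  assumes A: "smooth_mat n A"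
  shows "smooth_mat n (\<lambda>x. adj_mat (A x))"
  unfolding smooth_mat_def
proof (intro conjI allI impI)
  note dims = carrier_matD[OF smooth_mat_carrier[OF A]]
  show "adj_mat (A x) \<in> carrier_mat n n" for x
    by (rule adj_mat(1)[OF smooth_mat_carrier[OF A]])
  fix i k assume ik: "i < n" "k < n"
  have "smooth_mat (n - 1) (\<lambda>x. mat_delete (A x) k i)"
    unfolding smooth_mat_def
  proof (intro conjI allI impI)
    show "mat_delete (A x) k i \<in> carrier_mat (n - 1) (n - 1)" for x
      by (rule mat_delete_carrier[OF smooth_mat_carrier[OF A]])
    show "smooth (\<lambda>x. mat_delete (A x) k i $$ (p, q))" if "p < n - 1" "q < n - 1" for p q
      using that by (auto simp: mat_delete_def dims intro!: smooth_mat_entry[OF A])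
  qed
  then show "smooth (\<lambda>x. adj_mat (A x) $$ (i, k))"
    using ik by (simp add: adj_mat_def dims cofactor_def smooth_mult smooth_det)
qed

lemma adj_mat_inverse:
  assumes "A \<in> carrier_mat n n" "det A = 1"
  shows "A * adj_mat A = 1\<^sub>m n" "adj_mat A * A = 1\<^sub>m n" "adj_mat A \<in> carrier_mat n n"
  using adj_mat[OF assms(1)] assms(2) by (auto intro!: eq_matI)

lemma mat_deriv_mult:
  assumes A: "smooth_mat n A" and B: "smooth_mat n B"
  shows "mat_deriv n (\<lambda>y. A y * B y) x = mat_deriv n A x * B x + A x * mat_deriv n B x"
proof (rule eq_matI)
  note dims = carrier_matD[OF smooth_mat_carrier[OF A]] carrier_matD[OF smooth_mat_carrier[OF B]]
  fix i k assume "i < dim_row (mat_deriv n A x * B x + A x * mat_deriv n B x)"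
    "k < dim_col (mat_deriv n A x * B x + A x * mat_deriv n B x)"
  then have ik: "i < n" "k < n"
    using dims carrier_matD[OF mat_deriv_carrier[of n B x]] by auto
  let ?a = "\<lambda>q y. A y $$ (i, q)" and ?b = "\<lambda>q y. B y $$ (q, k)"
  have "((\<lambda>y. \<Sum>q<n. ?a q y * ?b q y) has_real_derivative
      (\<Sum>q<n. ?a q x * deriv (?b q) x + deriv (?a q) x * ?b q x)) (at x)"
    using ik by (intro DERIV_sum DERIV_mult' smooth_deriv_real smooth_mat_entry[OF A] smooth_mat_entry[OF B]) auto
  moreover have "(A y * B y) $$ (i, k) = (\<Sum>q<n. ?a q y * ?b q y)" for y
    using ik dims by (simp add: scalar_prod_def lessThan_atLeast0)
  ultimately have "mat_deriv n (\<lambda>y. A y * B y) x $$ (i, k)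
      = (\<Sum>q<n. ?a q x * deriv (?b q) x + deriv (?a q) x * ?b q x)"
    using ik by (simp add: mat_deriv_def DERIV_imp_deriv)
  also have "\<dots> = (mat_deriv n A x * B x + A x * mat_deriv n B x) $$ (i, k)"
    using ik dims by (simp add: scalar_prod_def lessThan_atLeast0 mat_deriv_def sum.distrib)
  finally show "mat_deriv n (\<lambda>y. A y * B y) x $$ (i, k)
      = (mat_deriv n A x * B x + A x * mat_deriv n B x) $$ (i, k)" .
qed (use carrier_matD[OF smooth_mat_carrier[OF A]] carrier_matD[OF smooth_mat_carrier[OF B]] in
    \<open>auto simp: mat_deriv_def\<close>)

text \<open>The product rule in the Leibniz formula differentiates one factor at a time; collecting
  by column gives determinants with one column differentiated.\<close>

lemma deriv_det:
  assumes A: "smooth_mat n A"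
  shows "deriv (\<lambda>y. det (A y)) x = (\<Sum>k<n. det (replace_col (A x) (col (mat_deriv n A x) k) k))"
proof -
  note Ac = smooth_mat_carrier[OF A] and dims = carrier_matD[OF smooth_mat_carrier[OF A]]
  let ?S = "{p. p permutes {0..<n}}"
  let ?R = "\<lambda>k. replace_col (A x) (col (mat_deriv n A x) k) k"
  have p: "p j < n" if "p \<in> ?S" "j < n" for p j
    using that permutes_in_image[of p "{0..<n}" j] by auto
  have Rc: "?R k \<in> carrier_mat n n" for k
    using dims by (simp add: replace_col_def)
  have "((\<lambda>y. \<Sum>p\<in>?S. signof p * (\<Prod>j<n. A y $$ (p j, j))) has_real_derivative
      (\<Sum>p\<in>?S. signof p * (\<Sum>k<n. deriv (\<lambda>y. A y $$ (p k, k)) x * (\<Prod>j\<in>{..<n}-{k}. A x $$ (p j, j))))) (at x)"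
    using p by (intro DERIV_sum DERIV_cmult has_field_derivative_prod smooth_deriv_real smooth_mat_entry[OF A]) auto
  then have "deriv (\<lambda>y. det (A y)) x =
      (\<Sum>p\<in>?S. signof p * (\<Sum>k<n. deriv (\<lambda>y. A y $$ (p k, k)) x * (\<Prod>j\<in>{..<n}-{k}. A x $$ (p j, j))))"
    unfolding det_col[OF Ac] by (rule DERIV_imp_deriv)
  also have "\<dots> = (\<Sum>k<n. \<Sum>p\<in>?S. signof p *
      (deriv (\<lambda>y. A y $$ (p k, k)) x * (\<Prod>j\<in>{..<n}-{k}. A x $$ (p j, j))))"
    unfolding sum_distrib_left by (rule sum.swap)
  also have "\<dots> = (\<Sum>k<n. det (?R k))"
  proof (rule sum.cong[OF refl])
    fix k assume "k \<in> {..<n}"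
    then have k: "k < n" by simp
    have "(\<Prod>j<n. ?R k $$ (p j, j))
        = deriv (\<lambda>y. A y $$ (p k, k)) x * (\<Prod>j\<in>{..<n}-{k}. A x $$ (p j, j))" if "p \<in> ?S" for p
    proof -
      have "(\<Prod>j<n. ?R k $$ (p j, j)) = ?R k $$ (p k, k) * (\<Prod>j\<in>{..<n}-{k}. ?R k $$ (p j, j))"
        using k by (intro prod.remove) auto
      also have "?R k $$ (p k, k) = deriv (\<lambda>y. A y $$ (p k, k)) x"
        using k p[OF that k] dims by (simp add: replace_col_def mat_deriv_def)
      also have "(\<Prod>j\<in>{..<n}-{k}. ?R k $$ (p j, j)) = (\<Prod>j\<in>{..<n}-{k}. A x $$ (p j, j))"
        using p[OF that] dims by (intro prod.cong) (auto simp: replace_col_def)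
      finally show ?thesis .
    qed
    then show "(\<Sum>p\<in>?S. signof p * (deriv (\<lambda>y. A y $$ (p k, k)) x * (\<Prod>j\<in>{..<n}-{k}. A x $$ (p j, j))))
        = det (?R k)"
      unfolding det_col[OF Rc] by (intro sum.cong) auto
  qed
  finally show ?thesis .
qed

text \<open>Since (g^-1)_t = - M g^-1, the product h g^-1 has zero derivative, and it is the
  identity at \<open>a\<close>. An invertible solution at hand replaces any appeal to general
  uniqueness theory.\<close>

lemma linear_ode_unique:
  assumes h: "smooth_mat n h" and g: "smooth_mat n g" and det: "\<And>t. det (g t) = 1"
    and M: "\<And>t. M t \<in> carrier_mat n n"
    and h': "\<And>t. mat_deriv n h t = h t * M t" and g': "\<And>t. mat_deriv n g t = g t * M t"
    and init: "h a = g a"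
  shows "h t = g t"
proof -
  let ?q = "\<lambda>t. adj_mat (g t)"
  note hc = smooth_mat_carrier[OF h] and gc = smooth_mat_carrier[OF g]
  note q = smooth_mat_adj[OF g] and qinv = adj_mat_inverse[OF gc det]
  note assoc = assoc_mult_mat[of _ n n _ n _ n]
  have q': "mat_deriv n ?q t = - (M t * ?q t)" for t
  proof -
    have "mat_deriv n (\<lambda>t. g t * ?q t) t = 0\<^sub>m n n"
      unfolding qinv(1) by (intro eq_matI) (auto simp: mat_deriv_def)
    then have "g t * M t * ?q t + g t * mat_deriv n ?q t = 0\<^sub>m n n"
      by (simp add: mat_deriv_mult[OF g q] g')
    then have "?q t * (g t * M t * ?q t + g t * mat_deriv n ?q t) = ?q t * 0\<^sub>m n n"
      by simp
    moreover have "?q t * (g t * M t * ?q t + g t * mat_deriv n ?q t)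
        = ?q t * g t * (M t * ?q t) + ?q t * g t * mat_deriv n ?q t"
      using gc[of t] qinv(3)[of t] M[of t] mult_add_distrib_mat[of "?q t" n n "g t * M t * ?q t" n "g t * mat_deriv n ?q t"]
      by (simp add: assoc mult_carrier_mat[of _ n n _ n])
    ultimately have "M t * ?q t + mat_deriv n ?q t = 0\<^sub>m n n"
      using qinv(3)[of t] M[of t]
      by (simp add: qinv(2) left_mult_one_mat[OF mult_carrier_mat[OF M qinv(3)]] left_mult_one_mat[OF mat_deriv_carrier]
          right_mult_zero_mat[OF qinv(3)])
    then show ?thesis
      using mat_add_eq_0_iff[of "mat_deriv n ?q t" n n "M t * ?q t"] comm_add_mat[of "M t * ?q t" n n "mat_deriv n ?q t"]
        mult_carrier_mat[OF M[of t] qinv(3)[of t]] by simp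
  qed
  have "mat_deriv n (\<lambda>t. h t * ?q t) t = 0\<^sub>m n n" for t
  proof -
    have "mat_deriv n (\<lambda>t. h t * ?q t) t = h t * M t * ?q t + h t * - (M t * ?q t)"
      by (simp add: mat_deriv_mult[OF h q] h' q')
    also have "h t * - (M t * ?q t) = - (h t * M t * ?q t)"
      using hc[of t] qinv(3)[of t] M[of t] by (simp add: assoc uminus_mult_right_mat)
    also have "h t * M t * ?q t + - (h t * M t * ?q t) = 0\<^sub>m n n"
      using hc[of t] qinv(3)[of t] M[of t] mat_add_eq_0_iff[of "h t * M t * ?q t" n n "- (h t * M t * ?q t)"]
      by (simp add: mult_carrier_mat[of _ n n _ n])
    finally show ?thesis .
  qed
  note deriv0 = this
  have "(h t * ?q t) $$ (i, k) = (h a * ?q a) $$ (i, k)" if ik: "i < n" "k < n" for i k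
  proof -
    have "deriv (\<lambda>t. (h t * ?q t) $$ (i, k)) s = 0" for s
      using arg_cong[OF deriv0[of s], of "\<lambda>A. A $$ (i, k)"] ik by (simp add: mat_deriv_def)
    then have "\<forall>s. ((\<lambda>t. (h t * ?q t) $$ (i, k)) has_real_derivative 0) (at s)"
      using smooth_deriv_real(1)[OF smooth_mat_entry[OF smooth_mat_mult[OF h q] ik]] by metis
    then show ?thesis
      by (rule DERIV_isconst_all)
  qed
  then have "h t * ?q t = h a * ?q a"
    using carrier_matD[OF hc] carrier_matD[OF qinv(3)]
    by (intro eq_matI) (auto simp del: index_mult_mat(1))
  also have "\<dots> = 1\<^sub>m n"
    by (simp add: init qinv(1))
  finally have "h t * ?q t * g t = g t"
    by (simp add: left_mult_one_mat[OF gc])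
  moreover have "h t * ?q t * g t = h t"
    using hc[of t] gc[of t] qinv(3)[of t] by (simp add: assoc qinv(2))
  ultimately show ?thesis by simp
qed

subsection \<open>Central affine curves\<close>

lemma smooth_vec_carrier: "smooth_vec n v \<Longrightarrow> v x \<in> carrier_vec n"
  and smooth_vec_entry: "smooth_vec n v \<Longrightarrow> i < n \<Longrightarrow> smooth (\<lambda>x. v x $ i)"
  by (simp_all add: smooth_vec_def)

lemma smooth_vec_deriv:
  assumes "smooth_vec n v"
  shows "smooth_vec n (vec_deriv n v)"
  unfolding smooth_vec_def
proof (intro conjI allI impI)
  fix i assume "i < n"
  then show "smooth (\<lambda>x. vec_deriv n v x $ i)"
    using smooth_deriv_real(2)[OF smooth_vec_entry[OF assms]] by (simp add: vec_deriv_def)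
qed (simp add: vec_deriv_def)

lemma smooth_vec_iter_deriv: "smooth_vec n v \<Longrightarrow> smooth_vec n ((vec_deriv n ^^ k) v)"
  by (induction k) (auto intro: smooth_vec_deriv)

lemma moving_frame_carrier [simp]: "moving_frame n \<gamma> x \<in> carrier_mat n n"
  by (simp add: moving_frame_def)

lemma smooth_moving_frame: "smooth_vec n \<gamma> \<Longrightarrow> smooth_mat n (moving_frame n \<gamma>)"
  using smooth_vec_entry[OF smooth_vec_iter_deriv]
  by (auto simp: smooth_mat_def moving_frame_def)

lemma mat_deriv_moving_frame:
  assumes "i < n" "k < n"
  shows "mat_deriv n (moving_frame n \<gamma>) x $$ (i, k) = (vec_deriv n ^^ Suc k) \<gamma> x $ i"
  using assms by (simp add: mat_deriv_def moving_frame_def vec_deriv_def)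

text \<open>The coordinates of the n-th derivative in the moving frame, for frames of determinant 1:
  the first n - 1 are the curvatures, the last is shown to vanish. Unlike the description in
  \<open>curvature\<close>, this formula makes smoothness visible.\<close>

definition frame_coords :: "nat \<Rightarrow> (real \<Rightarrow> real vec) \<Rightarrow> real \<Rightarrow> real vec" where
  "frame_coords n \<gamma> x = adj_mat (moving_frame n \<gamma> x) *\<^sub>v (vec_deriv n ^^ n) \<gamma> x"

lemma central_affine_curvesD:
  assumes "\<gamma> \<in> central_affine_curves n"
  shows "smooth_vec n \<gamma>" "det (moving_frame n \<gamma> x) = 1"
  using assms by (simp_all add: central_affine_curves_def)

lemma moving_frame_mult_coords:
  assumes "\<gamma> \<in> central_affine_curves n"
  shows "frame_coords n \<gamma> x \<in> carrier_vec n"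
    and "moving_frame n \<gamma> x *\<^sub>v frame_coords n \<gamma> x = (vec_deriv n ^^ n) \<gamma> x"
proof -
  note inv = adj_mat_inverse[OF moving_frame_carrier central_affine_curvesD(2)[OF assms], of x]
  have c: "(vec_deriv n ^^ n) \<gamma> x \<in> carrier_vec n"
    using smooth_vec_carrier[OF smooth_vec_iter_deriv[OF central_affine_curvesD(1)[OF assms]]] .
  show "frame_coords n \<gamma> x \<in> carrier_vec n"
    unfolding frame_coords_def using inv(3) c by (rule mult_mat_vec_carrier)
  show "moving_frame n \<gamma> x *\<^sub>v frame_coords n \<gamma> x = (vec_deriv n ^^ n) \<gamma> x"
    unfolding frame_coords_def assoc_mult_mat_vec[OF moving_frame_carrier inv(3) c, symmetric] inv(1)
    using c by simp
qed

text \<open>Differentiating \<open>det g = 1\<close> column by column, every summand but the last has two equal columns.\<close>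

lemma frame_coords_last:
  assumes n: "n \<ge> 2" and \<gamma>: "\<gamma> \<in> central_affine_curves n"
  shows "frame_coords n \<gamma> x $ (n - 1) = 0"
proof -
  let ?g = "moving_frame n \<gamma>"
  let ?R = "\<lambda>k. replace_col (?g x) (col (mat_deriv n ?g x) k) k"
  note D = central_affine_curvesD[OF \<gamma>]
  have Rc: "?R k \<in> carrier_mat n n" for k
    by (simp add: replace_col_def carrier_matD[OF moving_frame_carrier])
  have zero: "det (?R k) = 0" if k: "k < n - 1" for k
  proof (rule det_identical_columns[OF Rc, of k "Suc k"])
    show "col (?R k) k = col (?R k) (Suc k)"
      using k carrier_matD[OF Rc[of k]] carrier_matD[OF moving_frame_carrier[of n \<gamma> x]]
      by (intro eq_vecI) (auto simp: replace_col_def mat_deriv_moving_frame carrier_matD[OF mat_deriv_carrier],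
          auto simp: moving_frame_def)
  qed (use k in auto)
  have "(\<Sum>k<n. det (?R k)) = 0"
    using deriv_det[OF smooth_moving_frame[OF D(1)], of x] D(2) by simp
  then have "det (?R (n - 1)) = 0"
    using zero n by (cases n) auto
  \<comment> \<open>The only surviving determinant has g times the coordinate vector as its last
    column; by Cramer's rule it is the last coordinate times det g.\<close>
  moreover have "col (mat_deriv n ?g x) (n - 1) = ?g x *\<^sub>v frame_coords n \<gamma> x"
    unfolding moving_frame_mult_coords(2)[OF \<gamma>]
    using n smooth_vec_carrier[OF smooth_vec_iter_deriv[OF D(1)], of n x]
    by (intro eq_vecI) (auto simp: mat_deriv_moving_frame carrier_matD[OF mat_deriv_carrier] simp del: funpow.simps)
  ultimately show ?thesis
    using cramer_lemma_mat[OF moving_frame_carrier moving_frame_mult_coords(1)[OF \<gamma>, of x], of "n - 1" \<gamma> x]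
      D(2) n
    by simp
qed

lemma curvature_eqI:
  assumes n: "n \<ge> 2" and \<gamma>: "\<gamma> \<in> central_affine_curves n" and U: "U \<in> V_space n"
    and eq: "\<And>i. i < n \<Longrightarrow> (vec_deriv n ^^ n) \<gamma> x $ i
      = (\<Sum>k<n-1. U $$ (k, n - 1) * (vec_deriv n ^^ k) \<gamma> x $ i)"
  shows "U = mat n n (\<lambda>(r, c). if c = n - 1 \<and> r < n - 1 then frame_coords n \<gamma> x $ r else 0)"
    and "curvature n \<gamma> x = U"
proof -
  let ?F = "mat n n (\<lambda>(r, c). if c = n - 1 \<and> r < n - 1 then frame_coords n \<gamma> x $ r else 0)"
  note inv = adj_mat_inverse[OF moving_frame_carrier central_affine_curvesD(2)[OF \<gamma>], of x]
  have *: "U = ?F" if U: "U \<in> V_space n"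
    and eq: "\<And>i. i < n \<Longrightarrow> (vec_deriv n ^^ n) \<gamma> x $ i
      = (\<Sum>k<n-1. U $$ (k, n - 1) * (vec_deriv n ^^ k) \<gamma> x $ i)" for U
  proof -
    define c where "c = vec n (\<lambda>k. U $$ (k, n - 1))"
    have cc: "c \<in> carrier_vec n" by (simp add: c_def)
    have "U $$ (n - 1, n - 1) = 0"
      using V_space_entry[OF U, of "n - 1" "n - 1"] n by auto
    then have "(moving_frame n \<gamma> x *\<^sub>v c) $ i = (\<Sum>k<n-1. U $$ (k, n - 1) * (vec_deriv n ^^ k) \<gamma> x $ i)"
      if "i < n" for i
      using that n
      by (cases n) (auto simp: c_def moving_frame_def scalar_prod_def lessThan_atLeast0[symmetric] mult.commute)
    then have "moving_frame n \<gamma> x *\<^sub>v c = (vec_deriv n ^^ n) \<gamma> x"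
      using eq smooth_vec_carrier[OF smooth_vec_iter_deriv[OF central_affine_curvesD(1)[OF \<gamma>]], of n x]
      by (intro eq_vecI) (auto simp: carrier_matD[OF moving_frame_carrier] simp del: index_mult_mat_vec)
    then have "frame_coords n \<gamma> x = adj_mat (moving_frame n \<gamma> x) *\<^sub>v (moving_frame n \<gamma> x *\<^sub>v c)"
      by (simp add: frame_coords_def)
    also have "\<dots> = c"
      using assoc_mult_mat_vec[OF inv(3) moving_frame_carrier cc, symmetric] inv(2) cc by simp
    finally have c: "frame_coords n \<gamma> x = c" .
    obtain v where v: "U = mat n n (\<lambda>(r, c). if c = n - 1 \<and> r < n - 1 then v r else 0)"
      using U by (auto simp: V_space_def)
    have "(if k = n - 1 \<and> r < n - 1 then v r else 0) = (if k = n - 1 \<and> r < n - 1 then c $ r else 0)"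
      if "r < n" "k < n" for r k
      using that by (auto simp: c_def v)
    then show ?thesis
      unfolding c by (subst v) (intro eq_matI, auto)
  qed
  show "U = ?F"
    using *[OF U eq] .
  show "curvature n \<gamma> x = U"
    unfolding curvature_def
  proof (rule the_equality)
    show "U \<in> V_space n \<and> (\<forall>i<n. (vec_deriv n ^^ n) \<gamma> x $ i
        = (\<Sum>k<n-1. U $$ (k, n - 1) * (vec_deriv n ^^ k) \<gamma> x $ i))"
      using U eq by blast
    show "U' = U" if "U' \<in> V_space n \<and> (\<forall>i<n. (vec_deriv n ^^ n) \<gamma> x $ i
        = (\<Sum>k<n-1. U' $$ (k, n - 1) * (vec_deriv n ^^ k) \<gamma> x $ i))" for U'
      using *[of U'] *[OF U eq] that by simp
  qed
qed

lemma curvature_properties: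
  assumes n: "n \<ge> 2" and \<gamma>: "\<gamma> \<in> central_affine_curves n"
  shows "curvature n \<gamma> x = mat n n (\<lambda>(r, c). if c = n - 1 \<and> r < n - 1 then frame_coords n \<gamma> x $ r else 0)"
    and "curvature n \<gamma> x \<in> V_space n"
    and "mat_deriv n (moving_frame n \<gamma>) x = moving_frame n \<gamma> x * (b_mat n + curvature n \<gamma> x)"
proof -
  define U where "U = mat n n (\<lambda>(r, c). if c = n - 1 \<and> r < n - 1 then frame_coords n \<gamma> x $ r else 0)"
  have U: "U \<in> V_space n"
    unfolding U_def V_space_def by blast
  have eq: "(vec_deriv n ^^ n) \<gamma> x $ i = (\<Sum>k<n-1. U $$ (k, n - 1) * (vec_deriv n ^^ k) \<gamma> x $ i)"
    if i: "i < n" for i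
  proof -
    have "(vec_deriv n ^^ n) \<gamma> x $ i = (moving_frame n \<gamma> x *\<^sub>v frame_coords n \<gamma> x) $ i"
      by (simp add: moving_frame_mult_coords(2)[OF \<gamma>])
    also have "\<dots> = (\<Sum>k<n. (vec_deriv n ^^ k) \<gamma> x $ i * frame_coords n \<gamma> x $ k)"
      using i carrier_vecD[OF moving_frame_mult_coords(1)[OF \<gamma>, of x]]
      by (simp add: scalar_prod_def moving_frame_def lessThan_atLeast0)
    also have "\<dots> = (\<Sum>k<n-1. (vec_deriv n ^^ k) \<gamma> x $ i * frame_coords n \<gamma> x $ k)"
      using frame_coords_last[OF n \<gamma>, of x] n by (cases n) auto
    also have "\<dots> = (\<Sum>k<n-1. U $$ (k, n - 1) * (vec_deriv n ^^ k) \<gamma> x $ i)"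
      by (intro sum.cong) (auto simp: U_def mult.commute)
    finally show ?thesis .
  qed
  have curv: "curvature n \<gamma> x = U"
    by (rule curvature_eqI(2)[OF n \<gamma> U eq])
  then show "curvature n \<gamma> x = mat n n (\<lambda>(r, c). if c = n - 1 \<and> r < n - 1 then frame_coords n \<gamma> x $ r else 0)"
    "curvature n \<gamma> x \<in> V_space n"
    using U by (simp_all add: U_def)
  show "mat_deriv n (moving_frame n \<gamma>) x = moving_frame n \<gamma> x * (b_mat n + curvature n \<gamma> x)"
    unfolding curv
  proof (rule eq_matI)
    fix i k assume "i < dim_row (moving_frame n \<gamma> x * (b_mat n + U))" "k < dim_col (moving_frame n \<gamma> x * (b_mat n + U))"
    then have ik: "i < n" "k < n"
      using carrier_matD[OF V_space_carrier[OF U]] carrier_matD[OF moving_frame_carrier[of n \<gamma> x]] by auto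
    show "mat_deriv n (moving_frame n \<gamma>) x $$ (i, k) = (moving_frame n \<gamma> x * (b_mat n + U)) $$ (i, k)"
    proof (cases "k < n - 1")
      case True
      then show ?thesis
        using mult_b_plus_V_space(1)[OF moving_frame_carrier U ik(1) True] ik
        unfolding mat_deriv_moving_frame[OF ik] by (simp add: moving_frame_def)
    next
      case False
      then have "k = n - 1" "Suc k = n" using ik by auto
      then show ?thesis
        using mult_b_plus_V_space(2)[OF moving_frame_carrier U ik(1), of \<gamma> x] eq[OF ik(1)] ik
        unfolding mat_deriv_moving_frame[OF ik]
        by (simp add: moving_frame_def mult.commute del: funpow.simps)
    qed
  qed (use carrier_matD[OF V_space_carrier[OF U]] carrier_matD[OF moving_frame_carrier[of n \<gamma> x]] in
      \<open>auto simp: mat_deriv_def\<close>)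
qed

lemma curve_of_frame:
  assumes n: "n \<ge> 2" and g: "smooth_mat n g" "\<And>x. det (g x) = 1"
    and u: "\<And>x. u x \<in> V_space n" and g': "\<And>x. mat_deriv n g x = g x * (b_mat n + u x)"
    and \<gamma>: "\<And>x. \<gamma> x = g x *\<^sub>v unit_vec n 0"
  shows "\<gamma> \<in> central_affine_curves n" and "moving_frame n \<gamma> = g" and "curvature n \<gamma> = u"
proof -
  note dims = carrier_matD[OF smooth_mat_carrier[OF g(1)]]
  have \<gamma>i: "\<gamma> x = col (g x) 0" for x
    unfolding \<gamma> using n dims by (intro eq_vecI) (auto simp: scalar_prod_right_unit)
  have iter: "(vec_deriv n ^^ k) \<gamma> = (\<lambda>x. col (g x) k)" if "k < n" for k
    using that
  proof (induction k)
    case (Suc k)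
    then have k: "k < n" "k < n - 1" by auto
    show ?case
    proof
      fix x
      have "(vec_deriv n ^^ Suc k) \<gamma> x = vec_deriv n (\<lambda>x. col (g x) k) x"
        using Suc.IH[OF k(1)] by simp
      also have "\<dots> = col (g x) (Suc k)"
      proof (rule eq_vecI)
        fix i assume "i < dim_vec (col (g x) (Suc k))"
        then have i: "i < n" using dims by simp
        have "vec_deriv n (\<lambda>x. col (g x) k) x $ i = mat_deriv n g x $$ (i, k)"
          using i k dims by (simp add: vec_deriv_def mat_deriv_def)
        also have "\<dots> = col (g x) (Suc k) $ i"
          using mult_b_plus_V_space(1)[OF smooth_mat_carrier[OF g(1)] u i k(2), of x] g'[of x] i k dims Suc.prems
          by simp
        finally show "vec_deriv n (\<lambda>x. col (g x) k) x $ i = col (g x) (Suc k) $ i" .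
      qed (simp add: vec_deriv_def dims)
      finally show "(vec_deriv n ^^ Suc k) \<gamma> x = col (g x) (Suc k)" .
    qed
  qed (simp add: \<gamma>i fun_eq_iff)
  show frame: "moving_frame n \<gamma> = g"
    using iter dims by (intro ext eq_matI) (auto simp: moving_frame_def)
  have sm: "smooth_vec n \<gamma>"
    unfolding smooth_vec_def \<gamma>i
  proof (intro conjI allI impI)
    show "col (g x) 0 \<in> carrier_vec n" for x
      using col_dim[of "g x" 0] dims(1)[of x] by (simp only:)
    show "smooth (\<lambda>x. col (g x) 0 $ i)" if "i < n" for i
      using smooth_mat_entry[OF g(1) that, of 0] that n by (simp add: dims)
  qed
  have "\<gamma> x \<noteq> 0\<^sub>v n" for x
  proof
    assume "\<gamma> x = 0\<^sub>v n"
    then have "col (g x) 0 $ i = 0" if "i < n" for i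
      using that \<gamma>i[of x] by simp
    then have "g x $$ (i, 0) = 0" if "i < n" for i
      using that n dims[of x] by simp
    then have "det (g x) = 0"
      using laplace_expansion_column[OF smooth_mat_carrier[OF g(1)], of 0 x] n by simp
    then show False using g(2) by simp
  qed
  then show \<gamma>c: "\<gamma> \<in> central_affine_curves n"
    using sm g(2) frame by (simp add: central_affine_curves_def)
  show "curvature n \<gamma> = u"
  proof
    fix x
    show "curvature n \<gamma> x = u x"
    proof (rule curvature_eqI(2)[OF n \<gamma>c u])
      fix i assume i: "i < n"
      have "(vec_deriv n ^^ n) \<gamma> x $ i = mat_deriv n (moving_frame n \<gamma>) x $$ (i, n - 1)"
        using mat_deriv_moving_frame[OF i, of "n - 1" \<gamma> x] n by (simp del: funpow.simps)
      also have "\<dots> = (\<Sum>k<n-1. g x $$ (i, k) * u x $$ (k, n - 1))"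
        using mult_b_plus_V_space(2)[OF smooth_mat_carrier[OF g(1)] u i, of x] n
        by (simp add: frame g')
      also have "\<dots> = (\<Sum>k<n-1. u x $$ (k, n - 1) * (vec_deriv n ^^ k) \<gamma> x $ i)"
        using i dims by (intro sum.cong) (auto simp: iter)
      finally show "(vec_deriv n ^^ n) \<gamma> x $ i = (\<Sum>k<n-1. u x $$ (k, n - 1) * (vec_deriv n ^^ k) \<gamma> x $ i)" .
    qed
  qed
qed

section \<open>The curve flow\<close>

lemma smooth_mat_slices:
  assumes "smooth_mat n (\<lambda>(x :: real, t :: real). A x t)"
  shows "smooth_mat n (\<lambda>x. A x t)" and "smooth_mat n (\<lambda>t. A x t)"
proof -
  have "smooth (\<lambda>(x, t). A x t $$ (i, k))" if "i < n" "k < n" for i k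
    using smooth_mat_entry[OF assms that] by (simp add: case_prod_unfold)
  then have "smooth (\<lambda>x. A x t $$ (i, k))" "smooth (\<lambda>t. A x t $$ (i, k))" if "i < n" "k < n" for i k x t
    using smooth_slices[of "\<lambda>x t. A x t $$ (i, k)"] that by auto
  moreover have "A x t \<in> carrier_mat n n" for x t
    using smooth_mat_carrier[OF assms, of "(x, t)"] by simp
  ultimately show "smooth_mat n (\<lambda>x. A x t)" "smooth_mat n (\<lambda>t. A x t)"
    by (simp_all add: smooth_mat_def)
qed

lemma smooth_iter_vec_deriv_joint:
  assumes \<beta>: "smooth_vec n (\<lambda>(x :: real, t :: real). \<beta> x t)" and i: "i < n"
  shows "smooth (\<lambda>(x, t). (vec_deriv n ^^ k) (\<lambda>y. \<beta> y t) x $ i)"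
proof (induction k)
  case 0
  then show ?case
    using smooth_vec_entry[OF \<beta> i] by (simp add: case_prod_unfold)
next
  case (Suc k)
  have "(vec_deriv n ^^ Suc k) (\<lambda>y. \<beta> y t) x $ i
      = deriv (\<lambda>y. (vec_deriv n ^^ k) (\<lambda>y. \<beta> y t) y $ i) x" for x t
    using i by (simp add: vec_deriv_def)
  then show ?case
    using smooth_partial_derivs(1)[OF Suc] by simp
qed

lemma smooth_moving_frame_joint:
  assumes "smooth_vec n (\<lambda>(x :: real, t :: real). \<beta> x t)"
  shows "smooth_mat n (\<lambda>(x, t). moving_frame n (\<lambda>y. \<beta> y t) x)"
  using smooth_iter_vec_deriv_joint[OF assms]
  by (auto simp: smooth_mat_def moving_frame_def case_prod_unfold)

text \<open>Smoothness in (x, t) together comes from the adjugate formula, whose ingredients are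
  x-derivatives of a jointly smooth curve.\<close>

lemma smooth_curvature_joint:
  assumes n: "n \<ge> 2" and \<beta>: "smooth_vec n (\<lambda>(x :: real, t :: real). \<beta> x t)"
    and \<beta>c: "\<And>t. (\<lambda>x. \<beta> x t) \<in> central_affine_curves n"
  shows "smooth_mat n (\<lambda>(x, t). curvature n (\<lambda>y. \<beta> y t) x)"
proof -
  let ?A = "\<lambda>p. adj_mat (moving_frame n (\<lambda>y. \<beta> y (snd p)) (fst p))"
  let ?w = "\<lambda>p. (vec_deriv n ^^ n) (\<lambda>y. \<beta> y (snd p)) (fst p)"
  have A: "smooth_mat n ?A"
    using smooth_mat_adj[OF smooth_moving_frame_joint[OF \<beta>]] by (simp add: case_prod_unfold)
  have w: "smooth (\<lambda>p. ?w p $ i)" if "i < n" for i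
    using smooth_iter_vec_deriv_joint[OF \<beta> that, of n] by (simp add: case_prod_unfold)
  have wc: "dim_vec (?w p) = n" for p
    by (rule carrier_vecD[OF smooth_vec_carrier[OF smooth_vec_iter_deriv[OF central_affine_curvesD(1)[OF \<beta>c]]]])
  have "frame_coords n (\<lambda>y. \<beta> y (snd p)) (fst p) $ r = (\<Sum>q<n. ?A p $$ (r, q) * ?w p $ q)" if "r < n" for r p
    using that wc[of p] carrier_matD[OF smooth_mat_carrier[OF A, of p]]
    by (simp add: frame_coords_def scalar_prod_def lessThan_atLeast0)
  moreover have "smooth (\<lambda>p. \<Sum>q<n. ?A p $$ (r, q) * ?w p $ q)" if "r < n" for r
    using that by (intro smooth_sum smooth_mult smooth_mat_entry[OF A] w) auto
  ultimately have coords: "smooth (\<lambda>p. frame_coords n (\<lambda>y. \<beta> y (snd p)) (fst p) $ r)" if "r < n" for r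
    using that by simp
  show ?thesis
    unfolding smooth_mat_def
  proof (intro conjI allI impI)
    fix i k assume ik: "i < n" "k < n"
    show "smooth (\<lambda>x. (case x of (x, t) \<Rightarrow> curvature n (\<lambda>y. \<beta> y t) x) $$ (i, k))"
    proof -
      have "(case p of (x, t) \<Rightarrow> curvature n (\<lambda>y. \<beta> y t) x) $$ (i, k)
          = (if k = n - 1 \<and> i < n - 1 then frame_coords n (\<lambda>y. \<beta> y (snd p)) (fst p) $ i else 0)" for p
        using ik by (simp add: case_prod_unfold curvature_properties(1)[OF n \<beta>c])
      then show ?thesis
        using coords[OF ik(1)] by (cases "k = n - 1 \<and> i < n - 1") (simp_all only: if_True if_False simp_thms smooth_const)
    qed
  qed (use V_space_carrier[OF curvature_properties(2)[OF n \<beta>c]] in auto)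
qed

text \<open>Since \<open>g e\<^sub>k\<^sub>+\<^sub>1 = (g e\<^sub>k)\<^sub>x\<close>, the evolution of the first column of the moving frame \<open>g\<close> propagates
  to all of them: if \<open>(g e\<^sub>k)\<^sub>t = g Z e\<^sub>k\<close>, then \<open>(g e\<^sub>k\<^sub>+\<^sub>1)\<^sub>t = (g Z e\<^sub>k)\<^sub>x = g (Z\<^sub>x + (b + u) Z) e\<^sub>k = g Z e\<^sub>k\<^sub>+\<^sub>1\<close>.\<close>

lemma curve_flow_frame_evolution:
  assumes n: "n \<ge> 2" and \<beta>: "curve_flow_solution n j \<beta>"
  shows "mat_deriv n (\<lambda>s. moving_frame n (\<lambda>y. \<beta> y s) x) t
      = moving_frame n (\<lambda>y. \<beta> y t) x * Z_mat n j (curvature n (\<lambda>y. \<beta> y t)) x"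
proof -
  have sm: "smooth_vec n (\<lambda>(x, t). \<beta> x t)" and \<beta>c: "(\<lambda>x. \<beta> x t) \<in> central_affine_curves n" for t
    using \<beta> by (simp_all add: curve_flow_solution_def)
  let ?H = "\<lambda>x t. moving_frame n (\<lambda>y. \<beta> y t) x"
  let ?v = "curvature n (\<lambda>y. \<beta> y t)"
  let ?Z = "Z_mat n j ?v"
  have v: "smooth_mat n ?v" "?v x \<in> V_space n" for x
    using smooth_mat_slices(1)[OF smooth_curvature_joint[OF n sm \<beta>c], of t]
      curvature_properties(2)[OF n \<beta>c] by auto
  note Z = Z_mat_properties[where u = ?v, OF n v, of j]
  note Zc = smooth_mat_carrier[OF Z(1)]
  have Hs: "smooth_mat n (\<lambda>x. ?H x t)"
    using smooth_moving_frame[OF central_affine_curvesD(1)[OF \<beta>c]] .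
  have vc: "?v x \<in> carrier_mat n n" for x
    by (rule V_space_carrier[OF v(2)])
  have Hi: "?H x s $$ (i, k) = (vec_deriv n ^^ k) (\<lambda>y. \<beta> y s) x $ i" if "i < n" "k < n" for x s i k
    using that by (simp add: moving_frame_def)
  have col: "deriv (\<lambda>s. ?H x s $$ (i, k)) t = (?H x t * ?Z x) $$ (i, k)" if "i < n" "k < n" for x i k
    using that
  proof (induction k arbitrary: x)
    case 0
    have "deriv (\<lambda>s. ?H x s $$ (i, 0)) t = vec_deriv n (\<lambda>s. \<beta> x s) t $ i"
      using 0 by (simp add: Hi vec_deriv_def)
    also have "\<dots> = (?H x t *\<^sub>v (?Z x *\<^sub>v unit_vec n 0)) $ i"
      using \<beta> by (simp add: curve_flow_solution_def)
    also have "?H x t *\<^sub>v (?Z x *\<^sub>v unit_vec n 0) = (?H x t * ?Z x) *\<^sub>v unit_vec n 0"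
      using assoc_mult_mat_vec[OF moving_frame_carrier Zc unit_vec_carrier] by simp
    also have "\<dots> $ i = (?H x t * ?Z x) $$ (i, 0)"
      using 0 carrier_matD[OF mult_carrier_mat[OF moving_frame_carrier[of n "\<lambda>y. \<beta> y t" x] Zc[of x]]]
      by (simp add: scalar_prod_right_unit row_def del: index_mult_mat(1))
    finally show ?case .
  next
    case (Suc k)
    then have k: "k < n" "k < n - 1" by auto
    have "?H x s $$ (i, Suc k) = deriv (\<lambda>y. ?H y s $$ (i, k)) x" for s
      using Suc.prems k by (simp add: Hi vec_deriv_def)
    then have "deriv (\<lambda>s. ?H x s $$ (i, Suc k)) t = deriv (\<lambda>s. deriv (\<lambda>y. ?H y s $$ (i, k)) x) t"
      by simp
    \<comment> \<open>With the two derivatives exchanged, the induction hypothesis for column k,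
      valid at every point y, can be inserted under the x-derivative.\<close>
    also have "\<dots> = deriv (\<lambda>y. deriv (\<lambda>s. ?H y s $$ (i, k)) t) x"
      using smooth_mat_entry[OF smooth_moving_frame_joint[OF sm] Suc.prems(1) k(1)]
      by (intro smooth_mixed_partials) (simp add: case_prod_unfold)
    also have "\<dots> = mat_deriv n (\<lambda>y. ?H y t * ?Z y) x $$ (i, k)"
      using Suc.IH[OF Suc.prems(1) k(1)] Suc.prems k by (simp add: mat_deriv_def del: index_mult_mat(1))
    also have "mat_deriv n (\<lambda>y. ?H y t * ?Z y) x
        = ?H x t * ((b_mat n + ?v x) * ?Z x) + ?H x t * mat_deriv n ?Z x"
      unfolding mat_deriv_mult[OF Hs Z(1)] curvature_properties(3)[OF n \<beta>c]
      using vc[of x] Zc[of x] by (simp add: assoc_mult_mat[of _ n n _ n _ n])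
    also have "\<dots> = ?H x t * ((b_mat n + ?v x) * ?Z x + mat_deriv n ?Z x)"
      using vc[of x] Zc[of x]
      by (intro mult_add_distrib_mat[symmetric, of _ n n _ n] mult_carrier_mat[of _ n n _ n]) auto
    also have "\<dots> $$ (i, k) = (\<Sum>q<n. ?H x t $$ (i, q) * ((b_mat n + ?v x) * ?Z x + mat_deriv n ?Z x) $$ (q, k))"
      using Suc.prems k carrier_matD[OF moving_frame_carrier[of n "\<lambda>y. \<beta> y t" x]] vc[of x] Zc[of x]
        carrier_matD[OF mat_deriv_carrier[of n ?Z x]]
      by (subst index_mult_mat(1)) (auto simp: scalar_prod_def lessThan_atLeast0 simp del: index_mult_mat(1) index_add_mat(1))
    also have "\<dots> = (\<Sum>q<n. ?H x t $$ (i, q) * ?Z x $$ (q, Suc k))"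
    proof (intro sum.cong refl)
      fix q assume "q \<in> {..<n}"
      then have q: "q < n" by simp
      have "?Z x $$ (q, Suc k) = deriv (\<lambda>y. ?Z y $$ (q, k)) x + ((b_mat n + ?v x) * ?Z x) $$ (q, k)"
        by (rule dx_commutator_V_space_column[OF Zc v(2) Z(2) q k(2)])
      then show "?H x t $$ (i, q) * ((b_mat n + ?v x) * ?Z x + mat_deriv n ?Z x) $$ (q, k)
          = ?H x t $$ (i, q) * ?Z x $$ (q, Suc k)"
        using q k(1) carrier_matD[OF Zc[of x]] carrier_matD[OF vc[of x]]
        by (simp add: mat_deriv_def del: index_mult_mat(1))
    qed
    also have "\<dots> = (?H x t * ?Z x) $$ (i, Suc k)"
      using Suc.prems carrier_matD[OF moving_frame_carrier[of n "\<lambda>y. \<beta> y t" x]] carrier_matD[OF Zc[of x]]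
      by (simp add: scalar_prod_def lessThan_atLeast0)
    finally show ?case .
  qed
  show ?thesis
  proof (rule eq_matI)
    fix i k assume "i < dim_row (?H x t * ?Z x)" "k < dim_col (?H x t * ?Z x)"
    then have "i < n" "k < n"
      using carrier_matD[OF moving_frame_carrier[of n "\<lambda>y. \<beta> y t" x]] carrier_matD[OF Zc[of x]] by auto
    then show "mat_deriv n (\<lambda>s. ?H x s) t $$ (i, k) = (?H x t * ?Z x) $$ (i, k)"
      using col by (simp add: mat_deriv_def del: index_mult_mat(1))
  qed (use carrier_matD[OF moving_frame_carrier[of n "\<lambda>y. \<beta> y t" x]] carrier_matD[OF Zc[of x]] in
      \<open>auto simp: mat_deriv_def\<close>)
qed

text \<open>Zero curvature: for the frame H and B = b + v, equality of mixed partials reads (H B)_t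
  = (H Z)_x. Expanding with H_x = H B and H_t = H Z and cancelling the invertible H leaves v_t = Z_x
  + [B, Z]. Decay enters because \<open>kdv_solution\<close> includes it.\<close>

lemma curve_flow_curvature_kdv:
  assumes n: "n \<ge> 2" and \<beta>: "curve_flow_solution n j \<beta>"
    and decay: "\<And>t. rapidly_decaying_mat n (curvature n (\<lambda>x. \<beta> x t))"
  shows "kdv_solution n j (\<lambda>x t. curvature n (\<lambda>y. \<beta> y t) x)"
proof -
  have sm: "smooth_vec n (\<lambda>(x, t). \<beta> x t)" and \<beta>c: "(\<lambda>x. \<beta> x t) \<in> central_affine_curves n" for t
    using \<beta> by (simp_all add: curve_flow_solution_def)
  let ?H = "\<lambda>x t. moving_frame n (\<lambda>y. \<beta> y t) x"
  let ?v = "\<lambda>x t. curvature n (\<lambda>y. \<beta> y t) x"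
  let ?B = "\<lambda>x t. b_mat n + ?v x t"
  note vj = smooth_curvature_joint[OF n sm \<beta>c]
  note V = curvature_properties(2)[OF n \<beta>c]
  have "mat_deriv n (\<lambda>s. ?v x s) t = dx_commutator n (\<lambda>y. ?B y t) (Z_mat n j (\<lambda>y. ?v y t)) x" for x t
  proof -
    let ?Z = "Z_mat n j (\<lambda>y. ?v y t)"
    note Z = Z_mat_properties[where u = "\<lambda>y. ?v y t", OF n smooth_mat_slices(1)[OF vj] V, of j]
    note Zc = smooth_mat_carrier[OF Z(1)]
    note Hj = smooth_moving_frame_joint[OF sm]
    note inv = adj_mat_inverse[OF moving_frame_carrier central_affine_curvesD(2)[OF \<beta>c]]
    let ?q = "adj_mat (?H x t)"
    have Bc: "?B x t \<in> carrier_mat n n"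
      using V_space_carrier[OF V, of t x] by simp
    have Bs: "smooth_mat n (\<lambda>s. ?B x s)"
      by (intro smooth_mat_add smooth_mat_const smooth_mat_slices(2)[OF vj]) simp
    have ev: "mat_deriv n (\<lambda>s. ?H y s) t = ?H y t * ?Z y" for y
      by (rule curve_flow_frame_evolution[OF n \<beta>])
    have fr: "mat_deriv n (\<lambda>y. ?H y s) x = ?H x s * ?B x s" for s
      by (rule curvature_properties(3)[OF n \<beta>c])
    have "mat_deriv n (\<lambda>s. ?H x s * ?B x s) t = mat_deriv n (\<lambda>y. ?H y t * ?Z y) x"
    proof (rule eq_matI)
      fix i k assume "i < dim_row (mat_deriv n (\<lambda>y. ?H y t * ?Z y) x)" "k < dim_col (mat_deriv n (\<lambda>y. ?H y t * ?Z y) x)"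
      then have ik: "i < n" "k < n" by (auto simp: mat_deriv_def)
      have 1: "(?H x s * ?B x s) $$ (i, k) = deriv (\<lambda>y. ?H y s $$ (i, k)) x" for s
        using ik by (simp add: fr[symmetric] mat_deriv_def del: index_mult_mat(1))
      have 2: "(?H y t * ?Z y) $$ (i, k) = deriv (\<lambda>s. ?H y s $$ (i, k)) t" for y
        using ik by (simp add: ev[symmetric] mat_deriv_def del: index_mult_mat(1))
      have "deriv (\<lambda>s. deriv (\<lambda>y. ?H y s $$ (i, k)) x) t = deriv (\<lambda>y. deriv (\<lambda>s. ?H y s $$ (i, k)) t) x"
        using smooth_mat_entry[OF Hj ik] by (intro smooth_mixed_partials) (simp add: case_prod_unfold)
      then show "mat_deriv n (\<lambda>s. ?H x s * ?B x s) t $$ (i, k) = mat_deriv n (\<lambda>y. ?H y t * ?Z y) x $$ (i, k)"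
        unfolding mat_deriv_def index_mat(1)[OF ik] prod.case 1 2 .
    qed (auto simp: mat_deriv_def)
    moreover have "mat_deriv n (\<lambda>s. ?H x s * ?B x s) t = ?H x t * (?Z x * ?B x t) + ?H x t * mat_deriv n (\<lambda>s. ?B x s) t"
      unfolding mat_deriv_mult[OF smooth_mat_slices(2)[OF Hj] Bs] ev
      using Bc Zc[of x] by (simp add: assoc_mult_mat[of _ n n _ n _ n])
    moreover have "mat_deriv n (\<lambda>y. ?H y t * ?Z y) x = ?H x t * (?B x t * ?Z x) + ?H x t * mat_deriv n ?Z x"
      unfolding mat_deriv_mult[OF smooth_mat_slices(1)[OF Hj] Z(1)] fr
      using Bc Zc[of x] by (simp add: assoc_mult_mat[of _ n n _ n _ n])
    ultimately have "?H x t * (?Z x * ?B x t + mat_deriv n (\<lambda>s. ?B x s) t) = ?H x t * (?B x t * ?Z x + mat_deriv n ?Z x)"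
      using Bc Zc[of x] by (simp add: mult_add_distrib_mat[of _ n n _ n] mult_carrier_mat[of _ n n _ n])
    then have "?q * (?H x t * (?Z x * ?B x t + mat_deriv n (\<lambda>s. ?B x s) t)) = ?q * (?H x t * (?B x t * ?Z x + mat_deriv n ?Z x))"
      by simp
    \<comment> \<open>Cancellation of the frame, with the adjugate acting as its inverse.\<close>
    moreover have "?q * (?H x t * M) = M" if "M \<in> carrier_mat n n" for M
      using assoc_mult_mat[OF inv(3) moving_frame_carrier that, of t x "\<lambda>y. \<beta> y t" x]
        inv(2)[of t x] left_mult_one_mat[OF that] by simp
    ultimately have eq: "?Z x * ?B x t + mat_deriv n (\<lambda>s. ?B x s) t = ?B x t * ?Z x + mat_deriv n ?Z x"
      using Bc Zc[of x] by (simp add: mult_carrier_mat[of _ n n _ n])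
    have "mat_deriv n (\<lambda>s. ?B x s) t = mat_deriv n (\<lambda>s. ?v x s) t"
    proof (rule eq_matI)
      fix i k assume "i < dim_row (mat_deriv n (\<lambda>s. ?v x s) t)" "k < dim_col (mat_deriv n (\<lambda>s. ?v x s) t)"
      then have ik: "i < n" "k < n" by (auto simp: mat_deriv_def)
      have "?B x s $$ (i, k) = b_mat n $$ (i, k) + ?v x s $$ (i, k)" for s
        using ik V_space_carrier[OF V, of s x] by simp
      moreover have "((\<lambda>s. b_mat n $$ (i, k) + ?v x s $$ (i, k)) has_real_derivative
          0 + deriv (\<lambda>s. ?v x s $$ (i, k)) t) (at t)"
        by (intro DERIV_add DERIV_const smooth_deriv_real smooth_mat_entry[OF smooth_mat_slices(2)[OF vj] ik])
      ultimately show "mat_deriv n (\<lambda>s. ?B x s) t $$ (i, k) = mat_deriv n (\<lambda>s. ?v x s) t $$ (i, k)"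
        using ik by (simp add: mat_deriv_def DERIV_imp_deriv)
    qed (auto simp: mat_deriv_def)
    note vt = eq[unfolded this]
    show ?thesis
    proof (rule eq_matI)
      have c: "?Z x * ?B x t \<in> carrier_mat n n" "?B x t * ?Z x \<in> carrier_mat n n"
        using Bc Zc[of x] by (auto simp: mult_carrier_mat[of _ n n _ n])
      note d = carrier_matD[OF c(1)] carrier_matD[OF c(2)] carrier_matD[OF mat_deriv_carrier[of n ?Z x]]
        carrier_matD[OF mat_deriv_carrier[of n "\<lambda>s. ?v x s" t]]
      fix i k assume "i < dim_row (dx_commutator n (\<lambda>y. ?B y t) ?Z x)" "k < dim_col (dx_commutator n (\<lambda>y. ?B y t) ?Z x)"
      then have ik: "i < n" "k < n"
        using d by (auto simp: dx_commutator_def commutator_def)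
      have "(?Z x * ?B x t + mat_deriv n (\<lambda>s. ?v x s) t) $$ (i, k) = (?B x t * ?Z x + mat_deriv n ?Z x) $$ (i, k)"
        by (simp only: vt)
      then show "mat_deriv n (\<lambda>s. ?v x s) t $$ (i, k) = dx_commutator n (\<lambda>y. ?B y t) ?Z x $$ (i, k)"
        using ik d by (simp add: dx_commutator_def commutator_def del: index_mult_mat)
    qed (use carrier_matD[OF Bc] carrier_matD[OF Zc[of x]] in
        \<open>auto simp: mat_deriv_def dx_commutator_def commutator_def\<close>)
  qed
  then show ?thesis
    unfolding kdv_solution_def using vj V decay by blast
qed

text \<open>That \<gamma> is "the" solution is meant relative to the KdV problem: if the Cauchy
  problem determines u in the rapidly decaying class, then \<gamma> is the only curve flow with this
  initial curve whose curvatures decay rapidly at every time.\<close>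

theorem theorem3p4:
  fixes n j :: nat
    and \<gamma>0 :: "real \<Rightarrow> real vec"
    and u g :: "real \<Rightarrow> real \<Rightarrow> real mat"
    and \<gamma> :: "real \<Rightarrow> real \<Rightarrow> real vec"
  assumes "n \<ge> 2" and "j \<ge> 1" and "j mod n \<noteq> 0"
    and "\<gamma>0 \<in> central_affine_curves n"
    and "rapidly_decaying_mat n (curvature n \<gamma>0)"
    and "kdv_solution n j u"
    and "\<forall>x. u x 0 = curvature n \<gamma>0 x"
    and "frame_solution n j u g"
    and "g 0 0 = moving_frame n \<gamma>0 0"
    and "\<forall>x t. \<gamma> x t = g x t *\<^sub>v unit_vec n 0"
  shows "curve_flow_solution n j \<gamma> \<and>
         (\<forall>x. \<gamma> x 0 = \<gamma>0 x) \<and>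
         (\<forall>t. rapidly_decaying_mat n (curvature n (\<lambda>x. \<gamma> x t))) \<and>
         ((\<forall>v. kdv_solution n j v \<and> (\<forall>x. v x 0 = curvature n \<gamma>0 x) \<longrightarrow> v = u) \<longrightarrow>
          (\<forall>\<beta>. curve_flow_solution n j \<beta> \<and> (\<forall>x. \<beta> x 0 = \<gamma>0 x) \<and>
               (\<forall>t. rapidly_decaying_mat n (curvature n (\<lambda>x. \<beta> x t))) \<longrightarrow> \<beta> = \<gamma>))"
proof -
  note n = assms(1) and \<gamma>0 = assms(4) and kdv = assms(6) and u0 = assms(7) and init = assms(9)
  have n0: "n > 0" using n by simp
  have V: "u x t \<in> V_space n" and uj: "smooth_mat n (\<lambda>(x, t). u x t)"
    and decay: "rapidly_decaying_mat n (\<lambda>x. u x t)" for x t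
    using kdv by (simp_all add: kdv_solution_def)
  have gj: "smooth_mat n (\<lambda>(x, t). g x t)" and det: "det (g x t) = 1"
    and gx: "mat_deriv n (\<lambda>y. g y t) x = g x t * (b_mat n + u x t)"
    and gt: "mat_deriv n (\<lambda>s. g x s) t = g x t * Z_mat n j (\<lambda>y. u y t) x" for x t
    using assms(8) by (simp_all add: frame_solution_def)
  have \<gamma>: "\<gamma> x t = g x t *\<^sub>v unit_vec n 0" for x t
    using assms(10) by simp
  have gc: "g x t \<in> carrier_mat n n" for x t
    using smooth_mat_carrier[OF gj, of "(x, t)"] by simp
  have curve: "(\<lambda>x. \<gamma> x t) \<in> central_affine_curves n"
    and frame: "moving_frame n (\<lambda>x. \<gamma> x t) = (\<lambda>x. g x t)"
    and curv: "curvature n (\<lambda>x. \<gamma> x t) = (\<lambda>x. u x t)" for t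
    by (rule curve_of_frame[where g = "\<lambda>x. g x t" and u = "\<lambda>x. u x t",
          OF n smooth_mat_slices(1)[OF gj] det V gx \<gamma>])+
  have Zc: "Z_mat n j (\<lambda>y. u y t) x \<in> carrier_mat n n" for x t
    using smooth_mat_carrier[OF Z_mat_properties(1)[OF n smooth_mat_slices(1)[OF uj] V]] .
  have \<gamma>i: "\<gamma> x t $ i = g x t $$ (i, 0)" if "i < n" for x t i
    using that n0 carrier_matD[OF gc[of x t]] by (simp add: \<gamma> scalar_prod_right_unit)
  have \<gamma>d: "dim_vec (\<gamma> x t) = n" for x t
    using carrier_matD[OF gc[of x t]] by (simp add: \<gamma>)
  have sol: "curve_flow_solution n j \<gamma>"
    unfolding curve_flow_solution_def
  proof (intro conjI allI)
    show "smooth_vec n (\<lambda>(x, t). \<gamma> x t)"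
      unfolding smooth_vec_def
    proof (intro conjI allI impI)
      show "(case p of (x, t) \<Rightarrow> \<gamma> x t) \<in> carrier_vec n" for p
        by (cases p) (simp add: carrier_vecI[OF \<gamma>d])
      show "smooth (\<lambda>p. (case p of (x, t) \<Rightarrow> \<gamma> x t) $ i)" if "i < n" for i
        using smooth_mat_entry[OF gj that n0] that by (simp add: case_prod_unfold \<gamma>i)
    qed
    show "(\<lambda>x. \<gamma> x t) \<in> central_affine_curves n" for t
      by (rule curve)
    fix x t
    let ?Z = "Z_mat n j (\<lambda>y. u y t) x"
    have gZ: "g x t * ?Z \<in> carrier_mat n n"
      using gc Zc by (rule mult_carrier_mat)
    have "vec_deriv n (\<lambda>s. \<gamma> x s) t = (g x t * ?Z) *\<^sub>v unit_vec n 0"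
    proof (rule eq_vecI)
      fix i assume "i < dim_vec ((g x t * ?Z) *\<^sub>v unit_vec n 0)"
      then have i: "i < n" using carrier_matD[OF gZ] by simp
      have "vec_deriv n (\<lambda>s. \<gamma> x s) t $ i = mat_deriv n (\<lambda>s. g x s) t $$ (i, 0)"
        using i n0 by (simp add: vec_deriv_def mat_deriv_def \<gamma>i)
      also have "\<dots> = ((g x t * ?Z) *\<^sub>v unit_vec n 0) $ i"
        unfolding gt using i n0 carrier_matD[OF gZ]
        by (simp add: scalar_prod_right_unit row_def del: index_mult_mat(1))
      finally show "vec_deriv n (\<lambda>s. \<gamma> x s) t $ i = ((g x t * ?Z) *\<^sub>v unit_vec n 0) $ i" .
    qed (use carrier_matD[OF gZ] in \<open>simp add: vec_deriv_def\<close>)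
    then show "vec_deriv n (\<lambda>s. \<gamma> x s) t = moving_frame n (\<lambda>y. \<gamma> y t) x
        *\<^sub>v (Z_mat n j (curvature n (\<lambda>y. \<gamma> y t)) x *\<^sub>v unit_vec n 0)"
      unfolding frame curv assoc_mult_mat_vec[OF gc Zc unit_vec_carrier] .
  qed
  \<comment> \<open>At t = 0 both frames solve the same linear equation in x and agree at x =
    0.\<close>
  have g0: "g x 0 = moving_frame n \<gamma>0 x" for x
  proof (rule linear_ode_unique[where M = "\<lambda>x. b_mat n + u x 0" and a = 0 and h = "\<lambda>x. g x 0"])
    show "smooth_mat n (\<lambda>x. g x 0)"
      by (rule smooth_mat_slices(1)[OF gj])
    show "smooth_mat n (moving_frame n \<gamma>0)"
      by (rule smooth_moving_frame[OF central_affine_curvesD(1)[OF \<gamma>0]])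
    show "mat_deriv n (moving_frame n \<gamma>0) t = moving_frame n \<gamma>0 t * (b_mat n + u t 0)" for t
      using curvature_properties(3)[OF n \<gamma>0] u0 by simp
    show "b_mat n + u t 0 \<in> carrier_mat n n" for t
      using V_space_carrier[OF V] by simp
  qed (use central_affine_curvesD(2)[OF \<gamma>0] gx init in auto)
  have \<gamma>_init: "\<gamma> x 0 = \<gamma>0 x" for x
  proof (rule eq_vecI)
    show "dim_vec (\<gamma> x 0) = dim_vec (\<gamma>0 x)"
      using \<gamma>d smooth_vec_carrier[OF central_affine_curvesD(1)[OF \<gamma>0], of x] by simp
    fix i assume "i < dim_vec (\<gamma>0 x)"
    then have "i < n"
      using smooth_vec_carrier[OF central_affine_curvesD(1)[OF \<gamma>0], of x] by simp
    then show "\<gamma> x 0 $ i = \<gamma>0 x $ i"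
      using n0 by (simp add: \<gamma>i g0) (simp add: moving_frame_def)
  qed
  have unique: "\<beta> = \<gamma>"
    if uniq: "\<forall>v. kdv_solution n j v \<and> (\<forall>x. v x 0 = curvature n \<gamma>0 x) \<longrightarrow> v = u"
      and \<beta>: "curve_flow_solution n j \<beta>" and \<beta>0: "\<forall>x. \<beta> x 0 = \<gamma>0 x"
      and \<beta>d: "\<forall>t. rapidly_decaying_mat n (curvature n (\<lambda>x. \<beta> x t))" for \<beta>
  proof -
    have sm: "smooth_vec n (\<lambda>(x, t). \<beta> x t)" and \<beta>c: "(\<lambda>x. \<beta> x t) \<in> central_affine_curves n" for t
      using \<beta> by (simp_all add: curve_flow_solution_def)
    have "(\<lambda>x. \<beta> x 0) = \<gamma>0"
      using \<beta>0 by blast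
    then have "(\<lambda>x t. curvature n (\<lambda>y. \<beta> y t) x) = u"
      using uniq curve_flow_curvature_kdv[OF n \<beta>] \<beta>d by simp
    then have v: "curvature n (\<lambda>y. \<beta> y t) = (\<lambda>y. u y t)" for t
      by (auto simp: fun_eq_iff)
    \<comment> \<open>Now x is fixed and t varies: both curves have curvature u, so their frames
      solve the same linear equation in t, and they agree at t = 0 by \<open>g0\<close>.\<close>
    have H: "moving_frame n (\<lambda>y. \<beta> y t) x = g x t" for x t
    proof (rule linear_ode_unique[where M = "\<lambda>t. Z_mat n j (\<lambda>y. u y t) x" and a = 0
          and h = "\<lambda>t. moving_frame n (\<lambda>y. \<beta> y t) x" and g = "\<lambda>t. g x t"])
      show "smooth_mat n (\<lambda>t. moving_frame n (\<lambda>y. \<beta> y t) x)"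
        by (rule smooth_mat_slices(2)[OF smooth_moving_frame_joint[OF sm]])
      show "smooth_mat n (g x)"
        using smooth_mat_slices(2)[OF gj] .
      show "mat_deriv n (\<lambda>t. moving_frame n (\<lambda>y. \<beta> y t) x) t
          = moving_frame n (\<lambda>y. \<beta> y t) x * Z_mat n j (\<lambda>y. u y t) x" for t
        using curve_flow_frame_evolution[OF n \<beta>, of x t] by (simp add: v)
      show "mat_deriv n (g x) t = g x t * Z_mat n j (\<lambda>y. u y t) x" for t
        by (rule gt)
      show "moving_frame n (\<lambda>y. \<beta> y 0) x = g x 0"
        using \<open>(\<lambda>x. \<beta> x 0) = \<gamma>0\<close> by (simp add: g0)
    qed (use det Zc in auto)
    have "\<beta> x t = \<gamma> x t" for x t
    proof (rule eq_vecI)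
      have d: "dim_vec (\<beta> x t) = n"
        using smooth_vec_carrier[OF sm, of "(x, t)"] by simp
      then show "dim_vec (\<beta> x t) = dim_vec (\<gamma> x t)"
        using \<gamma>d by simp
      fix i assume "i < dim_vec (\<gamma> x t)"
      then have "i < n" by (simp add: \<gamma>d)
      then show "\<beta> x t $ i = \<gamma> x t $ i"
        using n0 by (simp add: \<gamma>i H[symmetric]) (simp add: moving_frame_def)
    qed
    then show ?thesis by blast
  qed
  show ?thesis
    using sol \<gamma>_init decay unique unfolding curv by blast
qed

end
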